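(* Let $A$ and $B$ be finitely generated nilpotent groups, let $C_A\le A$ and $C_B\le B$ be cyclic subgroups, and let $\phi:C_A\to C_B$ be an isomorphism. Then the generalized free product $G=\{A*B;\ C_A=C_B\}$ of $A$ and $B$ amalgamating $C_A$ with $C_B$ via $\phi$ is residually solvable.
   Context: The generalized free product (amalgamated product) $\{A*B;\ C_A=C_B\}$ is the quotient of the free product $A*B$ by the normal closure of the elements $c\,(\phi(c))^{-1}$, $c\in C_A$. A group $G$ is residually solvable if for every non-identity $g\in G$ there is a homomorphism from $G$ onto a solvable group under which the image of $g$ is not the identity. *)

theory Defs
  imports "HOL-Algebra.Elementary_Groups" "HOL-Algebra.Solvable_Groups"
begin

section \<open>Finitely generated and nilpotent groups\<close>

definition finitely_generated_group :: "('a, 'm) monoid_scheme \<Rightarrow> bool" where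
  "finitely_generated_group G \<longleftrightarrow>
     (\<exists>S. finite S \<and> S \<subseteq> carrier G \<and> generate G S = carrier G)"

definition commutator_subgroup ::
    "('a, 'm) monoid_scheme \<Rightarrow> 'a set \<Rightarrow> 'a set \<Rightarrow> 'a set" where
  "commutator_subgroup G H K =
     generate G (\<Union>h \<in> H. \<Union>k \<in> K. {h \<otimes>\<^bsub>G\<^esub> k \<otimes>\<^bsub>G\<^esub> inv\<^bsub>G\<^esub> h \<otimes>\<^bsub>G\<^esub> inv\<^bsub>G\<^esub> k})"

primrec lower_central_series :: "('a, 'm) monoid_scheme \<Rightarrow> nat \<Rightarrow> 'a set" where
  "lower_central_series G 0 = carrier G"
| "lower_central_series G (Suc n) =
     commutator_subgroup G (lower_central_series G n) (carrier G)"

definition nilpotent_group :: "('a, 'm) monoid_scheme \<Rightarrow> bool" where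
  "nilpotent_group G \<longleftrightarrow> (\<exists>n. lower_central_series G n = {\<one>\<^bsub>G\<^esub>})"

section \<open>Residually solvable groups\<close>

text \<open>
  A homomorphic image of \<open>G\<close> is isomorphic to a quotient of \<open>G\<close>, whose elements are subsets of
  \<open>carrier G\<close>.  Solvable images over the type \<open>'a set\<close> are therefore all that is needed;
  lemma \<open>residually_solvableI\<close> shows that images over any other type yield the same notion.
\<close>

definition residually_solvable :: "('a, 'm) monoid_scheme \<Rightarrow> bool" where
  "residually_solvable G \<longleftrightarrow>
     (\<forall>g \<in> carrier G. g \<noteq> \<one>\<^bsub>G\<^esub> \<longrightarrow>
        (\<exists>(H :: 'a set monoid) f.
           group H \<and> solvable H \<and> f \<in> epi G H \<and> f g \<noteq> \<one>\<^bsub>H\<^esub>))"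

lemma (in group) residually_solvableI:
  assumes "\<And>g. \<lbrakk>g \<in> carrier G; g \<noteq> \<one>\<rbrakk> \<Longrightarrow>
      \<exists>(H :: 'c monoid) f. group H \<and> solvable H \<and> f \<in> epi G H \<and> f g \<noteq> \<one>\<^bsub>H\<^esub>"
  shows "residually_solvable G"
  unfolding residually_solvable_def
proof (intro ballI impI)
  fix g assume g: "g \<in> carrier G" "g \<noteq> \<one>"
  then obtain H :: "'c monoid" and f
    where H: "group H" "solvable H" and f: "f \<in> epi G H" and fg: "f g \<noteq> \<one>\<^bsub>H\<^esub>"
    using assms by blast
  have hom: "group_hom G H f"
    using H(1) f by (auto simp: group_hom_def group_hom_axioms_def epi_def is_group)
  let ?K = "kernel G H f"
  have K: "?K \<lhd> G"
    by (rule group_hom.normal_kernel[OF hom])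
  have surj: "f ` carrier G = carrier H"
    using f by (simp add: epi_def)
  have iso: "(\<lambda>X. the_elem (f ` X)) \<in> iso (G Mod ?K) H"
    by (rule group_hom.FactGroup_iso_set[OF hom surj])
  have Q: "group (G Mod ?K)"
    by (rule normal.factorgroup_is_group[OF K])
  have "group_hom (G Mod ?K) H (\<lambda>X. the_elem (f ` X))"
    using iso Q H(1) by (auto simp: group_hom_def group_hom_axioms_def iso_def)
  moreover have "inj_on (\<lambda>X. the_elem (f ` X)) (carrier (G Mod ?K))"
    using iso by (auto simp: iso_def bij_betw_def)
  ultimately have "solvable (G Mod ?K)"
    using H(2) group_hom.inj_hom_imp_solvable by blast
  moreover have "(\<lambda>x. ?K #> x) \<in> epi G (G Mod ?K)"
    using normal.r_coset_hom_Mod[OF K] by (auto simp: epi_def FactGroup_def RCOSETS_def)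
  moreover have "?K #> g \<noteq> \<one>\<^bsub>G Mod ?K\<^esub>"
  proof
    assume "?K #> g = \<one>\<^bsub>G Mod ?K\<^esub>"
    then have "g \<in> ?K"
      using g(1) K by (simp add: FactGroup_def)
        (metis normal_imp_subgroup rcos_self)
    then show False
      using fg by (simp add: kernel_def)
  qed
  ultimately show "\<exists>(Q :: 'a set monoid) h.
      group Q \<and> solvable Q \<and> h \<in> epi G Q \<and> h g \<noteq> \<one>\<^bsub>Q\<^esub>"
    using Q by (metis (no_types, lifting))
qed

section \<open>Free products\<close>

text \<open>
  The free product consists of the words in the disjoint union of the two carriers, modulo the
  congruence that deletes identities and multiplies adjacent letters from the same factor.
\<close>

definition free_product_words ::
    "('a, 'm) monoid_scheme \<Rightarrow> ('b, 'n) monoid_scheme \<Rightarrow> ('a + 'b) list set" where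
  "free_product_words A B = lists (carrier A <+> carrier B)"

lemma free_product_words_simps [simp]:
  "[] \<in> free_product_words A B"
  "s # w \<in> free_product_words A B \<longleftrightarrow> s \<in> carrier A <+> carrier B \<and> w \<in> free_product_words A B"
  "u @ v \<in> free_product_words A B \<longleftrightarrow> u \<in> free_product_words A B \<and> v \<in> free_product_words A B"
  by (auto simp: free_product_words_def)

inductive_set free_product_rel ::
    "('a, 'm) monoid_scheme \<Rightarrow> ('b, 'n) monoid_scheme \<Rightarrow> (('a + 'b) list \<times> ('a + 'b) list) set"
  for A B where
  refl: "w \<in> free_product_words A B \<Longrightarrow> (w, w) \<in> free_product_rel A B"
| sym: "(v, w) \<in> free_product_rel A B \<Longrightarrow> (w, v) \<in> free_product_rel A B"
| trans: "\<lbrakk>(u, v) \<in> free_product_rel A B; (v, w) \<in> free_product_rel A B\<rbrakk>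
    \<Longrightarrow> (u, w) \<in> free_product_rel A B"
| one_left: "\<lbrakk>u \<in> free_product_words A B; v \<in> free_product_words A B\<rbrakk>
    \<Longrightarrow> (u @ [Inl \<one>\<^bsub>A\<^esub>] @ v, u @ v) \<in> free_product_rel A B"
| one_right: "\<lbrakk>u \<in> free_product_words A B; v \<in> free_product_words A B\<rbrakk>
    \<Longrightarrow> (u @ [Inr \<one>\<^bsub>B\<^esub>] @ v, u @ v) \<in> free_product_rel A B"
| mult_left: "\<lbrakk>u \<in> free_product_words A B; v \<in> free_product_words A B;
      x \<in> carrier A; y \<in> carrier A\<rbrakk>
    \<Longrightarrow> (u @ [Inl x, Inl y] @ v, u @ [Inl (x \<otimes>\<^bsub>A\<^esub> y)] @ v) \<in> free_product_rel A B"
| mult_right: "\<lbrakk>u \<in> free_product_words A B; v \<in> free_product_words A B;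
      x \<in> carrier B; y \<in> carrier B\<rbrakk>
    \<Longrightarrow> (u @ [Inr x, Inr y] @ v, u @ [Inr (x \<otimes>\<^bsub>B\<^esub> y)] @ v) \<in> free_product_rel A B"

definition free_product ::
    "('a, 'm) monoid_scheme \<Rightarrow> ('b, 'n) monoid_scheme \<Rightarrow> ('a + 'b) list set monoid" where
  "free_product A B =
     \<lparr>carrier = free_product_words A B // free_product_rel A B,
      monoid.mult = (\<lambda>X Y. \<Union>u \<in> X. \<Union>v \<in> Y. free_product_rel A B `` {u @ v}),
      one = free_product_rel A B `` {[]}\<rparr>"

definition free_product_inl ::
    "('a, 'm) monoid_scheme \<Rightarrow> ('b, 'n) monoid_scheme \<Rightarrow> 'a \<Rightarrow> ('a + 'b) list set" where
  "free_product_inl A B a = free_product_rel A B `` {[Inl a]}"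

definition free_product_inr ::
    "('a, 'm) monoid_scheme \<Rightarrow> ('b, 'n) monoid_scheme \<Rightarrow> 'b \<Rightarrow> ('a + 'b) list set" where
  "free_product_inr A B b = free_product_rel A B `` {[Inr b]}"

locale two_groups = A: group A + B: group B for A (structure) and B (structure)
begin

abbreviation (input) "W \<equiv> free_product_words A B"
abbreviation (input) "R \<equiv> free_product_rel A B"

lemma rel_words: "(u, v) \<in> R \<Longrightarrow> u \<in> W \<and> v \<in> W"
  by (induction rule: free_product_rel.induct) auto

lemma equiv_rel: "equiv W R"
  by (auto simp: equiv_def refl_on_def sym_def trans_def
      intro: free_product_rel.refl free_product_rel.sym free_product_rel.trans dest: rel_words)

lemma rel_append_right: "(u, v) \<in> R \<Longrightarrow> w \<in> W \<Longrightarrow> (u @ w, v @ w) \<in> R"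
proof (induction rule: free_product_rel.induct)
  case (one_left u v)
  then show ?case using free_product_rel.one_left[of u A B "v @ w"] by simp
next
  case (one_right u v)
  then show ?case using free_product_rel.one_right[of u A B "v @ w"] by simp
next
  case (mult_left u v x y)
  then show ?case using free_product_rel.mult_left[of u A B "v @ w"] by simp
next
  case (mult_right u v x y)
  then show ?case using free_product_rel.mult_right[of u A B "v @ w"] by simp
next
  case (refl v)
  then show ?case by (intro free_product_rel.refl) simp
next
  case (sym u v)
  show ?case by (rule free_product_rel.sym[OF sym.IH[OF sym.prems]])
next
  case (trans u v v')
  show ?case by (rule free_product_rel.trans[OF trans.IH(1)[OF trans.prems] trans.IH(2)[OF trans.prems]])
qed

lemma rel_append_left: "(u, v) \<in> R \<Longrightarrow> w \<in> W \<Longrightarrow> (w @ u, w @ v) \<in> R"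
proof (induction rule: free_product_rel.induct)
  case (one_left u v)
  then show ?case using free_product_rel.one_left[of "w @ u" A B v] by simp
next
  case (one_right u v)
  then show ?case using free_product_rel.one_right[of "w @ u" A B v] by simp
next
  case (mult_left u v x y)
  then show ?case using free_product_rel.mult_left[of "w @ u" A B v] by simp
next
  case (mult_right u v x y)
  then show ?case using free_product_rel.mult_right[of "w @ u" A B v] by simp
next
  case (refl v)
  then show ?case by (intro free_product_rel.refl) simp
next
  case (sym u v)
  show ?case by (rule free_product_rel.sym[OF sym.IH[OF sym.prems]])
next
  case (trans u v v')
  show ?case by (rule free_product_rel.trans[OF trans.IH(1)[OF trans.prems] trans.IH(2)[OF trans.prems]])
qed

lemma rel_append:
  assumes "(u, u') \<in> R" "(v, v') \<in> R"
  shows "(u @ v, u' @ v') \<in> R"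
  using free_product_rel.trans[OF rel_append_right[OF assms(1)] rel_append_left[OF assms(2)]]
    rel_words[OF assms(1)] rel_words[OF assms(2)] by blast

lemma mult_class:
  assumes "u \<in> W" "v \<in> W"
  shows "R `` {u} \<otimes>\<^bsub>free_product A B\<^esub> R `` {v} = R `` {u @ v}"
proof -
  have "R `` {u' @ v'} = R `` {u @ v}" if "u' \<in> R `` {u}" "v' \<in> R `` {v}" for u' v'
  proof -
    have "(u @ v, u' @ v') \<in> R"
      using that by (auto intro: rel_append)
    then show ?thesis
      using equiv_class_eq[OF equiv_rel] by metis
  qed
  then have "(\<Union>u' \<in> R `` {u}. \<Union>v' \<in> R `` {v}. R `` {u' @ v'})
      = (\<Union>u' \<in> R `` {u}. \<Union>v' \<in> R `` {v}. R `` {u @ v})"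
    by (intro SUP_cong) simp_all
  also have "\<dots> = R `` {u @ v}"
  proof -
    have "u \<in> R `` {u}" "v \<in> R `` {v}"
      using assms equiv_class_self[OF equiv_rel] by simp_all
    then show ?thesis by blast
  qed
  finally show ?thesis
    by (simp add: free_product_def)
qed

lemma carrier_free_product: "carrier (free_product A B) = (\<lambda>w. R `` {w}) ` W"
  by (auto simp: free_product_def quotient_def)

lemma carrier_cases:
  assumes "X \<in> carrier (free_product A B)"
  obtains w where "w \<in> W" "X = R `` {w}"
  using assms by (auto simp: carrier_free_product)

lemma class_in_carrier: "w \<in> W \<Longrightarrow> R `` {w} \<in> carrier (free_product A B)"
  by (auto simp: carrier_free_product)

lemma one_free_product: "\<one>\<^bsub>free_product A B\<^esub> = R `` {[]}"
  by (simp add: free_product_def)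

lemma left_inverse:
  assumes "w \<in> W"
  shows "\<exists>v \<in> W. (v @ w, []) \<in> R"
  using assms
proof (induction w)
  case Nil
  then show ?case by (auto intro!: bexI[of _ "[]"] free_product_rel.refl)
next
  case (Cons a w)
  then obtain v where v: "v \<in> W" "(v @ w, []) \<in> R" by auto
  have w: "w \<in> W" using Cons by auto
  have "\<exists>b. [b] \<in> W \<and> ([b, a], []) \<in> R"
  proof (cases a)
    case (Inl x)
    then have x: "x \<in> carrier A" using Cons by auto
    have "([Inl (inv\<^bsub>A\<^esub> x), Inl x], [Inl \<one>\<^bsub>A\<^esub>]) \<in> R"
      using free_product_rel.mult_left[of "[]" A B "[]" "inv\<^bsub>A\<^esub> x" x] x by simp
    moreover have "([Inl \<one>\<^bsub>A\<^esub>], []) \<in> R"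
      using free_product_rel.one_left[of "[]" A B "[]"] by simp
    ultimately show ?thesis
      using Inl x free_product_rel.trans by (intro exI[of _ "Inl (inv\<^bsub>A\<^esub> x)"]) auto
  next
    case (Inr x)
    then have x: "x \<in> carrier B" using Cons by auto
    have "([Inr (inv\<^bsub>B\<^esub> x), Inr x], [Inr \<one>\<^bsub>B\<^esub>]) \<in> R"
      using free_product_rel.mult_right[of "[]" A B "[]" "inv\<^bsub>B\<^esub> x" x] x by simp
    moreover have "([Inr \<one>\<^bsub>B\<^esub>], []) \<in> R"
      using free_product_rel.one_right[of "[]" A B "[]"] by simp
    ultimately show ?thesis
      using Inr x free_product_rel.trans by (intro exI[of _ "Inr (inv\<^bsub>B\<^esub> x)"]) auto
  qed
  then obtain b where b: "[b] \<in> W" "([b, a], []) \<in> R" by blast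
  have "(v @ ([b, a] @ w), v @ ([] @ w)) \<in> R"
    by (intro rel_append_left rel_append_right b v w)
  then have "((v @ [b]) @ a # w, []) \<in> R"
    using v free_product_rel.trans by fastforce
  then show ?case using v b by (intro bexI[of _ "v @ [b]"]) auto
qed

theorem group_free_product: "group (free_product A B)"
proof (rule groupI)
  fix X assume "X \<in> carrier (free_product A B)"
  then obtain w where w: "w \<in> W" "X = R `` {w}" by (elim carrier_cases)
  then obtain v where v: "v \<in> W" "(v @ w, []) \<in> R" using left_inverse by blast
  then have "R `` {v} \<otimes>\<^bsub>free_product A B\<^esub> X = \<one>\<^bsub>free_product A B\<^esub>"
    using w equiv_class_eq[OF equiv_rel] by (simp add: mult_class one_free_product)
  then show "\<exists>Y \<in> carrier (free_product A B).
      Y \<otimes>\<^bsub>free_product A B\<^esub> X = \<one>\<^bsub>free_product A B\<^esub>"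
    using v class_in_carrier by blast
next
  fix X Y assume "X \<in> carrier (free_product A B)" "Y \<in> carrier (free_product A B)"
  then show "X \<otimes>\<^bsub>free_product A B\<^esub> Y \<in> carrier (free_product A B)"
    by (elim carrier_cases) (simp add: mult_class class_in_carrier)
next
  fix X Y Z
  assume "X \<in> carrier (free_product A B)" "Y \<in> carrier (free_product A B)"
    "Z \<in> carrier (free_product A B)"
  then show "X \<otimes>\<^bsub>free_product A B\<^esub> Y \<otimes>\<^bsub>free_product A B\<^esub> Z
      = X \<otimes>\<^bsub>free_product A B\<^esub> (Y \<otimes>\<^bsub>free_product A B\<^esub> Z)"
    by (elim carrier_cases) (simp add: mult_class)
next
  fix X assume "X \<in> carrier (free_product A B)"
  then show "\<one>\<^bsub>free_product A B\<^esub> \<otimes>\<^bsub>free_product A B\<^esub> X = X"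
    by (elim carrier_cases) (simp add: mult_class one_free_product)
next
  show "\<one>\<^bsub>free_product A B\<^esub> \<in> carrier (free_product A B)"
    by (simp add: one_free_product class_in_carrier)
qed

lemma free_product_inl_hom: "free_product_inl A B \<in> hom A (free_product A B)"
proof (rule homI)
  fix x assume "x \<in> carrier A"
  then show "free_product_inl A B x \<in> carrier (free_product A B)"
    unfolding free_product_inl_def by (intro class_in_carrier) auto
next
  fix x y assume xy: "x \<in> carrier A" "y \<in> carrier A"
  have "R `` {[Inl x]} \<otimes>\<^bsub>free_product A B\<^esub> R `` {[Inl y]} = R `` {[Inl x] @ [Inl y]}"
    using xy by (intro mult_class) auto
  moreover have "R `` {[Inl x, Inl y]} = R `` {[Inl (x \<otimes>\<^bsub>A\<^esub> y)]}"
    using free_product_rel.mult_left[of "[]" A B "[]" x y] xy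
    by (intro equiv_class_eq[OF equiv_rel]) simp
  ultimately show "free_product_inl A B (x \<otimes>\<^bsub>A\<^esub> y)
      = free_product_inl A B x \<otimes>\<^bsub>free_product A B\<^esub> free_product_inl A B y"
    by (simp add: free_product_inl_def)
qed

lemma free_product_inr_hom: "free_product_inr A B \<in> hom B (free_product A B)"
proof (rule homI)
  fix x assume "x \<in> carrier B"
  then show "free_product_inr A B x \<in> carrier (free_product A B)"
    unfolding free_product_inr_def by (intro class_in_carrier) auto
next
  fix x y assume xy: "x \<in> carrier B" "y \<in> carrier B"
  have "R `` {[Inr x]} \<otimes>\<^bsub>free_product A B\<^esub> R `` {[Inr y]} = R `` {[Inr x] @ [Inr y]}"
    using xy by (intro mult_class) auto
  moreover have "R `` {[Inr x, Inr y]} = R `` {[Inr (x \<otimes>\<^bsub>B\<^esub> y)]}"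
    using free_product_rel.mult_right[of "[]" A B "[]" x y] xy
    by (intro equiv_class_eq[OF equiv_rel]) simp
  ultimately show "free_product_inr A B (x \<otimes>\<^bsub>B\<^esub> y)
      = free_product_inr A B x \<otimes>\<^bsub>free_product A B\<^esub> free_product_inr A B y"
    by (simp add: free_product_inr_def)
qed

theorem free_product_universal:
  assumes "group H" and f: "f \<in> hom A H" and g: "g \<in> hom B H"
  shows "\<exists>h \<in> hom (free_product A B) H.
    (\<forall>a \<in> carrier A. h (free_product_inl A B a) = f a) \<and>
    (\<forall>b \<in> carrier B. h (free_product_inr A B b) = g b)"
proof -
  interpret H: group H by fact
  define val where "val = foldr (\<lambda>s y. case_sum f g s \<otimes>\<^bsub>H\<^esub> y)"
  have f_closed: "f x \<in> carrier H" if "x \<in> carrier A" for x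
    using f that by (auto simp: hom_def)
  have g_closed: "g x \<in> carrier H" if "x \<in> carrier B" for x
    using g that by (auto simp: hom_def)
  have f_one: "f \<one>\<^bsub>A\<^esub> = \<one>\<^bsub>H\<^esub>" and g_one: "g \<one>\<^bsub>B\<^esub> = \<one>\<^bsub>H\<^esub>"
    using f g assms(1) hom_one A.is_group B.is_group by blast+
  have closed: "val w z \<in> carrier H" if "w \<in> W" "z \<in> carrier H" for w z
    using that by (induction w) (auto simp: val_def f_closed g_closed)
  have val_append: "val (u @ v) z = val u (val v z)" for u v z
    by (simp add: val_def)
  have val_mult: "val u z = val u \<one>\<^bsub>H\<^esub> \<otimes>\<^bsub>H\<^esub> z" if "u \<in> W" "z \<in> carrier H" for u z
    using that
  proof (induction u)
    case (Cons s u)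
    moreover have "val u \<one>\<^bsub>H\<^esub> \<in> carrier H" using Cons closed by auto
    moreover have "case_sum f g s \<in> carrier H" using Cons f_closed g_closed by (auto split: sum.split)
    ultimately show ?case by (auto simp: val_def H.m_assoc)
  qed (simp add: val_def)
  have val_rel: "val u \<one>\<^bsub>H\<^esub> = val v \<one>\<^bsub>H\<^esub>" if "(u, v) \<in> R" for u v
    using that
  proof (induction rule: free_product_rel.induct)
    case (one_left u v)
    then show ?case using closed[of v "\<one>\<^bsub>H\<^esub>"] f_one
      by (simp add: val_append) (simp add: val_def)
  next
    case (one_right u v)
    then show ?case using closed[of v "\<one>\<^bsub>H\<^esub>"] g_one
      by (simp add: val_append) (simp add: val_def)
  next
    case (mult_left u v x y)
    then show ?case using closed[of v "\<one>\<^bsub>H\<^esub>"] f f_closed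
      by (simp add: val_append) (simp add: val_def hom_def H.m_assoc)
  next
    case (mult_right u v x y)
    then show ?case using closed[of v "\<one>\<^bsub>H\<^esub>"] g g_closed
      by (simp add: val_append) (simp add: val_def hom_def H.m_assoc)
  qed simp_all
  define h where "h X = the_elem ((\<lambda>w. val w \<one>\<^bsub>H\<^esub>) ` X)" for X
  have h: "h (R `` {w}) = val w \<one>\<^bsub>H\<^esub>" if "w \<in> W" for w
  proof -
    have "w \<in> R `` {w}"
      using free_product_rel.refl[OF that] by blast
    moreover have "val v \<one>\<^bsub>H\<^esub> = val w \<one>\<^bsub>H\<^esub>" if "v \<in> R `` {w}" for v
      using that val_rel[of w v] by simp
    ultimately have "(\<lambda>w. val w \<one>\<^bsub>H\<^esub>) ` (R `` {w}) = {val w \<one>\<^bsub>H\<^esub>}"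
      by blast
    then show ?thesis by (simp add: h_def)
  qed
  have "h \<in> hom (free_product A B) H"
  proof (rule homI)
    fix X assume "X \<in> carrier (free_product A B)"
    then show "h X \<in> carrier H"
      by (elim carrier_cases) (simp add: h closed)
  next
    fix X Y assume "X \<in> carrier (free_product A B)" "Y \<in> carrier (free_product A B)"
    then obtain u v where "u \<in> W" "X = R `` {u}" "v \<in> W" "Y = R `` {v}"
      by (elim carrier_cases)
    then show "h (X \<otimes>\<^bsub>free_product A B\<^esub> Y) = h X \<otimes>\<^bsub>H\<^esub> h Y"
      using val_mult[of u "val v \<one>\<^bsub>H\<^esub>"] by (simp add: h mult_class val_append closed)
  qed
  moreover have "h (free_product_inl A B a) = f a" if "a \<in> carrier A" for a
    using that by (simp add: free_product_inl_def h InlI) (simp add: val_def f_closed)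
  moreover have "h (free_product_inr A B b) = g b" if "b \<in> carrier B" for b
    using that by (simp add: free_product_inr_def h InrI) (simp add: val_def g_closed)
  ultimately show ?thesis by blast
qed

end

section \<open>Amalgamated free products\<close>

definition normal_closure :: "('a, 'm) monoid_scheme \<Rightarrow> 'a set \<Rightarrow> 'a set" where
  "normal_closure G S = \<Inter> {N. N \<lhd> G \<and> S \<subseteq> N}"

lemma (in group) normal_closure_normal:
  assumes "S \<subseteq> carrier G"
  shows "normal_closure G S \<lhd> G"
proof -
  have self: "carrier G \<lhd> G"
    by (auto simp: normal_inv_iff subgroup_self)
  have "subgroup (normal_closure G S) G"
    unfolding normal_closure_def
    by (rule subgroups_Inter) (use self assms in \<open>auto intro: normal_imp_subgroup\<close>)
  moreover have "x \<otimes> n \<otimes> inv x \<in> normal_closure G S"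
    if "x \<in> carrier G" "n \<in> normal_closure G S" for x n
    using that by (auto simp: normal_closure_def intro: normal.inv_op_closed2)
  ultimately show ?thesis
    by (simp add: normal_inv_iff)
qed

definition amalgamated_product ::
    "('a, 'm) monoid_scheme \<Rightarrow> ('b, 'n) monoid_scheme \<Rightarrow> 'a set \<Rightarrow> ('a \<Rightarrow> 'b)
      \<Rightarrow> ('a + 'b) list set set monoid" where
  "amalgamated_product A B C \<phi> =
     free_product A B Mod normal_closure (free_product A B)
       {free_product_inl A B c \<otimes>\<^bsub>free_product A B\<^esub>
          inv\<^bsub>free_product A B\<^esub> (free_product_inr A B (\<phi> c)) | c. c \<in> C}"

lemma (in two_groups) group_amalgamated_product:
  assumes "C \<subseteq> carrier A" "\<phi> ` C \<subseteq> carrier B"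
  shows "group (amalgamated_product A B C \<phi>)"
proof -
  interpret P: group "free_product A B" by (rule group_free_product)
  have "{free_product_inl A B c \<otimes>\<^bsub>free_product A B\<^esub>
          inv\<^bsub>free_product A B\<^esub> (free_product_inr A B (\<phi> c)) | c. c \<in> C}
      \<subseteq> carrier (free_product A B)"
  proof clarify
    fix c assume "c \<in> C"
    then have "free_product_inl A B c \<in> carrier (free_product A B)"
      "free_product_inr A B (\<phi> c) \<in> carrier (free_product A B)"
      using assms hom_in_carrier[OF free_product_inl_hom] hom_in_carrier[OF free_product_inr_hom]
      by blast+
    then show "free_product_inl A B c \<otimes>\<^bsub>free_product A B\<^esub>
        inv\<^bsub>free_product A B\<^esub> (free_product_inr A B (\<phi> c)) \<in> carrier (free_product A B)"
      by simp
  qed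
  then show ?thesis
    unfolding amalgamated_product_def
    by (intro normal.factorgroup_is_group P.normal_closure_normal)
qed

end

theory Submission
  imports Defs "HOL-Algebra.Multiplicative_Group" "HOL-Computational_Algebra.Primes"
begin

text \<open>
  Let \<open>N \<lhd> G\<close> be the kernel of a homomorphism onto a solvable group that is injective on \<open>A\<close> and on
  \<open>B\<close>.  The derived series of \<open>N\<close> then separates every reduced word of \<open>G\<close> from \<open>C\<close>: in the coset graph of
  \<open>C\<close> in the quotient, a closed path of minimal length is a simple closed path, so it is not
  homologically trivial and becomes open in the next quotient.  The crossed homomorphism into
  the integer-valued functions on the quotient that measures this gives a map into a wreath product.

  The group \<open>N\<close> is found by descending along central series of \<open>A\<close> and \<open>B\<close> simultaneously.  If \<open>G\<close>
  has a solvable quotient that induces \<open>A / A\<^sub>1\<close> and \<open>B / B\<^sub>1\<close>, and \<open>A\<^sub>1 / A\<^sub>2\<close>, \<open>B\<^sub>1 / B\<^sub>2\<close> are central and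
  \<open>C\<close> meets \<open>A\<^sub>2\<close> and \<open>B\<^sub>2\<close> in the same subgroup, then the wreath product of the pushout of
  \<open>A\<^sub>1 / A\<^sub>2\<close> and \<open>B\<^sub>1 / B\<^sub>2\<close> over \<open>C \<inter> A\<^sub>1\<close> with that quotient contains both \<open>A / A\<^sub>2\<close> and \<open>B / B\<^sub>2\<close>.  The
  intersections with \<open>C\<close> are kept equal by lowering them by one prime at a time, which is
  possible because \<open>x\<close> is not in the normal closure of \<open>x\<^sup>p\<close> in a nilpotent group when \<open>p\<close> divides the
  order of \<open>x\<close> or \<open>x\<close> has infinite order.
\<close>

section \<open>Central series and nilpotent groups\<close>

lemma (in group) inv_mult_cancel:
  assumes "x \<in> carrier G" "y \<in> carrier G"
  shows "x \<otimes> (inv x \<otimes> y) = y" "inv x \<otimes> (x \<otimes> y) = y"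
  using assms by (simp_all flip: m_assoc)

lemmas (in group) word_simps = m_assoc inv_mult_group inv_mult_cancel

lemma (in normal) group_hom_rcoset: "group_hom G (G Mod H) (\<lambda>x. H #> x)"
  by (simp add: group_hom_def group_hom_axioms_def factorgroup_is_group r_coset_hom_Mod)

lemma (in normal) rcoset_eq_one_iff:
  assumes "x \<in> carrier G"
  shows "H #> x = \<one>\<^bsub>G Mod H\<^esub> \<longleftrightarrow> x \<in> H"
  using assms by (metis coset_join1 coset_join2 is_subgroup one_FactGroup subset)

lemma (in group) normal_closure_superset: "S \<subseteq> normal_closure G S"
  by (auto simp: normal_closure_def)

lemma (in group) normal_closure_minimal: "N \<lhd> G \<Longrightarrow> S \<subseteq> N \<Longrightarrow> normal_closure G S \<subseteq> N"
  by (auto simp: normal_closure_def)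

section \<open>Elements central modulo a normal subgroup\<close>

text \<open>For normal \<open>Y\<close> this is the preimage of the centre of the quotient by
  \<open>Y\<close>. The commutator form makes sense for any set \<open>Y\<close> and makes
  monotonicity in \<open>Y\<close> immediate.\<close>

definition central_mod :: "('a, 'm) monoid_scheme \<Rightarrow> 'a set \<Rightarrow> 'a set" where
  "central_mod G Y =
     {x \<in> carrier G. \<forall>a \<in> carrier G. a \<otimes>\<^bsub>G\<^esub> x \<otimes>\<^bsub>G\<^esub> inv\<^bsub>G\<^esub> a \<otimes>\<^bsub>G\<^esub> inv\<^bsub>G\<^esub> x \<in> Y}"

lemma central_mod_mono: "Y \<subseteq> Z \<Longrightarrow> central_mod G Y \<subseteq> central_mod G Z"
  by (auto simp: central_mod_def)

text \<open>Turns commutators into commuting cosets, so that closure properties can be checked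
  inside the quotient group.\<close>

lemma (in normal) central_mod_iff:
  "x \<in> central_mod G H \<longleftrightarrow> x \<in> carrier G \<and>
    (\<forall>a \<in> carrier G. (H #> a) \<otimes>\<^bsub>G Mod H\<^esub> (H #> x) = (H #> x) \<otimes>\<^bsub>G Mod H\<^esub> (H #> a))"
proof -
  interpret \<pi>: group_hom G "G Mod H" "\<lambda>x. H #> x" by (rule group_hom_rcoset)
  have "a \<otimes> x \<otimes> inv a \<otimes> inv x \<in> H \<longleftrightarrow>
      (H #> a) \<otimes>\<^bsub>G Mod H\<^esub> (H #> x) = (H #> x) \<otimes>\<^bsub>G Mod H\<^esub> (H #> a)"
    if x: "x \<in> carrier G" and a: "a \<in> carrier G" for a
  proof -
    have "a \<otimes> x \<otimes> inv a \<otimes> inv x \<in> H \<longleftrightarrow> H #> (a \<otimes> x \<otimes> inv (x \<otimes> a)) = \<one>\<^bsub>G Mod H\<^esub>"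
      using x a by (subst rcoset_eq_one_iff) (simp_all add: inv_mult_group m_assoc)
    also have "\<dots> \<longleftrightarrow> (H #> (a \<otimes> x)) \<otimes>\<^bsub>G Mod H\<^esub> inv\<^bsub>G Mod H\<^esub> (H #> (x \<otimes> a)) = \<one>\<^bsub>G Mod H\<^esub>"
      using x a \<pi>.hom_mult[of "a \<otimes> x" "inv (x \<otimes> a)"] by (simp only: \<pi>.hom_inv m_closed inv_closed)
    also have "\<dots> \<longleftrightarrow> H #> (a \<otimes> x) = H #> (x \<otimes> a)"
      using x a \<pi>.H.inv_solve_right'[of "\<one>\<^bsub>G Mod H\<^esub>" "H #> (a \<otimes> x)" "H #> (x \<otimes> a)"]
      by (metis \<pi>.H.one_closed \<pi>.H.r_inv \<pi>.H.right_cancel \<pi>.hom_closed \<pi>.H.inv_closed m_closed)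
    also have "\<dots> \<longleftrightarrow> (H #> a) \<otimes>\<^bsub>G Mod H\<^esub> (H #> x) = (H #> x) \<otimes>\<^bsub>G Mod H\<^esub> (H #> a)"
      using x a by (metis \<pi>.hom_mult)
    finally show ?thesis .
  qed
  then show ?thesis by (auto simp: central_mod_def)
qed

lemma (in normal) superset_central_mod: "H \<subseteq> central_mod G H"
  by (auto simp: central_mod_def inv_op_closed2)

lemma (in group) commute_inv:
  assumes "a \<otimes> x = x \<otimes> a" "a \<in> carrier G" "x \<in> carrier G"
  shows "a \<otimes> inv x = inv x \<otimes> a"
proof -
  have "a \<otimes> inv x = inv x \<otimes> (x \<otimes> a) \<otimes> inv x"
    using assms(2,3) by (simp add: word_simps)
  also have "\<dots> = inv x \<otimes> a"
    unfolding assms(1)[symmetric] using assms(2,3) by (simp add: word_simps)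
  finally show ?thesis .
qed

lemma (in group) commute_mult:
  assumes "a \<otimes> x = x \<otimes> a" "a \<otimes> y = y \<otimes> a"
    and "a \<in> carrier G" "x \<in> carrier G" "y \<in> carrier G"
  shows "a \<otimes> (x \<otimes> y) = (x \<otimes> y) \<otimes> a"
  using assms by (metis m_assoc)

lemma (in normal) normal_central_mod: "central_mod G H \<lhd> G"
proof -
  interpret \<pi>: group_hom G "G Mod H" "\<lambda>x. H #> x" by (rule group_hom_rcoset)
  have sub: "subgroup (central_mod G H) G"
  proof (rule subgroupI)
    show "central_mod G H \<subseteq> carrier G" by (auto simp: central_mod_def)
    show "central_mod G H \<noteq> {}" by (auto simp: central_mod_def intro!: exI[of _ \<one>])
  next
    fix x assume x: "x \<in> central_mod G H"
    then have "(H #> a) \<otimes>\<^bsub>G Mod H\<^esub> (H #> inv x) = (H #> inv x) \<otimes>\<^bsub>G Mod H\<^esub> (H #> a)"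
      if "a \<in> carrier G" for a
      using \<pi>.H.commute_inv[of "H #> a" "H #> x"] that
      unfolding central_mod_iff by (metis \<pi>.hom_closed \<pi>.hom_inv)
    then show "inv x \<in> central_mod G H"
      using x unfolding central_mod_iff by blast
  next
    fix x y assume x: "x \<in> central_mod G H" and y: "y \<in> central_mod G H"
    then have "(H #> a) \<otimes>\<^bsub>G Mod H\<^esub> (H #> x \<otimes> y) = (H #> x \<otimes> y) \<otimes>\<^bsub>G Mod H\<^esub> (H #> a)"
      if "a \<in> carrier G" for a
      using \<pi>.H.commute_mult[of "H #> a" "H #> x" "H #> y"] that
      unfolding central_mod_iff by (metis \<pi>.hom_closed \<pi>.hom_mult)
    then show "x \<otimes> y \<in> central_mod G H"
      using x y unfolding central_mod_iff by blast
  qed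
  moreover have "b \<otimes> x \<otimes> inv b \<in> central_mod G H"
    if b: "b \<in> carrier G" and x: "x \<in> central_mod G H" for b x
  proof -
    have xc: "x \<in> carrier G" using x by (simp add: central_mod_def)
    \<comment> \<open>The conjugate of \<open>x\<close> by \<open>b\<close> is this commutator times
      \<open>x\<close>, and the commutator already lies in \<open>H\<close>.\<close>
    have "b \<otimes> x \<otimes> inv b \<otimes> inv x \<in> central_mod G H"
      using x b superset_central_mod by (auto simp: central_mod_def)
    then have "(b \<otimes> x \<otimes> inv b \<otimes> inv x) \<otimes> x \<in> central_mod G H"
      by (rule subgroup.m_closed[OF sub _ x])
    then show ?thesis
      using b xc by (simp add: word_simps)
  qed
  ultimately show ?thesis by (simp add: normal_inv_iff)
qed

section \<open>The lower central series\<close>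

text \<open>Normality of \<open>H\<close> puts the generators into \<open>H\<close>. Normality of
  the commutator subgroup then follows from centrality: a conjugate of \<open>x\<close> is a
  commutator of \<open>x\<close>, which lies in the subgroup, times \<open>x\<close>.\<close>

lemma (in group) commutator_subgroup_facts:
  assumes "H \<lhd> G"
  shows commutator_subgroup_subset: "commutator_subgroup G H (carrier G) \<subseteq> H"
    and normal_commutator_subgroup: "commutator_subgroup G H (carrier G) \<lhd> G"
    and central_mod_commutator_subgroup: "H \<subseteq> central_mod G (commutator_subgroup G H (carrier G))"
proof -
  interpret H: normal H G by fact
  let ?S = "\<Union>h \<in> H. \<Union>k \<in> carrier G. {h \<otimes> k \<otimes> inv h \<otimes> inv k}"
  let ?K = "commutator_subgroup G H (carrier G)"
  have S: "?S \<subseteq> H"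
  proof clarify
    fix h k assume h: "h \<in> H" and k: "k \<in> carrier G"
    then have "h \<otimes> (k \<otimes> inv h \<otimes> inv k) \<in> H"
      by (intro H.m_closed H.inv_op_closed2) auto
    then show "h \<otimes> k \<otimes> inv h \<otimes> inv k \<in> H"
      using h k by (simp add: m_assoc)
  qed
  then have SG: "?S \<subseteq> carrier G" using H.subset by blast
  show KH: "?K \<subseteq> H"
    unfolding commutator_subgroup_def by (rule generate_subgroup_incl[OF S H.is_subgroup])
  have Ksub: "subgroup ?K G"
    unfolding commutator_subgroup_def by (rule generate_is_subgroup[OF SG])
  show cm: "H \<subseteq> central_mod G ?K"
  proof
    fix x assume x: "x \<in> H"
    then have "a \<otimes> x \<otimes> inv a \<otimes> inv x \<in> ?K" if a: "a \<in> carrier G" for a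
    proof -
      \<comment> \<open>The generators have the element of \<open>H\<close> first,
        \<open>central_mod\<close> has it second; the two commutators are inverse to each
        other.\<close>
      have "x \<otimes> a \<otimes> inv x \<otimes> inv a \<in> ?K"
        unfolding commutator_subgroup_def using x a by (intro generate.incl) auto
      then have "inv (x \<otimes> a \<otimes> inv x \<otimes> inv a) \<in> ?K"
        using Ksub subgroup.m_inv_closed by fast
      then show ?thesis using x a by (simp add: word_simps)
    qed
    with x show "x \<in> central_mod G ?K" by (simp add: central_mod_def)
  qed
  have "a \<otimes> x \<otimes> inv a \<in> ?K" if a: "a \<in> carrier G" and x: "x \<in> ?K" for a x
  proof -
    have xH: "x \<in> H" using x KH by blast
    then have "(a \<otimes> x \<otimes> inv a \<otimes> inv x) \<otimes> x \<in> ?K"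
      using cm a x Ksub subgroup.m_closed by (fastforce simp: central_mod_def)
    then show ?thesis using a xH by (simp add: word_simps)
  qed
  with Ksub show "?K \<lhd> G" by (simp add: normal_inv_iff)
qed

lemma (in group) normal_lower_central_series: "lower_central_series G n \<lhd> G"
  by (induction n) (simp_all add: normal_self normal_commutator_subgroup)

lemma (in group) lower_central_series_central:
  "lower_central_series G n \<subseteq> central_mod G (lower_central_series G (Suc n))"
  by (simp add: central_mod_commutator_subgroup normal_lower_central_series)

lemma (in group) lower_central_series_antimono:
  "m \<le> n \<Longrightarrow> lower_central_series G n \<subseteq> lower_central_series G m"
  by (rule lift_Suc_antimono_le)
    (simp_all add: commutator_subgroup_subset normal_lower_central_series)

text \<open>Having all later indices at once allows a common index for two nilpotent groups.\<close>

lemma (in group) nilpotent_eventually_trivial: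
  assumes "nilpotent_group G"
  obtains n where "\<And>i. i \<ge> n \<Longrightarrow> lower_central_series G i = {\<one>}"
proof -
  obtain n where n: "lower_central_series G n = {\<one>}"
    using assms by (auto simp: nilpotent_group_def)
  have "lower_central_series G i = {\<one>}" if "i \<ge> n" for i
    using lower_central_series_antimono[OF that] n
      subgroup.one_closed[OF normal_imp_subgroup[OF normal_lower_central_series[of i]]] by auto
  with that show ?thesis by blast
qed

section \<open>Exponents of central factors\<close>

text \<open>Modulo \<open>H\<close> the element \<open>w\<close> is central, so taking powers is
  multiplicative on \<open>v\<close> and \<open>w\<close>.\<close>

lemma (in normal) pow_mult_mem:
  assumes "v \<in> carrier G" "w \<in> central_mod G H" "v [^] (m::nat) \<in> H" "w [^] m \<in> H"
  shows "(v \<otimes> w) [^] m \<in> H"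
proof -
  interpret \<pi>: group_hom G "G Mod H" "\<lambda>x. H #> x" by (rule group_hom_rcoset)
  have w: "w \<in> carrier G" using assms(2) by (simp add: central_mod_def)
  have "(H #> v) \<otimes>\<^bsub>G Mod H\<^esub> (H #> w) = (H #> w) \<otimes>\<^bsub>G Mod H\<^esub> (H #> v)"
    using assms(1,2) by (simp add: central_mod_iff)
  then have "(H #> v \<otimes> w) [^]\<^bsub>G Mod H\<^esub> m = (H #> v) [^]\<^bsub>G Mod H\<^esub> m \<otimes>\<^bsub>G Mod H\<^esub> (H #> w) [^]\<^bsub>G Mod H\<^esub> m"
    using \<pi>.H.pow_mult_distrib[of "H #> v" "H #> w" m] assms(1) w by (simp only: \<pi>.hom_mult \<pi>.hom_closed)
  then have "H #> (v \<otimes> w) [^] m = (H #> v [^] m) \<otimes>\<^bsub>G Mod H\<^esub> (H #> w [^] m)"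
    using assms(1) w by (simp only: \<pi>.hom_nat_pow m_closed)
  moreover have "H #> v [^] m = \<one>\<^bsub>G Mod H\<^esub>"
    using iffD2[OF rcoset_eq_one_iff, of "v [^] m"] assms(1,3) by blast
  moreover have "H #> w [^] m = \<one>\<^bsub>G Mod H\<^esub>"
    using iffD2[OF rcoset_eq_one_iff, of "w [^] m"] w assms(4) by blast
  ultimately have "H #> (v \<otimes> w) [^] m = \<one>\<^bsub>G Mod H\<^esub>"
    by (simp only: \<pi>.H.l_one \<pi>.H.one_closed)
  moreover have "(v \<otimes> w) [^] m \<in> carrier G"
    using assms(1) w by simp
  ultimately show ?thesis
    using rcoset_eq_one_iff by (simp only:)
qed

lemma (in group) conj_nat_pow:
  assumes "a \<in> carrier G" "x \<in> carrier G"
  shows "(a \<otimes> x \<otimes> inv a) [^] (m::nat) = a \<otimes> x [^] m \<otimes> inv a"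
  using assms by (induction m) (simp_all add: word_simps)

text \<open>An exponent \<open>m\<close> of \<open>X / [X, G]\<close> passes to the next factor
  \<open>Y / Z\<close>. As \<open>Y\<close> is central modulo \<open>Z\<close>, it suffices to treat
  a commutator \<open>w\<close> of \<open>x\<close> and \<open>a\<close>. From
  \<open>x = w y\<close> with \<open>y\<close> the conjugate of \<open>x\<close> by
  \<open>a\<close>, the power \<open>x^m\<close> is \<open>w^m y^m\<close> modulo \<open>Z\<close>,
  and \<open>y^m\<close> equals \<open>x^m\<close> there, so \<open>w^m\<close> vanishes.\<close>

lemma (in group) commutator_subgroup_pow:
  assumes X: "X \<lhd> G" and pow: "\<And>u. u \<in> X \<Longrightarrow> u [^] m \<in> commutator_subgroup G X (carrier G)"
    and u: "u \<in> commutator_subgroup G X (carrier G)"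
  shows "u [^] (m::nat)
    \<in> commutator_subgroup G (commutator_subgroup G X (carrier G)) (carrier G)"
proof -
  define Y where "Y = commutator_subgroup G X (carrier G)"
  define Z where "Z = commutator_subgroup G Y (carrier G)"
  have YX: "Y \<subseteq> X" and Y: "Y \<lhd> G"
    unfolding Y_def using X by (rule commutator_subgroup_facts)+
  have Z: "Z \<lhd> G" and ZY: "Y \<subseteq> central_mod G Z"
    unfolding Z_def using Y by (rule commutator_subgroup_facts)+
  interpret X: normal X G by fact
  interpret Y: normal Y G by fact
  interpret Z: normal Z G by fact
  interpret \<pi>: group_hom G "G Mod Z" "\<lambda>x. Z #> x" by (rule Z.group_hom_rcoset)
  have comm: "(Z #> a) \<otimes>\<^bsub>G Mod Z\<^esub> (Z #> x) = (Z #> x) \<otimes>\<^bsub>G Mod Z\<^esub> (Z #> a)"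
    if "a \<in> carrier G" "x \<in> Y" for a x
    using that ZY by (auto simp: Z.central_mod_iff)
  let ?S = "{v \<in> Y. v [^] m \<in> Z}"
  have "subgroup ?S G"
  proof (rule subgroupI)
    show "?S \<noteq> {}" by (auto intro!: exI[of _ \<one>])
  next
    fix v assume "v \<in> ?S"
    then show "inv v \<in> ?S" by (simp add: nat_pow_inv)
  next
    fix v w assume v: "v \<in> ?S" and w: "w \<in> ?S"
    then show "v \<otimes> w \<in> ?S" using ZY Z.pow_mult_mem by auto
  qed (auto)
  moreover have "(\<Union>h \<in> X. \<Union>k \<in> carrier G. {h \<otimes> k \<otimes> inv h \<otimes> inv k}) \<subseteq> ?S"
  proof clarify
    fix x a assume x: "x \<in> X" and a: "a \<in> carrier G"
    define w where "w = x \<otimes> a \<otimes> inv x \<otimes> inv a"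
    have wY: "w \<in> Y"
      unfolding Y_def w_def commutator_subgroup_def using x a by (intro generate.incl) auto
    have xm: "x [^] m \<in> Y" using pow x by (simp add: Y_def)
    let ?y = "a \<otimes> x \<otimes> inv a"
    have mem: "w \<in> carrier G" "?y \<in> carrier G" "x [^] m \<in> carrier G" "a \<in> carrier G"
      using x a by (simp_all add: w_def)
    have "Z #> x [^] m = Z #> (w \<otimes> ?y) [^] m"
      using x a by (simp add: w_def word_simps)
    also have "\<dots> = (Z #> w \<otimes> ?y) [^]\<^bsub>G Mod Z\<^esub> m"
      using mem \<pi>.hom_nat_pow m_closed by metis
    also have "\<dots> = ((Z #> w) \<otimes>\<^bsub>G Mod Z\<^esub> (Z #> ?y)) [^]\<^bsub>G Mod Z\<^esub> m"
      using mem \<pi>.hom_mult by metis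
    also have "\<dots> = (Z #> w) [^]\<^bsub>G Mod Z\<^esub> m \<otimes>\<^bsub>G Mod Z\<^esub> (Z #> ?y) [^]\<^bsub>G Mod Z\<^esub> m"
      using mem comm[OF mem(2) wY] by (intro \<pi>.H.pow_mult_distrib) (simp_all del: mult_FactGroup)
    also have "\<dots> = (Z #> w [^] m) \<otimes>\<^bsub>G Mod Z\<^esub> (Z #> ?y [^] m)"
      using mem \<pi>.hom_nat_pow by metis
    \<comment> \<open>By assumption \<open>x^m\<close> lies in \<open>Y\<close>, hence is central
      modulo \<open>Z\<close> and unchanged by conjugation with \<open>a\<close>.\<close>
    also have "Z #> ?y [^] m = Z #> x [^] m"
    proof -
      have "Z #> ?y [^] m = (Z #> a \<otimes> x [^] m) \<otimes>\<^bsub>G Mod Z\<^esub> (Z #> inv a)"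
        using mem x unfolding conj_nat_pow[OF mem(4) X.mem_carrier[OF x]] by (intro \<pi>.hom_mult) auto
      also have "Z #> a \<otimes> x [^] m = Z #> x [^] m \<otimes> a"
        using mem comm[OF a xm] \<pi>.hom_mult by metis
      also have "(Z #> x [^] m \<otimes> a) \<otimes>\<^bsub>G Mod Z\<^esub> (Z #> inv a) = Z #> x [^] m"
        using mem \<pi>.hom_mult[of "x [^] m \<otimes> a" "inv a"] by (simp add: m_assoc del: mult_FactGroup)
      finally show ?thesis .
    qed
    finally have "Z #> w [^] m = \<one>\<^bsub>G Mod Z\<^esub>"
      using mem \<pi>.H.r_cancel_one'[of "Z #> x [^] m" "Z #> w [^] m"] by (simp del: mult_FactGroup one_FactGroup)
    then show "x \<otimes> a \<otimes> inv x \<otimes> inv a \<in> Y \<and> (x \<otimes> a \<otimes> inv x \<otimes> inv a) [^] m \<in> Z"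
      using wY by (simp add: Z.rcoset_eq_one_iff w_def[symmetric] del: one_FactGroup)
  qed
  ultimately have "Y \<subseteq> ?S"
    unfolding Y_def commutator_subgroup_def using generate_subgroup_incl by blast
  then show ?thesis using u unfolding Y_def[symmetric] Z_def[symmetric] by blast
qed

text \<open>The set is the product of \<open>Y\<close> with the cyclic group generated by
  \<open>z\<close>; it is normal because \<open>z\<close> is central modulo
  \<open>Y\<close>.\<close>

lemma (in group) normal_central_extension:
  assumes Y: "Y \<lhd> G" and z: "z \<in> central_mod G Y"
  shows "{x \<in> carrier G. \<exists>t::int. x \<otimes> z [^] t \<in> Y} \<lhd> G"
proof -
  interpret Y: normal Y G by fact
  have Zsub: "subgroup (central_mod G Y) G"
    using Y.normal_central_mod normal_imp_subgroup by blast
  have zc: "z \<in> carrier G" using z by (simp add: central_mod_def)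
  have zt: "a \<otimes> z [^] t \<otimes> inv a \<otimes> inv (z [^] t) \<in> Y" if "a \<in> carrier G" for a and t :: int
    using subgroup_int_pow_closed[OF Zsub z, of t] that by (simp add: central_mod_def)
  let ?S = "{x \<in> carrier G. \<exists>t::int. x \<otimes> z [^] t \<in> Y}"
  have "subgroup ?S G"
  proof (rule subgroupI)
    show "?S \<noteq> {}" using Y.one_closed by (auto intro!: exI[of _ \<one>] exI[of _ "0::int"])
  next
    fix x assume "x \<in> ?S"
    then obtain t :: int where x: "x \<in> carrier G" and t: "x \<otimes> z [^] t \<in> Y" by blast
    have "z [^] t \<otimes> inv (x \<otimes> z [^] t) \<otimes> inv (z [^] t) \<in> Y"
      using t zc by (intro Y.inv_op_closed2) auto
    then have "inv x \<otimes> z [^] (- t) \<in> Y"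
      using x zc by (simp add: word_simps int_pow_neg)
    then show "inv x \<in> ?S" using x by blast
  next
    fix x y assume "x \<in> ?S" "y \<in> ?S"
    then obtain s t :: int where x: "x \<in> carrier G" and s: "x \<otimes> z [^] s \<in> Y"
      and y: "y \<in> carrier G" and t: "y \<otimes> z [^] t \<in> Y" by blast
    \<comment> \<open>An element of \<open>Y\<close> which, inserted between the two given factors,
      moves \<open>y\<close> to the left of \<open>z^s\<close>.\<close>
    have "inv (z [^] s) \<otimes> (y \<otimes> z [^] s \<otimes> inv y \<otimes> inv (z [^] s)) \<otimes> z [^] s \<in> Y"
      using zt[OF y] zc by (intro Y.inv_op_closed1) auto
    then have "(x \<otimes> z [^] s) \<otimes> (inv (z [^] s) \<otimes> (y \<otimes> z [^] s \<otimes> inv y \<otimes> inv (z [^] s)) \<otimes> z [^] s)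
        \<otimes> (y \<otimes> z [^] t) \<in> Y"
      by (rule Y.m_closed[OF Y.m_closed[OF s] t])
    then have "x \<otimes> y \<otimes> z [^] (s + t) \<in> Y"
      using x y zc by (simp add: word_simps int_pow_mult)
    then show "x \<otimes> y \<in> ?S" using x y by blast
  qed auto
  moreover have "a \<otimes> x \<otimes> inv a \<in> ?S" if a: "a \<in> carrier G" and "x \<in> ?S" for a x
  proof -
    obtain t :: int where x: "x \<in> carrier G" and t: "x \<otimes> z [^] t \<in> Y"
      using \<open>x \<in> ?S\<close> by blast
    have "(a \<otimes> (x \<otimes> z [^] t) \<otimes> inv a) \<otimes> (a \<otimes> z [^] (-t) \<otimes> inv a \<otimes> inv (z [^] (-t))) \<in> Y"
      by (rule Y.m_closed[OF Y.inv_op_closed2[OF a t] zt[OF a]])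
    then have "a \<otimes> x \<otimes> inv a \<otimes> z [^] t \<in> Y"
      using a x zc by (simp add: word_simps int_pow_neg)
    then show ?thesis using a x by auto
  qed
  ultimately show ?thesis by (simp add: normal_inv_iff)
qed

lemma (in group) commutator_subgroup_mono:
  "H \<subseteq> K \<Longrightarrow> K \<subseteq> carrier G \<Longrightarrow> commutator_subgroup G H (carrier G) \<subseteq> commutator_subgroup G K (carrier G)"
  unfolding commutator_subgroup_def by (intro mono_generate UN_mono) auto

text \<open>If \<open>c\<close> lies in the normal closure \<open>M\<close> of \<open>c\<^sup>p\<close>, then \<open>M / [M, G]\<close> is generated by \<open>c\<^sup>p\<close> as
  well as by \<open>c\<close>, so its exponent divides some \<open>m\<close> prime to \<open>p\<close>.  The exponent of all further
  factors \<open>[M, G, \<dots>, G]\<close> then divides \<open>m\<close> too, and the order of \<open>c\<close> divides a power of \<open>m\<close>.\<close>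

lemma (in group) nilpotent_not_in_closure_pow:
  assumes nil: "nilpotent_group G" and c: "c \<in> carrier G" and p: "prime (p::nat)"
    and ord: "\<And>t::nat. c [^] t = \<one> \<Longrightarrow> p dvd t"
  shows "c \<notin> normal_closure G {c [^] p}"
proof
  define M where "M = normal_closure G {c [^] p}"
  assume "c \<in> normal_closure G {c [^] p}"
  then have cM: "c \<in> M" by (simp add: M_def)
  have M: "M \<lhd> G" unfolding M_def using c by (intro normal_closure_normal) auto
  have zM: "c [^] p \<in> M" unfolding M_def using normal_closure_superset by blast
  define Y where "Y = commutator_subgroup G M (carrier G)"
  have YM: "Y \<subseteq> M" and Y: "Y \<lhd> G" and MY: "M \<subseteq> central_mod G Y"
    unfolding Y_def using M by (rule commutator_subgroup_facts)+
  interpret M: normal M G by fact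
  interpret Y: normal Y G by fact
  have "M \<subseteq> {x \<in> carrier G. \<exists>t::int. x \<otimes> (c [^] p) [^] t \<in> Y}"
    unfolding M_def
  proof (rule normal_closure_minimal[OF normal_central_extension[OF Y]])
    show "c [^] p \<in> central_mod G Y" using zM MY by blast
    have "c [^] p \<otimes> (c [^] p) [^] (-1::int) = \<one>"
      using c by (simp add: int_pow_neg)
    then show "{c [^] p} \<subseteq> {x \<in> carrier G. \<exists>t::int. x \<otimes> (c [^] p) [^] t \<in> Y}"
      using c Y.one_closed by (auto intro!: exI[of _ "-1::int"])
  qed
  then obtain t :: int where t: "c \<otimes> (c [^] p) [^] t \<in> Y"
    using cM by blast
  \<comment> \<open>The absolute value makes the exponent a natural number; since \<open>Y\<close>
    is closed under inverses, the sign does not matter.\<close>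
  define m where "m = nat \<bar>1 + int p * t\<bar>"
  have "c \<otimes> (c [^] p) [^] t = c [^] (1 + int p * t)"
    using c by (simp add: int_pow_mult int_pow_pow int_pow_int[symmetric])
  then have "c [^] (1 + int p * t) \<in> Y" using t by simp
  then have "c [^] (int m) \<in> Y"
    using c Y.m_inv_closed int_pow_neg[OF c, of "1 + int p * t"] by (auto simp: m_def abs_if)
  then have cm: "c [^] m \<in> Y" by (simp add: int_pow_int)
  have pm: "\<not> p dvd m"
  proof
    assume "p dvd m"
    then have "int p dvd 1 + int p * t" by (simp add: m_def flip: int_dvd_int_iff)
    then have "int p dvd 1" by (simp add: dvd_add_left_iff)
    then show False using p by simp
  qed
  \<comment> \<open>The iterated commutator subgroup of \<open>M\<close> with \<open>i\<close>
    factors \<open>G\<close>. It lies in the lower central series of \<open>G\<close> with the same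
    index, so it becomes trivial.\<close>
  define L where "L i = ((\<lambda>X. commutator_subgroup G X (carrier G)) ^^ i) M" for i
  have LS: "L (Suc i) = commutator_subgroup G (L i) (carrier G)" for i
    by (simp add: L_def)
  have L: "L i \<lhd> G" for i
    by (induction i) (simp_all add: LS M normal_commutator_subgroup, simp add: L_def M)
  let ?S = "{u \<in> M. u [^] m \<in> Y}"
  have "?S \<lhd> G"
  proof -
    have "subgroup ?S G"
    proof (rule subgroupI)
      show "?S \<noteq> {}" using M.one_closed Y.one_closed by (auto intro!: exI[of _ \<one>])
    next
      fix v assume "v \<in> ?S"
      then show "inv v \<in> ?S" using M.mem_carrier by (simp add: nat_pow_inv)
    next
      fix v w assume "v \<in> ?S" "w \<in> ?S"
      then show "v \<otimes> w \<in> ?S" using MY Y.pow_mult_mem by auto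
    qed auto
    moreover have "a \<otimes> u \<otimes> inv a \<in> ?S" if "a \<in> carrier G" "u \<in> ?S" for a u
      using that M.mem_carrier by (simp add: conj_nat_pow M.inv_op_closed2 Y.inv_op_closed2)
    ultimately show ?thesis by (simp add: normal_inv_iff)
  qed
  \<comment> \<open>This puts the generator \<open>c^p\<close> into the normal subgroup
    \<open>?S\<close>, and minimality of the normal closure extends the exponent \<open>m\<close> to
    all of \<open>M\<close>.\<close>
  moreover have "(c [^] p) [^] m \<in> Y"
    using subgroup_int_pow_closed[OF Y.is_subgroup cm, of "int p"] c
    by (simp add: int_pow_int nat_pow_pow mult.commute)
  ultimately have "M \<subseteq> ?S"
    unfolding M_def using normal_closure_minimal[of ?S "{c [^] p}"] zM by (simp add: M_def)
  then have L_pow: "u [^] m \<in> L (Suc i)" if "u \<in> L i" for u i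
    using that
  proof (induction i arbitrary: u)
    case 0
    then show ?case by (auto simp: L_def Y_def)
  next
    case (Suc i)
    then show ?case using commutator_subgroup_pow[OF L[of i], of m u] by (simp only: LS)
  qed
  have "c [^] (m ^ i) \<in> L i" for i
  proof (induction i)
    case 0
    then show ?case using cM c by (simp add: L_def)
  next
    case (Suc i)
    then show ?case using L_pow[OF Suc] c by (simp add: nat_pow_pow mult.commute)
  qed
  moreover have "L i \<subseteq> lower_central_series G i" for i
  proof (induction i)
    case 0
    then show ?case using M.subset by (simp add: L_def)
  next
    case (Suc i)
    then show ?case
      using normal_imp_subgroup[OF normal_lower_central_series[of i]]
      by (simp add: LS commutator_subgroup_mono subgroup.subset)
  qed
  moreover obtain n where "\<And>i. i \<ge> n \<Longrightarrow> lower_central_series G i = {\<one>}"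
    using nilpotent_eventually_trivial[OF nil] by blast
  ultimately have "c [^] (m ^ n) = \<one>" by (metis order_refl singletonD subsetD)
  then have "p dvd m ^ n" by (rule ord)
  then have "p dvd m" by (rule prime_dvd_power[OF p])
  then show False using pm by contradiction
qed

section \<open>The lower central series relative to a normal subgroup\<close>

text \<open>For normal \<open>M\<close> this is the product of \<open>M\<close> and the term of
  index \<open>i\<close>, which is the preimage of the lower central series of the quotient by
  \<open>M\<close>. Written as a normal closure, its inclusions follow from minimality.\<close>

definition relative_lower_central :: "('a, 'm) monoid_scheme \<Rightarrow> 'a set \<Rightarrow> nat \<Rightarrow> 'a set" where
  "relative_lower_central G M i = normal_closure G (M \<union> lower_central_series G i)"

lemma (in group) relative_lower_central:
  assumes M: "M \<lhd> G"
  shows normal_relative_lower_central: "relative_lower_central G M i \<lhd> G"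
    and relative_lower_central_superset: "M \<subseteq> relative_lower_central G M i"
    and relative_lower_central_central:
      "relative_lower_central G M i \<subseteq> central_mod G (relative_lower_central G M (Suc i))"
    and relative_lower_central_Suc: "relative_lower_central G M (Suc i) \<subseteq> relative_lower_central G M i"
    and relative_lower_central_0: "relative_lower_central G M 0 = carrier G"
    and relative_lower_central_trivial:
      "lower_central_series G i = {\<one>} \<Longrightarrow> relative_lower_central G M i = M"
proof -
  let ?N = "relative_lower_central G M"
  have sub: "M \<union> lower_central_series G i \<subseteq> carrier G" for i
    using subgroup.subset[OF normal_imp_subgroup[OF M]]
      subgroup.subset[OF normal_imp_subgroup[OF normal_lower_central_series[of i]]] by blast
  have N: "?N i \<lhd> G" for i
    unfolding relative_lower_central_def using sub by (rule normal_closure_normal)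
  have MN: "M \<union> lower_central_series G i \<subseteq> ?N i" for i
    unfolding relative_lower_central_def by (rule normal_closure_superset)
  show "?N i \<lhd> G" by (rule N)
  show "M \<subseteq> ?N i" using MN by blast
  show "?N i \<subseteq> central_mod G (?N (Suc i))"
    unfolding relative_lower_central_def[of G M i]
  proof (rule normal_closure_minimal)
    show "central_mod G (?N (Suc i)) \<lhd> G" by (rule normal.normal_central_mod[OF N])
    show "M \<union> lower_central_series G i \<subseteq> central_mod G (?N (Suc i))"
      using lower_central_series_central[of i] MN[of "Suc i"]
        normal.superset_central_mod[OF N, of "Suc i"]
        central_mod_mono[of "lower_central_series G (Suc i)" "?N (Suc i)" G] by blast
  qed
  show "?N (Suc i) \<subseteq> ?N i"
    unfolding relative_lower_central_def[of G M "Suc i"]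
    using MN[of i] lower_central_series_antimono[of i "Suc i"]
    by (intro normal_closure_minimal[OF N]) auto
  show "?N 0 = carrier G"
    using MN[of 0] subgroup.subset[OF normal_imp_subgroup[OF N[of 0]]] by auto
  show "?N i = M" if "lower_central_series G i = {\<one>}"
  proof
    show "?N i \<subseteq> M"
      unfolding relative_lower_central_def
      using that subgroup.one_closed[OF normal_imp_subgroup[OF M]]
      by (intro normal_closure_minimal M) auto
  qed (use MN in blast)
qed

text \<open>The relative series runs from the whole group down to \<open>M\<close>, so
  \<open>c\<close> leaves it at some step; \<open>Y\<close> is the first term without
  \<open>c\<close>.\<close>

lemma (in group) nilpotent_central_separation:
  assumes nil: "nilpotent_group G" and M: "M \<lhd> G" and c: "c \<in> carrier G" "c \<notin> M"
  obtains Y where "Y \<lhd> G" "M \<subseteq> Y" "c \<notin> Y" "c \<in> central_mod G Y"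
proof -
  obtain n where "\<And>i. i \<ge> n \<Longrightarrow> lower_central_series G i = {\<one>}"
    using nilpotent_eventually_trivial[OF nil] by blast
  then have "c \<notin> relative_lower_central G M n"
    using c(2) by (simp add: relative_lower_central_trivial[OF M])
  moreover have "c \<in> relative_lower_central G M 0"
    using c(1) by (simp add: relative_lower_central_0[OF M])
  ultimately have "\<exists>i. c \<in> relative_lower_central G M i \<and> c \<notin> relative_lower_central G M (Suc i)"
    by (induction n) auto
  then show ?thesis
    using that[OF normal_relative_lower_central[OF M] relative_lower_central_superset[OF M]]
      relative_lower_central_central[OF M] by blast
qed

section \<open>Wreath products with abelian base\<close>

text \<open>The unrestricted wreath product: the base consists of all functions from
  \<open>Q\<close> to \<open>U\<close>, and \<open>Q\<close> acts on them by left translation of the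
  argument. Extensionality makes equality of pairs mean equality on
  \<open>carrier Q\<close>.\<close>

definition wreath ::
    "('u, 'm) monoid_scheme \<Rightarrow> ('q, 'n) monoid_scheme \<Rightarrow> (('q \<Rightarrow> 'u) \<times> 'q) monoid" where
  "wreath U Q =
     \<lparr>carrier = (carrier Q \<rightarrow>\<^sub>E carrier U) \<times> carrier Q,
      monoid.mult = (\<lambda>(F, p) (F', q).
        (\<lambda>x \<in> carrier Q. F x \<otimes>\<^bsub>U\<^esub> F' (inv\<^bsub>Q\<^esub> p \<otimes>\<^bsub>Q\<^esub> x), p \<otimes>\<^bsub>Q\<^esub> q)),
      one = (\<lambda>x \<in> carrier Q. \<one>\<^bsub>U\<^esub>, \<one>\<^bsub>Q\<^esub>)\<rparr>"

lemma wreath_simps [simp]: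
  "carrier (wreath U Q) = (carrier Q \<rightarrow>\<^sub>E carrier U) \<times> carrier Q"
  "(F, p) \<otimes>\<^bsub>wreath U Q\<^esub> (F', q) =
     (\<lambda>x \<in> carrier Q. F x \<otimes>\<^bsub>U\<^esub> F' (inv\<^bsub>Q\<^esub> p \<otimes>\<^bsub>Q\<^esub> x), p \<otimes>\<^bsub>Q\<^esub> q)"
  "\<one>\<^bsub>wreath U Q\<^esub> = (\<lambda>x \<in> carrier Q. \<one>\<^bsub>U\<^esub>, \<one>\<^bsub>Q\<^esub>)"
  by (simp_all add: wreath_def)

lemma group_wreath:
  assumes "group U" "group Q"
  shows "group (wreath U Q)"
proof -
  interpret U: group U by fact
  interpret Q: group Q by fact
  show ?thesis
  proof (rule groupI)
    fix x y assume "x \<in> carrier (wreath U Q)" "y \<in> carrier (wreath U Q)"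
    then obtain F p F' q where x: "x = (F, p)" and F: "F \<in> carrier Q \<rightarrow>\<^sub>E carrier U" and p: "p \<in> carrier Q"
      and y: "y = (F', q)" and F': "F' \<in> carrier Q \<rightarrow>\<^sub>E carrier U" and q: "q \<in> carrier Q"
      by (cases x; cases y) auto
    show "x \<otimes>\<^bsub>wreath U Q\<^esub> y \<in> carrier (wreath U Q)"
      using p q PiE_mem[OF F] PiE_mem[OF F'] by (simp add: x y)
  next
    fix x y z
    assume "x \<in> carrier (wreath U Q)" "y \<in> carrier (wreath U Q)" "z \<in> carrier (wreath U Q)"
    then obtain F p F' q F'' r
      where x: "x = (F, p)" and F: "F \<in> carrier Q \<rightarrow>\<^sub>E carrier U" and p: "p \<in> carrier Q"
      and y: "y = (F', q)" and F': "F' \<in> carrier Q \<rightarrow>\<^sub>E carrier U" and q: "q \<in> carrier Q"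
      and z: "z = (F'', r)" and F'': "F'' \<in> carrier Q \<rightarrow>\<^sub>E carrier U" and r: "r \<in> carrier Q"
      by (cases x; cases y; cases z) auto
    show "x \<otimes>\<^bsub>wreath U Q\<^esub> y \<otimes>\<^bsub>wreath U Q\<^esub> z = x \<otimes>\<^bsub>wreath U Q\<^esub> (y \<otimes>\<^bsub>wreath U Q\<^esub> z)"
      using p q r PiE_mem[OF F] PiE_mem[OF F'] PiE_mem[OF F'']
      by (simp add: x y z Q.m_assoc U.m_assoc Q.inv_mult_group cong: restrict_cong)
  next
    fix x assume "x \<in> carrier (wreath U Q)"
    then obtain F q where x: "x = (F, q)" and F: "F \<in> carrier Q \<rightarrow>\<^sub>E carrier U" and q: "q \<in> carrier Q"
      by (cases x) auto
    have "restrict F (carrier Q) = F"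
      using F by (rule PiE_restrict)
    then show "\<one>\<^bsub>wreath U Q\<^esub> \<otimes>\<^bsub>wreath U Q\<^esub> x = x"
      using q PiE_mem[OF F] by (simp add: x cong: restrict_cong)
    let ?y = "(\<lambda>x \<in> carrier Q. inv\<^bsub>U\<^esub> F (q \<otimes>\<^bsub>Q\<^esub> x), inv\<^bsub>Q\<^esub> q)"
    have "?y \<in> carrier (wreath U Q)" "?y \<otimes>\<^bsub>wreath U Q\<^esub> x = \<one>\<^bsub>wreath U Q\<^esub>"
      using q PiE_mem[OF F] by (simp_all add: x cong: restrict_cong)
    then show "\<exists>y \<in> carrier (wreath U Q). y \<otimes>\<^bsub>wreath U Q\<^esub> x = \<one>\<^bsub>wreath U Q\<^esub>"
      by blast
  qed auto
qed

lemma (in comm_group) solvable: "solvable G"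
proof -
  have "(derived G ^^ 1) (carrier G) = {\<one>}"
    using derived_eq_singleton[of "carrier G"] by simp
  then show ?thesis unfolding solvable_iff_trivial_derived_seq by blast
qed

text \<open>An extension of \<open>Q\<close> by the base group, which is abelian because
  \<open>U\<close> is.\<close>

lemma solvable_wreath:
  assumes "comm_group U" "group Q" "solvable Q"
  shows "solvable (wreath U Q)"
proof -
  interpret U: comm_group U by fact
  interpret Q: group Q by fact
  interpret W: group "wreath U Q" by (rule group_wreath) (rule U.is_group Q.is_group)+
  have snd_hom: "group_hom (wreath U Q) Q snd"
    by (auto simp: group_hom_def group_hom_axioms_def hom_def W.is_group Q.is_group)
  define N where "N = kernel (wreath U Q) Q snd"
  have N: "subgroup N (wreath U Q)"
    unfolding N_def by (rule group_hom.subgroup_kernel[OF snd_hom])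
  have "group (wreath U Q\<lparr>carrier := N\<rparr>)"
    by (rule subgroup.subgroup_is_group[OF N W.is_group])
  moreover have "x \<otimes>\<^bsub>wreath U Q\<^esub> y = y \<otimes>\<^bsub>wreath U Q\<^esub> x" if "x \<in> N" "y \<in> N" for x y
    using that by (auto simp: N_def kernel_def intro!: restrict_ext U.m_comm PiE_mem[of _ "carrier Q"])
  ultimately have comm: "comm_group (wreath U Q\<lparr>carrier := N\<rparr>)"
    by (intro group.group_comm_groupI) auto
  have incl: "group_hom (wreath U Q\<lparr>carrier := N\<rparr>) (wreath U Q) id"
    using comm W.is_group subgroup.subset[OF N]
    by (auto simp: group_hom_def group_hom_axioms_def hom_def comm_group_def)
  show ?thesis
  proof (rule solvable_condition[OF incl snd_hom])
    have "carrier Q \<rightarrow>\<^sub>E carrier U \<noteq> {}"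
      using U.one_closed by (simp add: PiE_eq_empty_iff) blast
    then show "snd ` carrier (wreath U Q) = carrier Q"
      by (simp only: wreath_simps snd_image_times if_False)
    show "kernel (wreath U Q) Q snd \<subseteq> id ` carrier (wreath U Q\<lparr>carrier := N\<rparr>)"
      by (simp add: N_def)
    show "solvable (wreath U Q\<lparr>carrier := N\<rparr>)"
      by (rule comm_group.solvable[OF comm])
  qed (rule assms(3))
qed

text \<open>The identity required of \<open>D\<close> is that of a crossed homomorphism over
  \<alpha>, which is the form in which every later lift is constructed.\<close>

lemma wreath_homI:
  assumes "\<alpha> \<in> hom A Q"
    and "\<And>a. a \<in> carrier A \<Longrightarrow> D a \<in> carrier Q \<rightarrow>\<^sub>E carrier U"
    and "\<And>a b x. \<lbrakk>a \<in> carrier A; b \<in> carrier A; x \<in> carrier Q\<rbrakk> \<Longrightarrow>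
      D (a \<otimes>\<^bsub>A\<^esub> b) x = D a x \<otimes>\<^bsub>U\<^esub> D b (inv\<^bsub>Q\<^esub> (\<alpha> a) \<otimes>\<^bsub>Q\<^esub> x)"
    and "group A"
  shows "(\<lambda>a. (D a, \<alpha> a)) \<in> hom A (wreath U Q)"
proof (rule homI)
  fix a assume "a \<in> carrier A"
  then show "(D a, \<alpha> a) \<in> carrier (wreath U Q)"
    using assms(2) hom_in_carrier[OF assms(1)] by simp
next
  interpret A: group A by fact
  fix a b assume ab: "a \<in> carrier A" "b \<in> carrier A"
  have "D (a \<otimes>\<^bsub>A\<^esub> b) \<in> extensional (carrier Q)"
    using assms(2)[of "a \<otimes>\<^bsub>A\<^esub> b"] ab by (simp add: PiE_def)
  then have "D (a \<otimes>\<^bsub>A\<^esub> b) = (\<lambda>x \<in> carrier Q. D a x \<otimes>\<^bsub>U\<^esub> D b (inv\<^bsub>Q\<^esub> (\<alpha> a) \<otimes>\<^bsub>Q\<^esub> x))"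
    using assms(3)[OF ab] by (intro extensionalityI[of _ "carrier Q"]) simp_all
  then show "(D (a \<otimes>\<^bsub>A\<^esub> b), \<alpha> (a \<otimes>\<^bsub>A\<^esub> b)) = (D a, \<alpha> a) \<otimes>\<^bsub>wreath U Q\<^esub> (D b, \<alpha> b)"
    using hom_mult[OF assms(1) ab] by simp
qed

section \<open>Pushouts of abelian groups\<close>

text \<open>The quotient of the direct product by all pairs of \<open>f k\<close> and the inverse of
  \<open>g k\<close>. Equality of the kernels makes both maps injective: if such a pair has one
  trivial entry, the other is trivial too.\<close>

lemma pushout_comm_group:
  fixes X :: "('x, 'm) monoid_scheme" and Y :: "('y, 'n) monoid_scheme"
  assumes "comm_group X" "comm_group Y" "group K"
    and f: "f \<in> hom K X" and g: "g \<in> hom K Y"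
    and ker: "\<And>k. k \<in> carrier K \<Longrightarrow> f k = \<one>\<^bsub>X\<^esub> \<longleftrightarrow> g k = \<one>\<^bsub>Y\<^esub>"
  obtains U :: "('x \<times> 'y) set monoid" and i j
  where "comm_group U" "i \<in> hom X U" "j \<in> hom Y U"
    and "\<And>x. x \<in> carrier X \<Longrightarrow> i x = \<one>\<^bsub>U\<^esub> \<longleftrightarrow> x = \<one>\<^bsub>X\<^esub>"
    and "\<And>y. y \<in> carrier Y \<Longrightarrow> j y = \<one>\<^bsub>U\<^esub> \<longleftrightarrow> y = \<one>\<^bsub>Y\<^esub>"
    and "\<And>k. k \<in> carrier K \<Longrightarrow> i (f k) = j (g k)"
proof -
  interpret X: comm_group X by fact
  interpret Y: comm_group Y by fact
  interpret K: group K by fact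
  have grp: "group (X \<times>\<times> Y)"
    by (rule DirProd_group) (rule X.is_group Y.is_group)+
  interpret P: comm_group "X \<times>\<times> Y"
    by (rule group.group_comm_groupI[OF grp]) (auto simp: X.m_comm Y.m_comm)
  interpret f: group_hom K X f
    by (simp add: group_hom_def group_hom_axioms_def f X.is_group K.is_group)
  interpret g: group_hom K Y g
    by (simp add: group_hom_def group_hom_axioms_def g Y.is_group K.is_group)
  define h where "h k = (f k, inv\<^bsub>Y\<^esub> (g k))" for k
  have "h \<in> hom K (X \<times>\<times> Y)"
    by (auto simp: h_def hom_def Y.inv_mult)
  then interpret h: group_hom K "X \<times>\<times> Y" h
    by (simp add: group_hom_def group_hom_axioms_def P.is_group K.is_group)
  define N where "N = h ` carrier K"
  have N: "N \<lhd> X \<times>\<times> Y"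
    unfolding N_def by (intro P.subgroup_imp_normal h.img_is_subgroup)
  interpret N: normal N "X \<times>\<times> Y" by (rule N)
  interpret \<pi>: group_hom "X \<times>\<times> Y" "(X \<times>\<times> Y) Mod N" "\<lambda>x. N #>\<^bsub>X \<times>\<times> Y\<^esub> x"
    by (rule N.group_hom_rcoset)
  define i where "i x = N #>\<^bsub>X \<times>\<times> Y\<^esub> (x, \<one>\<^bsub>Y\<^esub>)" for x
  define j where "j y = N #>\<^bsub>X \<times>\<times> Y\<^esub> (\<one>\<^bsub>X\<^esub>, y)" for y
  show thesis
  proof (rule that)
    show "comm_group ((X \<times>\<times> Y) Mod N)"
      by (rule P.abelian_FactGroup[OF N.is_subgroup])
    show "i \<in> hom X ((X \<times>\<times> Y) Mod N)"
    proof (rule homI)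
      fix x y assume "x \<in> carrier X" "y \<in> carrier X"
      then show "i (x \<otimes>\<^bsub>X\<^esub> y) = i x \<otimes>\<^bsub>(X \<times>\<times> Y) Mod N\<^esub> i y"
        using \<pi>.hom_mult[of "(x, \<one>\<^bsub>Y\<^esub>)" "(y, \<one>\<^bsub>Y\<^esub>)"] unfolding i_def by simp
    qed (use \<pi>.hom_closed in \<open>simp add: i_def\<close>)
    show "j \<in> hom Y ((X \<times>\<times> Y) Mod N)"
    proof (rule homI)
      fix x y assume "x \<in> carrier Y" "y \<in> carrier Y"
      then show "j (x \<otimes>\<^bsub>Y\<^esub> y) = j x \<otimes>\<^bsub>(X \<times>\<times> Y) Mod N\<^esub> j y"
        using \<pi>.hom_mult[of "(\<one>\<^bsub>X\<^esub>, x)" "(\<one>\<^bsub>X\<^esub>, y)"] unfolding j_def by simp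
    qed (use \<pi>.hom_closed in \<open>simp add: j_def\<close>)
  next
    fix x assume x: "x \<in> carrier X"
    have "i x = \<one>\<^bsub>(X \<times>\<times> Y) Mod N\<^esub> \<longleftrightarrow> (x, \<one>\<^bsub>Y\<^esub>) \<in> N"
      unfolding i_def using x by (intro N.rcoset_eq_one_iff) simp
    also have "\<dots> \<longleftrightarrow> x = \<one>\<^bsub>X\<^esub>"
    proof
      assume "(x, \<one>\<^bsub>Y\<^esub>) \<in> N"
      then obtain k where "k \<in> carrier K" "h k = (x, \<one>\<^bsub>Y\<^esub>)"
        unfolding N_def by (metis imageE)
      then show "x = \<one>\<^bsub>X\<^esub>"
        using ker[of k] Y.inv_eq_1_iff[of "g k"] by (simp add: h_def)
    qed (use N.one_closed[unfolded one_DirProd] in \<open>simp only:\<close>)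
    finally show "i x = \<one>\<^bsub>(X \<times>\<times> Y) Mod N\<^esub> \<longleftrightarrow> x = \<one>\<^bsub>X\<^esub>" .
  next
    fix y assume y: "y \<in> carrier Y"
    have "j y = \<one>\<^bsub>(X \<times>\<times> Y) Mod N\<^esub> \<longleftrightarrow> (\<one>\<^bsub>X\<^esub>, y) \<in> N"
      unfolding j_def using y by (intro N.rcoset_eq_one_iff) simp
    also have "\<dots> \<longleftrightarrow> y = \<one>\<^bsub>Y\<^esub>"
    proof
      assume "(\<one>\<^bsub>X\<^esub>, y) \<in> N"
      then obtain k where "k \<in> carrier K" "h k = (\<one>\<^bsub>X\<^esub>, y)"
        unfolding N_def by (metis imageE)
      then show "y = \<one>\<^bsub>Y\<^esub>"
        using ker[of k] by (auto simp add: h_def)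
    qed (use N.one_closed[unfolded one_DirProd] in \<open>simp only:\<close>)
    finally show "j y = \<one>\<^bsub>(X \<times>\<times> Y) Mod N\<^esub> \<longleftrightarrow> y = \<one>\<^bsub>Y\<^esub>" .
  next
    fix k assume k: "k \<in> carrier K"
    \<comment> \<open>Multiplying by the coset of \<open>h k\<close>, which is trivial, changes the
      pair of one and \<open>g k\<close> into the pair of \<open>f k\<close> and one.\<close>
    have "j (g k) = \<one>\<^bsub>(X \<times>\<times> Y) Mod N\<^esub> \<otimes>\<^bsub>(X \<times>\<times> Y) Mod N\<^esub> j (g k)"
      using k \<pi>.hom_closed by (simp add: j_def del: mult_FactGroup one_FactGroup)
    also have "\<one>\<^bsub>(X \<times>\<times> Y) Mod N\<^esub> = N #>\<^bsub>X \<times>\<times> Y\<^esub> h k"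
      by (rule iffD2[OF N.rcoset_eq_one_iff[OF h.hom_closed[OF k]], symmetric]) (simp add: N_def k)
    also have "\<dots> \<otimes>\<^bsub>(X \<times>\<times> Y) Mod N\<^esub> j (g k) = i (f k)"
      using k \<pi>.hom_mult[of "h k" "(\<one>\<^bsub>X\<^esub>, g k)"] by (simp add: i_def j_def h_def)
    finally show "i (f k) = j (g k)" by simp
  qed
qed

section \<open>Equivariant sections and lifts to the wreath product\<close>

text \<open>The image of \<alpha> acts on \<open>Q\<close> by left multiplication. A representative
  \<open>rep x\<close> is fixed in each orbit, and \<theta> picks an element of \<open>A\<close>
  whose image moves it to \<open>x\<close>. As this element is arbitrary in its fibre, equivariance
  holds only after applying \<alpha>.\<close>

lemma equivariant_section:
  assumes "group A" "group Q" "\<alpha> \<in> hom A Q"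
  obtains \<theta> where "\<And>x. x \<in> carrier Q \<Longrightarrow> \<theta> x \<in> carrier A"
    and "\<And>a x. \<lbrakk>a \<in> carrier A; x \<in> carrier Q\<rbrakk> \<Longrightarrow> \<alpha> (\<theta> (\<alpha> a \<otimes>\<^bsub>Q\<^esub> x)) = \<alpha> a \<otimes>\<^bsub>Q\<^esub> \<alpha> (\<theta> x)"
proof -
  interpret \<alpha>: group_hom A Q \<alpha>
    using assms by (simp add: group_hom_def group_hom_axioms_def)
  define orb where "orb x = {\<alpha> a \<otimes>\<^bsub>Q\<^esub> x | a. a \<in> carrier A}" for x
  define rep where "rep x = (SOME y. y \<in> orb x)" for x
  define \<theta> where "\<theta> x = (SOME a. a \<in> carrier A \<and> x = \<alpha> a \<otimes>\<^bsub>Q\<^esub> rep x)" for x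
  have orb: "orb (\<alpha> a \<otimes>\<^bsub>Q\<^esub> x) = orb x" if a: "a \<in> carrier A" and x: "x \<in> carrier Q" for a x
  proof (intro equalityI subsetI)
    fix y assume "y \<in> orb (\<alpha> a \<otimes>\<^bsub>Q\<^esub> x)"
    then obtain b where "b \<in> carrier A" "y = \<alpha> (b \<otimes>\<^bsub>A\<^esub> a) \<otimes>\<^bsub>Q\<^esub> x"
      using a x by (auto simp: orb_def \<alpha>.H.m_assoc)
    then show "y \<in> orb x" unfolding orb_def using a by blast
  next
    fix y assume "y \<in> orb x"
    then obtain b where b: "b \<in> carrier A" "y = \<alpha> b \<otimes>\<^bsub>Q\<^esub> x" by (auto simp: orb_def)
    then have "y = \<alpha> (b \<otimes>\<^bsub>A\<^esub> inv\<^bsub>A\<^esub> a) \<otimes>\<^bsub>Q\<^esub> (\<alpha> a \<otimes>\<^bsub>Q\<^esub> x)"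
      using a x by (simp add: \<alpha>.H.word_simps)
    then show "y \<in> orb (\<alpha> a \<otimes>\<^bsub>Q\<^esub> x)" unfolding orb_def using a b by blast
  qed
  have rep: "rep x \<in> carrier Q \<and> (\<exists>a. a \<in> carrier A \<and> x = \<alpha> a \<otimes>\<^bsub>Q\<^esub> rep x)" if x: "x \<in> carrier Q" for x
  proof -
    have "x \<in> orb x"
      using x \<alpha>.hom_one by (auto simp: orb_def intro!: exI[of _ "\<one>\<^bsub>A\<^esub>"])
    then have "rep x \<in> orb x" unfolding rep_def by (rule someI)
    then obtain a where a: "a \<in> carrier A" "rep x = \<alpha> a \<otimes>\<^bsub>Q\<^esub> x" by (auto simp: orb_def)
    then have "x = \<alpha> (inv\<^bsub>A\<^esub> a) \<otimes>\<^bsub>Q\<^esub> rep x"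
      using x by (simp add: \<alpha>.H.word_simps)
    then show ?thesis using a x by (metis \<alpha>.G.inv_closed \<alpha>.H.m_closed \<alpha>.hom_closed)
  qed
  have \<theta>: "\<theta> x \<in> carrier A \<and> x = \<alpha> (\<theta> x) \<otimes>\<^bsub>Q\<^esub> rep x" if x: "x \<in> carrier Q" for x
    unfolding \<theta>_def by (rule someI_ex) (use rep[OF x] in blast)
  have "\<alpha> (\<theta> (\<alpha> a \<otimes>\<^bsub>Q\<^esub> x)) = \<alpha> a \<otimes>\<^bsub>Q\<^esub> \<alpha> (\<theta> x)" if a: "a \<in> carrier A" and x: "x \<in> carrier Q" for a x
  proof -
    have ax: "\<alpha> a \<otimes>\<^bsub>Q\<^esub> x \<in> carrier Q" using a x by simp
    have "rep (\<alpha> a \<otimes>\<^bsub>Q\<^esub> x) = rep x" by (simp add: rep_def orb a x)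
    then have "\<alpha> (\<theta> (\<alpha> a \<otimes>\<^bsub>Q\<^esub> x)) \<otimes>\<^bsub>Q\<^esub> rep x = \<alpha> a \<otimes>\<^bsub>Q\<^esub> x"
      using \<theta>[OF ax] by simp
    also have "\<dots> = \<alpha> a \<otimes>\<^bsub>Q\<^esub> \<alpha> (\<theta> x) \<otimes>\<^bsub>Q\<^esub> rep x"
      using \<theta>[OF x] rep[OF x] a by (simp add: \<alpha>.H.m_assoc)
    finally show ?thesis
      using \<theta>[OF x] \<theta>[OF ax] rep[OF x] a by simp
  qed
  with \<theta> that show thesis by blast
qed

lemma (in normal) comm_group_central_quotient:
  assumes "subgroup K G" "K \<subseteq> central_mod G H"
  shows "comm_group ((G Mod H)\<lparr>carrier := (\<lambda>x. H #> x) ` K\<rparr>)"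
proof -
  interpret \<pi>: group_hom G "G Mod H" "\<lambda>x. H #> x" by (rule group_hom_rcoset)
  have "subgroup ((\<lambda>x. H #> x) ` K) (G Mod H)"
    by (rule \<pi>.subgroup_img_is_subgroup[OF assms(1)])
  then have grp: "group ((G Mod H)\<lparr>carrier := (\<lambda>x. H #> x) ` K\<rparr>)"
    by (rule subgroup.subgroup_is_group) (rule \<pi>.H.is_group)
  have comm: "(H #> x) \<otimes>\<^bsub>G Mod H\<^esub> (H #> y) = (H #> y) \<otimes>\<^bsub>G Mod H\<^esub> (H #> x)"
    if "x \<in> K" "y \<in> K" for x y
  proof -
    have "x \<in> carrier G" "y \<in> central_mod G H"
      using that assms(2) subgroup.mem_carrier[OF assms(1)] by auto
    then show ?thesis unfolding central_mod_iff by blast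
  qed
  show ?thesis
  proof (rule group.group_comm_groupI[OF grp])
    fix X Y
    assume "X \<in> carrier ((G Mod H)\<lparr>carrier := (\<lambda>x. H #> x) ` K\<rparr>)"
      and "Y \<in> carrier ((G Mod H)\<lparr>carrier := (\<lambda>x. H #> x) ` K\<rparr>)"
    then obtain x y where "x \<in> K" "X = H #> x" "y \<in> K" "Y = H #> y"
      by auto
    then show "X \<otimes>\<^bsub>(G Mod H)\<lparr>carrier := (\<lambda>x. H #> x) ` K\<rparr>\<^esub> Y =
        Y \<otimes>\<^bsub>(G Mod H)\<lparr>carrier := (\<lambda>x. H #> x) ` K\<rparr>\<^esub> X"
      using comm[of x y] by simp
  qed
qed

text \<open>A homomorphism \<open>\<lambda>\<close> on the kernel of \<open>\<alpha> : A \<rightarrow> Q\<close> that is invariant under conjugation lifts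
  \<open>\<alpha>\<close> to the wreath product.  The lift depends on an equivariant section \<open>Q \<rightarrow> A\<close>, which can be
  chosen so that on \<open>C\<close> the lift is prescribed by a given \<open>C\<close>-equivariant section \<open>s\<close>.\<close>

lemma wreath_lift:
  assumes "group A" "group Q" "\<alpha> \<in> hom A Q"
    and lam_closed: "\<And>a. \<lbrakk>a \<in> carrier A; \<alpha> a = \<one>\<^bsub>Q\<^esub>\<rbrakk> \<Longrightarrow> lam a \<in> carrier U"
    and lam_mult: "\<And>a b. \<lbrakk>a \<in> carrier A; \<alpha> a = \<one>\<^bsub>Q\<^esub>; b \<in> carrier A; \<alpha> b = \<one>\<^bsub>Q\<^esub>\<rbrakk> \<Longrightarrow>
      lam (a \<otimes>\<^bsub>A\<^esub> b) = lam a \<otimes>\<^bsub>U\<^esub> lam b"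
    and lam_conj: "\<And>a t. \<lbrakk>a \<in> carrier A; \<alpha> a = \<one>\<^bsub>Q\<^esub>; t \<in> carrier A\<rbrakk> \<Longrightarrow>
      lam (inv\<^bsub>A\<^esub> t \<otimes>\<^bsub>A\<^esub> a \<otimes>\<^bsub>A\<^esub> t) = lam a"
    and C: "C \<subseteq> carrier A" and s: "\<And>x. x \<in> carrier Q \<Longrightarrow> s x \<in> carrier A"
    and s_eq: "\<And>c x. \<lbrakk>c \<in> C; x \<in> carrier Q\<rbrakk> \<Longrightarrow> \<alpha> (s (\<alpha> c \<otimes>\<^bsub>Q\<^esub> x)) = \<alpha> c \<otimes>\<^bsub>Q\<^esub> \<alpha> (s x)"
  obtains D where "(\<lambda>a. (D a, \<alpha> a)) \<in> hom A (wreath U Q)"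
    and "\<And>a. \<lbrakk>a \<in> carrier A; \<alpha> a = \<one>\<^bsub>Q\<^esub>\<rbrakk> \<Longrightarrow> D a = (\<lambda>x \<in> carrier Q. lam a)"
    and "\<And>c. c \<in> C \<Longrightarrow> D c =
      (\<lambda>x \<in> carrier Q. lam (inv\<^bsub>A\<^esub> (s x) \<otimes>\<^bsub>A\<^esub> c \<otimes>\<^bsub>A\<^esub> s (inv\<^bsub>Q\<^esub> (\<alpha> c) \<otimes>\<^bsub>Q\<^esub> x)))"
proof -
  interpret \<alpha>: group_hom A Q \<alpha>
    using assms(1-3) by (simp add: group_hom_def group_hom_axioms_def)
  obtain \<theta>\<^sub>0 where \<theta>\<^sub>0: "\<And>x. x \<in> carrier Q \<Longrightarrow> \<theta>\<^sub>0 x \<in> carrier A"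
    and \<theta>\<^sub>0_eq: "\<And>a x. \<lbrakk>a \<in> carrier A; x \<in> carrier Q\<rbrakk> \<Longrightarrow> \<alpha> (\<theta>\<^sub>0 (\<alpha> a \<otimes>\<^bsub>Q\<^esub> x)) = \<alpha> a \<otimes>\<^bsub>Q\<^esub> \<alpha> (\<theta>\<^sub>0 x)"
    using equivariant_section[OF assms(1-3)] by blast
  \<comment> \<open>The factor by which \<open>s\<close> misses \<open>x\<close>. It is constant on
    the orbits of the image of \<open>C\<close>, since \<open>s\<close> is equivariant for
    \<open>C\<close>.\<close>
  define r where "r x = inv\<^bsub>Q\<^esub> (\<alpha> (s x)) \<otimes>\<^bsub>Q\<^esub> x" for x
  \<comment> \<open>This correction of \<open>s\<close> has the same image under \<alpha> as
    \<open>\<theta>\<^sub>0\<close>, so it is equivariant for all of \<open>A\<close>; on an orbit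
    of \<open>C\<close> it differs from \<open>s\<close> only by a fixed right factor.\<close>
  define \<theta> where "\<theta> x = s x \<otimes>\<^bsub>A\<^esub> \<theta>\<^sub>0 (r x)" for x
  \<comment> \<open>Measures how far \<theta> is from being equivariant before \<alpha> is applied;
    its values lie in the kernel of \<alpha>, where \<open>lam\<close> is defined.\<close>
  define \<gamma> where "\<gamma> a x = inv\<^bsub>A\<^esub> (\<theta> x) \<otimes>\<^bsub>A\<^esub> a \<otimes>\<^bsub>A\<^esub> \<theta> (inv\<^bsub>Q\<^esub> (\<alpha> a) \<otimes>\<^bsub>Q\<^esub> x)" for a x
  define D where "D a = (\<lambda>x \<in> carrier Q. lam (\<gamma> a x))" for a
  have r: "r x \<in> carrier Q" if "x \<in> carrier Q" for x
    using that s by (simp add: r_def)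
  have \<theta>: "\<theta> x \<in> carrier A" if "x \<in> carrier Q" for x
    using that s r \<theta>\<^sub>0 by (simp add: \<theta>_def)
  have \<alpha>\<theta>: "\<alpha> (\<theta> x) = \<alpha> (\<theta>\<^sub>0 x)" if x: "x \<in> carrier Q" for x
  proof -
    have "\<alpha> (\<theta>\<^sub>0 (r x)) = inv\<^bsub>Q\<^esub> (\<alpha> (s x)) \<otimes>\<^bsub>Q\<^esub> \<alpha> (\<theta>\<^sub>0 x)"
      using \<theta>\<^sub>0_eq[of "inv\<^bsub>A\<^esub> (s x)" x] s x by (simp add: r_def)
    then show ?thesis
      using s \<theta>\<^sub>0 r x by (simp add: \<theta>_def \<alpha>.H.inv_mult_cancel)
  qed
  have \<gamma>: "\<gamma> a x \<in> carrier A" if "a \<in> carrier A" "x \<in> carrier Q" for a x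
    using that \<theta> by (simp add: \<gamma>_def)
  have \<gamma>_ker: "\<alpha> (\<gamma> a x) = \<one>\<^bsub>Q\<^esub>" if a: "a \<in> carrier A" and x: "x \<in> carrier Q" for a x
  proof -
    have "\<alpha> (\<theta> (inv\<^bsub>Q\<^esub> (\<alpha> a) \<otimes>\<^bsub>Q\<^esub> x)) = inv\<^bsub>Q\<^esub> (\<alpha> a) \<otimes>\<^bsub>Q\<^esub> \<alpha> (\<theta> x)"
      using \<theta>\<^sub>0_eq[of "inv\<^bsub>A\<^esub> a" x] a x by (simp add: \<alpha>\<theta>)
    then show ?thesis
      using a x \<theta> by (simp add: \<gamma>_def \<alpha>.H.word_simps)
  qed
  show thesis
  proof (rule that)
    show "(\<lambda>a. (D a, \<alpha> a)) \<in> hom A (wreath U Q)"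
    proof (rule wreath_homI[OF assms(3)])
      show "D a \<in> carrier Q \<rightarrow>\<^sub>E carrier U" if "a \<in> carrier A" for a
        using that by (simp add: D_def lam_closed \<gamma> \<gamma>_ker)
    next
      fix a b x assume a: "a \<in> carrier A" and b: "b \<in> carrier A" and x: "x \<in> carrier Q"
      let ?y = "inv\<^bsub>Q\<^esub> (\<alpha> a) \<otimes>\<^bsub>Q\<^esub> x"
      have y: "?y \<in> carrier Q" using a x by simp
      have "inv\<^bsub>Q\<^esub> (\<alpha> (a \<otimes>\<^bsub>A\<^esub> b)) \<otimes>\<^bsub>Q\<^esub> x = inv\<^bsub>Q\<^esub> (\<alpha> b) \<otimes>\<^bsub>Q\<^esub> ?y"
        using a b x by (simp add: \<alpha>.H.word_simps)
      then have "\<gamma> (a \<otimes>\<^bsub>A\<^esub> b) x = \<gamma> a x \<otimes>\<^bsub>A\<^esub> \<gamma> b ?y"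
        using a b \<theta>[OF x] \<theta>[OF y] \<theta>[of "inv\<^bsub>Q\<^esub> (\<alpha> b) \<otimes>\<^bsub>Q\<^esub> ?y"] y
        by (simp add: \<gamma>_def \<alpha>.G.word_simps)
      then show "D (a \<otimes>\<^bsub>A\<^esub> b) x = D a x \<otimes>\<^bsub>U\<^esub> D b ?y"
        using a b x y by (simp add: D_def lam_mult \<gamma> \<gamma>_ker)
    qed (rule assms(1))
  next
    fix a assume a: "a \<in> carrier A" "\<alpha> a = \<one>\<^bsub>Q\<^esub>"
    have "lam (\<gamma> a x) = lam a" if "x \<in> carrier Q" for x
      using that a \<theta> by (simp add: \<gamma>_def lam_conj)
    then show "D a = (\<lambda>x \<in> carrier Q. lam a)"
      by (simp add: D_def cong: restrict_cong)
  next
    fix c assume c: "c \<in> C"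
    then have cA: "c \<in> carrier A" using C by blast
    have "lam (\<gamma> c x) = lam (inv\<^bsub>A\<^esub> (s x) \<otimes>\<^bsub>A\<^esub> c \<otimes>\<^bsub>A\<^esub> s (inv\<^bsub>Q\<^esub> (\<alpha> c) \<otimes>\<^bsub>Q\<^esub> x))"
      if x: "x \<in> carrier Q" for x
    proof -
      let ?y = "inv\<^bsub>Q\<^esub> (\<alpha> c) \<otimes>\<^bsub>Q\<^esub> x"
      let ?d = "inv\<^bsub>A\<^esub> (s x) \<otimes>\<^bsub>A\<^esub> c \<otimes>\<^bsub>A\<^esub> s ?y"
      have y: "?y \<in> carrier Q" using cA x by simp
      have sx: "\<alpha> (s x) = \<alpha> c \<otimes>\<^bsub>Q\<^esub> \<alpha> (s ?y)"
        using s_eq[OF c y] cA x by (simp add: \<alpha>.H.inv_mult_cancel)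
      then have ry: "r ?y = r x"
        using s y cA x by (simp add: r_def \<alpha>.H.word_simps)
      have d: "?d \<in> carrier A" using s x y cA by simp
      have "\<alpha> ?d = \<one>\<^bsub>Q\<^esub>"
        using s x y cA sx[symmetric] by (simp add: \<alpha>.H.m_assoc)
      \<comment> \<open>The fixed right factor appears as a conjugation, which \<open>lam\<close>
        does not see.\<close>
      moreover have "\<gamma> c x = inv\<^bsub>A\<^esub> (\<theta>\<^sub>0 (r x)) \<otimes>\<^bsub>A\<^esub> ?d \<otimes>\<^bsub>A\<^esub> \<theta>\<^sub>0 (r x)"
        using s x y cA r \<theta>\<^sub>0 ry by (simp add: \<gamma>_def \<theta>_def \<alpha>.G.word_simps)
      ultimately show ?thesis
        using lam_conj[OF d] \<theta>\<^sub>0 r x by simp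
    qed
    then show "D c = (\<lambda>x \<in> carrier Q. lam (inv\<^bsub>A\<^esub> (s x) \<otimes>\<^bsub>A\<^esub> c \<otimes>\<^bsub>A\<^esub> s (inv\<^bsub>Q\<^esub> (\<alpha> c) \<otimes>\<^bsub>Q\<^esub> x)))"
      by (simp add: D_def cong: restrict_cong)
  qed
qed

lemma (in normal) rcoset_hom_central_quotient:
  assumes "subgroup K G"
  shows "(\<lambda>x. H #> x) \<in> hom (G\<lparr>carrier := K\<rparr>) ((G Mod H)\<lparr>carrier := (\<lambda>x. H #> x) ` K\<rparr>)"
  using assms rcos_sum[OF subgroup.mem_carrier[OF assms] subgroup.mem_carrier[OF assms]]
  by (auto simp: hom_def)

text \<open>One central layer of the descent. The kernels modulo \<open>A2\<close> and
  \<open>B2\<close> are abelian and are glued along \<open>C\<close> in a pushout \<open>U\<close>,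
  where \<open>compat\<close> gives injectivity. Both lifts use one section with values in
  \<open>C\<close>, carried to \<open>B\<close> by \<phi>, so they agree on \<open>C\<close>. On the
  kernel of \<alpha> the lift is a constant function with trivial value exactly on
  \<open>A2\<close>; elements outside the kernel are detected in \<open>Q\<close>. The same holds
  for \<open>B\<close>.\<close>

lemma wreath_layer:
  fixes A :: "('a, 'm) monoid_scheme" and B :: "('b, 'n) monoid_scheme"
    and Q :: "('q, 'l) monoid_scheme"
  assumes "group A" "group B" "group Q" "solvable Q"
    and \<alpha>: "\<alpha> \<in> hom A Q" and \<beta>: "\<beta> \<in> hom B Q"
    and C: "subgroup C A" and \<phi>: "\<phi> \<in> hom (A\<lparr>carrier := C\<rparr>) B"
    and agree: "\<And>c. c \<in> C \<Longrightarrow> \<alpha> c = \<beta> (\<phi> c)"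
    and A2: "A2 \<lhd> A" "A2 \<subseteq> kernel A Q \<alpha>" "kernel A Q \<alpha> \<subseteq> central_mod A A2"
    and B2: "B2 \<lhd> B" "B2 \<subseteq> kernel B Q \<beta>" "kernel B Q \<beta> \<subseteq> central_mod B B2"
    and compat: "\<And>c. c \<in> C \<Longrightarrow> c \<in> A2 \<longleftrightarrow> \<phi> c \<in> B2"
  obtains W :: "(('q \<Rightarrow> ('a set \<times> 'b set) set) \<times> 'q) monoid" and \<alpha>' \<beta>'
  where "group W" "solvable W" "\<alpha>' \<in> hom A W" "\<beta>' \<in> hom B W"
    and "\<And>c. c \<in> C \<Longrightarrow> \<alpha>' c = \<beta>' (\<phi> c)"
    and "kernel A W \<alpha>' = A2" "kernel B W \<beta>' = B2"
proof -
  interpret A: group A by fact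
  interpret B: group B by fact
  interpret Q: group Q by fact
  interpret \<alpha>: group_hom A Q \<alpha>
    using \<alpha> by (simp add: group_hom_def group_hom_axioms_def A.is_group Q.is_group)
  interpret \<beta>: group_hom B Q \<beta>
    using \<beta> by (simp add: group_hom_def group_hom_axioms_def B.is_group Q.is_group)
  interpret A2: normal A2 A by fact
  interpret B2: normal B2 B by fact
  let ?C = "A\<lparr>carrier := C\<rparr>"
  have grpC: "group ?C" by (rule subgroup.subgroup_is_group[OF C A.is_group])
  interpret \<phi>: group_hom ?C B \<phi>
    using \<phi> grpC by (simp add: group_hom_def group_hom_axioms_def B.is_group)
  have CA: "c \<in> carrier A" if "c \<in> C" for c
    using that subgroup.mem_carrier[OF C] by blast
  have \<phi>C: "\<phi> c \<in> carrier B" if "c \<in> C" for c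
    using \<phi>.hom_closed that by simp
  have \<phi>_mult: "\<phi> (c \<otimes>\<^bsub>A\<^esub> d) = \<phi> c \<otimes>\<^bsub>B\<^esub> \<phi> d" if "c \<in> C" "d \<in> C" for c d
    using \<phi>.hom_mult that by simp
  have \<phi>_inv: "\<phi> (inv\<^bsub>A\<^esub> c) = inv\<^bsub>B\<^esub> (\<phi> c)" if "c \<in> C" for c
    using \<phi>.hom_inv[of c] that A.m_inv_consistent[OF C that] by simp
  define A1 where "A1 = kernel A Q \<alpha>"
  define B1 where "B1 = kernel B Q \<beta>"
  have A1: "subgroup A1 A" and B1: "subgroup B1 B"
    unfolding A1_def B1_def by (rule \<alpha>.subgroup_kernel \<beta>.subgroup_kernel)+
  have A1_iff: "a \<in> A1 \<longleftrightarrow> a \<in> carrier A \<and> \<alpha> a = \<one>\<^bsub>Q\<^esub>" for a by (auto simp: A1_def kernel_def)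
  have B1_iff: "b \<in> B1 \<longleftrightarrow> b \<in> carrier B \<and> \<beta> b = \<one>\<^bsub>Q\<^esub>" for b by (auto simp: B1_def kernel_def)
  define X where "X = (A Mod A2)\<lparr>carrier := (\<lambda>x. A2 #>\<^bsub>A\<^esub> x) ` A1\<rparr>"
  define Y where "Y = (B Mod B2)\<lparr>carrier := (\<lambda>x. B2 #>\<^bsub>B\<^esub> x) ` B1\<rparr>"
  have X: "comm_group X"
    unfolding X_def A1_def by (rule A2.comm_group_central_quotient[OF \<alpha>.subgroup_kernel A2(3)])
  have Y: "comm_group Y"
    unfolding Y_def B1_def by (rule B2.comm_group_central_quotient[OF \<beta>.subgroup_kernel B2(3)])
  have fX: "(\<lambda>x. A2 #>\<^bsub>A\<^esub> x) \<in> hom (A\<lparr>carrier := A1\<rparr>) X"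
    unfolding X_def by (rule A2.rcoset_hom_central_quotient[OF A1])
  have fY: "(\<lambda>x. B2 #>\<^bsub>B\<^esub> x) \<in> hom (B\<lparr>carrier := B1\<rparr>) Y"
    unfolding Y_def by (rule B2.rcoset_hom_central_quotient[OF B1])
  have X1: "A2 #>\<^bsub>A\<^esub> a = \<one>\<^bsub>X\<^esub> \<longleftrightarrow> a \<in> A2" if "a \<in> carrier A" for a
    using A2.rcoset_eq_one_iff[OF that] by (simp add: X_def)
  have Y1: "B2 #>\<^bsub>B\<^esub> b = \<one>\<^bsub>Y\<^esub> \<longleftrightarrow> b \<in> B2" if "b \<in> carrier B" for b
    using B2.rcoset_eq_one_iff[OF that] by (simp add: Y_def)
  let ?K = "A\<lparr>carrier := C \<inter> A1\<rparr>"
  have "subgroup (C \<inter> A1) A" by (rule A.subgroups_Inter_pair[OF C A1])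
  then have K: "group ?K" by (rule subgroup.subgroup_is_group[OF _ A.is_group])
  have \<phi>B1: "\<phi> k \<in> B1" if "k \<in> C \<inter> A1" for k
    using that \<phi>C[of k] agree[of k] by (simp add: A1_iff B1_iff)
  have f: "(\<lambda>k. A2 #>\<^bsub>A\<^esub> k) \<in> hom ?K X"
    using fX by (auto simp: hom_def)
  have g: "(\<lambda>k. B2 #>\<^bsub>B\<^esub> \<phi> k) \<in> hom ?K Y"
    using fY \<phi>B1 \<phi>_mult by (auto simp: hom_def Pi_iff)
  have fg: "A2 #>\<^bsub>A\<^esub> k = \<one>\<^bsub>X\<^esub> \<longleftrightarrow> B2 #>\<^bsub>B\<^esub> \<phi> k = \<one>\<^bsub>Y\<^esub>" if "k \<in> carrier ?K" for k
    using that X1[OF CA] Y1[OF \<phi>C] compat by simp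
  obtain U :: "('a set \<times> 'b set) set monoid" and i j
    where U: "comm_group U" and i: "i \<in> hom X U" and j: "j \<in> hom Y U"
    and i1: "\<And>x. x \<in> carrier X \<Longrightarrow> i x = \<one>\<^bsub>U\<^esub> \<longleftrightarrow> x = \<one>\<^bsub>X\<^esub>"
    and j1: "\<And>y. y \<in> carrier Y \<Longrightarrow> j y = \<one>\<^bsub>U\<^esub> \<longleftrightarrow> y = \<one>\<^bsub>Y\<^esub>"
    and ij: "\<And>k. k \<in> carrier ?K \<Longrightarrow> i (A2 #>\<^bsub>A\<^esub> k) = j (B2 #>\<^bsub>B\<^esub> \<phi> k)"
    using pushout_comm_group[OF X Y K f g fg] by blast
  interpret U: comm_group U by fact
  have \<alpha>C: "\<alpha> \<in> hom ?C Q"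
    using \<alpha> CA by (auto simp: hom_def)
  \<comment> \<open>The section is taken for the restriction of \<alpha> to \<open>C\<close>, so
    that its values can be mapped by \<phi>.\<close>
  obtain s where s: "\<And>x. x \<in> carrier Q \<Longrightarrow> s x \<in> C"
    and s_eq: "\<And>c x. \<lbrakk>c \<in> C; x \<in> carrier Q\<rbrakk> \<Longrightarrow> \<alpha> (s (\<alpha> c \<otimes>\<^bsub>Q\<^esub> x)) = \<alpha> c \<otimes>\<^bsub>Q\<^esub> \<alpha> (s x)"
    using equivariant_section[OF grpC Q.is_group \<alpha>C] by auto
  have iX: "A2 #>\<^bsub>A\<^esub> a \<in> carrier X" if "a \<in> A1" for a
    using that by (simp add: X_def)
  have jY: "B2 #>\<^bsub>B\<^esub> b \<in> carrier Y" if "b \<in> B1" for b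
    using that by (simp add: Y_def)
  obtain D where D: "(\<lambda>a. (D a, \<alpha> a)) \<in> hom A (wreath U Q)"
    and D_ker: "\<And>a. \<lbrakk>a \<in> carrier A; \<alpha> a = \<one>\<^bsub>Q\<^esub>\<rbrakk> \<Longrightarrow> D a = (\<lambda>x \<in> carrier Q. i (A2 #>\<^bsub>A\<^esub> a))"
    and D_C: "\<And>c. c \<in> C \<Longrightarrow> D c =
      (\<lambda>x \<in> carrier Q. i (A2 #>\<^bsub>A\<^esub> (inv\<^bsub>A\<^esub> (s x) \<otimes>\<^bsub>A\<^esub> c \<otimes>\<^bsub>A\<^esub> s (inv\<^bsub>Q\<^esub> (\<alpha> c) \<otimes>\<^bsub>Q\<^esub> x))))"
  proof (rule wreath_lift[OF A.is_group Q.is_group \<alpha>, of "\<lambda>a. i (A2 #>\<^bsub>A\<^esub> a)" U C s])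
    fix a assume a: "a \<in> carrier A" "\<alpha> a = \<one>\<^bsub>Q\<^esub>"
    then have a1: "a \<in> A1" by (simp add: A1_iff)
    show "i (A2 #>\<^bsub>A\<^esub> a) \<in> carrier U"
      using hom_in_carrier[OF i iX[OF a1]] .
    show "i (A2 #>\<^bsub>A\<^esub> (a \<otimes>\<^bsub>A\<^esub> b)) = i (A2 #>\<^bsub>A\<^esub> a) \<otimes>\<^bsub>U\<^esub> i (A2 #>\<^bsub>A\<^esub> b)"
      if "b \<in> carrier A" "\<alpha> b = \<one>\<^bsub>Q\<^esub>" for b
      using that a1 hom_mult[OF fX, of a b] hom_mult[OF i iX iX, of a b] by (simp add: A1_iff)
    show "i (A2 #>\<^bsub>A\<^esub> (inv\<^bsub>A\<^esub> t \<otimes>\<^bsub>A\<^esub> a \<otimes>\<^bsub>A\<^esub> t)) = i (A2 #>\<^bsub>A\<^esub> a)" if t: "t \<in> carrier A" for t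
    proof -
      have "a \<in> central_mod A A2" using a1 A2(3) by (auto simp: A1_def)
      then have "inv\<^bsub>A\<^esub> t \<otimes>\<^bsub>A\<^esub> a \<otimes>\<^bsub>A\<^esub> inv\<^bsub>A\<^esub> (inv\<^bsub>A\<^esub> t) \<otimes>\<^bsub>A\<^esub> inv\<^bsub>A\<^esub> a \<in> A2"
        using A.inv_closed[OF t] unfolding central_mod_def by blast
      then have "inv\<^bsub>A\<^esub> t \<otimes>\<^bsub>A\<^esub> a \<otimes>\<^bsub>A\<^esub> t \<otimes>\<^bsub>A\<^esub> inv\<^bsub>A\<^esub> a \<in> A2"
        using t by simp
      then have "inv\<^bsub>A\<^esub> t \<otimes>\<^bsub>A\<^esub> a \<otimes>\<^bsub>A\<^esub> t \<in> A2 #>\<^bsub>A\<^esub> a"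
        using t a by (intro A2.rcos_module_rev[OF A.is_group]) simp_all
      then show ?thesis
        using A.repr_independence[OF _ a(1) A2.is_subgroup] by simp
    qed
  qed (use s CA s_eq that in auto)
  obtain E where E: "(\<lambda>b. (E b, \<beta> b)) \<in> hom B (wreath U Q)"
    and E_ker: "\<And>b. \<lbrakk>b \<in> carrier B; \<beta> b = \<one>\<^bsub>Q\<^esub>\<rbrakk> \<Longrightarrow> E b = (\<lambda>x \<in> carrier Q. j (B2 #>\<^bsub>B\<^esub> b))"
    and E_C: "\<And>c. c \<in> \<phi> ` C \<Longrightarrow> E c =
      (\<lambda>x \<in> carrier Q. j (B2 #>\<^bsub>B\<^esub> (inv\<^bsub>B\<^esub> (\<phi> (s x)) \<otimes>\<^bsub>B\<^esub> c \<otimes>\<^bsub>B\<^esub> \<phi> (s (inv\<^bsub>Q\<^esub> (\<beta> c) \<otimes>\<^bsub>Q\<^esub> x)))))"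
  proof (rule wreath_lift[OF B.is_group Q.is_group \<beta>, of "\<lambda>b. j (B2 #>\<^bsub>B\<^esub> b)" U "\<phi> ` C" "\<lambda>x. \<phi> (s x)"])
    fix b assume b: "b \<in> carrier B" "\<beta> b = \<one>\<^bsub>Q\<^esub>"
    then have b1: "b \<in> B1" by (simp add: B1_iff)
    show "j (B2 #>\<^bsub>B\<^esub> b) \<in> carrier U"
      using hom_in_carrier[OF j jY[OF b1]] .
    show "j (B2 #>\<^bsub>B\<^esub> (b \<otimes>\<^bsub>B\<^esub> b')) = j (B2 #>\<^bsub>B\<^esub> b) \<otimes>\<^bsub>U\<^esub> j (B2 #>\<^bsub>B\<^esub> b')"
      if "b' \<in> carrier B" "\<beta> b' = \<one>\<^bsub>Q\<^esub>" for b'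
      using that b1 hom_mult[OF fY, of b b'] hom_mult[OF j jY jY, of b b'] by (simp add: B1_iff)
    show "j (B2 #>\<^bsub>B\<^esub> (inv\<^bsub>B\<^esub> t \<otimes>\<^bsub>B\<^esub> b \<otimes>\<^bsub>B\<^esub> t)) = j (B2 #>\<^bsub>B\<^esub> b)" if t: "t \<in> carrier B" for t
    proof -
      have "b \<in> central_mod B B2" using b1 B2(3) by (auto simp: B1_def)
      then have "inv\<^bsub>B\<^esub> t \<otimes>\<^bsub>B\<^esub> b \<otimes>\<^bsub>B\<^esub> inv\<^bsub>B\<^esub> (inv\<^bsub>B\<^esub> t) \<otimes>\<^bsub>B\<^esub> inv\<^bsub>B\<^esub> b \<in> B2"
        using B.inv_closed[OF t] unfolding central_mod_def by blast
      then have "inv\<^bsub>B\<^esub> t \<otimes>\<^bsub>B\<^esub> b \<otimes>\<^bsub>B\<^esub> t \<otimes>\<^bsub>B\<^esub> inv\<^bsub>B\<^esub> b \<in> B2"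
        using t by simp
      then have "inv\<^bsub>B\<^esub> t \<otimes>\<^bsub>B\<^esub> b \<otimes>\<^bsub>B\<^esub> t \<in> B2 #>\<^bsub>B\<^esub> b"
        using t b by (intro B2.rcos_module_rev[OF B.is_group]) simp_all
      then show ?thesis
        using B.repr_independence[OF _ b(1) B2.is_subgroup] by simp
    qed
  next
    fix c x assume "c \<in> \<phi> ` C" and x: "x \<in> carrier Q"
    then obtain d where d: "d \<in> C" "c = \<phi> d" by blast
    then show "\<beta> (\<phi> (s (\<beta> c \<otimes>\<^bsub>Q\<^esub> x))) = \<beta> c \<otimes>\<^bsub>Q\<^esub> \<beta> (\<phi> (s x))"
      using s_eq[OF d(1) x] agree[OF d(1)] agree[OF s[OF x]]
        agree[OF s, of "\<alpha> d \<otimes>\<^bsub>Q\<^esub> x"] x CA[OF d(1)] by simp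
  qed (use s \<phi>C that in auto)
  show thesis
  proof (rule that[OF _ _ D E])
    show "group (wreath U Q)" by (rule group_wreath) (rule U.is_group Q.is_group)+
    show "solvable (wreath U Q)" by (rule solvable_wreath[OF U Q.is_group \<open>solvable Q\<close>])
  next
    fix c assume c: "c \<in> C"
    have "i (A2 #>\<^bsub>A\<^esub> (inv\<^bsub>A\<^esub> (s x) \<otimes>\<^bsub>A\<^esub> c \<otimes>\<^bsub>A\<^esub> s (inv\<^bsub>Q\<^esub> (\<alpha> c) \<otimes>\<^bsub>Q\<^esub> x))) =
        j (B2 #>\<^bsub>B\<^esub> (inv\<^bsub>B\<^esub> (\<phi> (s x)) \<otimes>\<^bsub>B\<^esub> \<phi> c \<otimes>\<^bsub>B\<^esub> \<phi> (s (inv\<^bsub>Q\<^esub> (\<beta> (\<phi> c)) \<otimes>\<^bsub>Q\<^esub> x))))"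
      if x: "x \<in> carrier Q" for x
    proof -
      let ?y = "inv\<^bsub>Q\<^esub> (\<alpha> c) \<otimes>\<^bsub>Q\<^esub> x"
      let ?k = "inv\<^bsub>A\<^esub> (s x) \<otimes>\<^bsub>A\<^esub> c \<otimes>\<^bsub>A\<^esub> s ?y"
      have y: "?y \<in> carrier Q" using x CA[OF c] by simp
      have k: "?k \<in> C"
        using c s[OF x] s[OF y] C by (simp add: subgroup.m_closed subgroup.m_inv_closed)
      have "\<alpha> (s x) = \<alpha> c \<otimes>\<^bsub>Q\<^esub> \<alpha> (s ?y)"
        using s_eq[OF c y] CA[OF c] x by (simp add: Q.inv_mult_cancel)
      then have "\<alpha> ?k = \<one>\<^bsub>Q\<^esub>"
        using CA[OF c] CA[OF s[OF x]] CA[OF s[OF y]] by (simp add: Q.word_simps)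
      \<comment> \<open>On this intersection the two maps into the pushout coincide.\<close>
      then have "?k \<in> C \<inter> A1"
        using k CA[OF k] by (simp add: A1_iff)
      moreover have "\<phi> ?k = inv\<^bsub>B\<^esub> (\<phi> (s x)) \<otimes>\<^bsub>B\<^esub> \<phi> c \<otimes>\<^bsub>B\<^esub> \<phi> (s ?y)"
        using c s[OF x] s[OF y] C
        by (simp add: \<phi>_mult \<phi>_inv subgroup.m_closed subgroup.m_inv_closed)
      ultimately show ?thesis
        using ij[of ?k] agree[OF c] by simp
    qed
    then show "(D c, \<alpha> c) = (E (\<phi> c), \<beta> (\<phi> c))"
      using D_C[OF c] E_C[of "\<phi> c"] c agree[OF c] by (simp cong: restrict_cong)
  next
    have "(D a, \<alpha> a) = \<one>\<^bsub>wreath U Q\<^esub> \<longleftrightarrow> a \<in> A2" if a: "a \<in> carrier A" for a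
    proof (cases "\<alpha> a = \<one>\<^bsub>Q\<^esub>")
      case True
      \<comment> \<open>A constant function on \<open>carrier Q\<close> determines its value, as the
        carrier contains the identity.\<close>
      have "(\<lambda>x \<in> carrier Q. i (A2 #>\<^bsub>A\<^esub> a)) = (\<lambda>x \<in> carrier Q. \<one>\<^bsub>U\<^esub>) \<longleftrightarrow> i (A2 #>\<^bsub>A\<^esub> a) = \<one>\<^bsub>U\<^esub>"
        using Q.one_closed by (metis restrict_apply')
      also have "\<dots> \<longleftrightarrow> a \<in> A2"
        using True a X1 i1[OF iX] by (simp add: A1_iff)
      finally show ?thesis using True a by (simp add: D_ker)
    next
      case False
      then show ?thesis using A2(2) by (auto simp: kernel_def)
    qed
    then show "kernel A (wreath U Q) (\<lambda>a. (D a, \<alpha> a)) = A2"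
      using A2.subset unfolding kernel_def by blast
    have "(E b, \<beta> b) = \<one>\<^bsub>wreath U Q\<^esub> \<longleftrightarrow> b \<in> B2" if b: "b \<in> carrier B" for b
    proof (cases "\<beta> b = \<one>\<^bsub>Q\<^esub>")
      case True
      have "(\<lambda>x \<in> carrier Q. j (B2 #>\<^bsub>B\<^esub> b)) = (\<lambda>x \<in> carrier Q. \<one>\<^bsub>U\<^esub>) \<longleftrightarrow> j (B2 #>\<^bsub>B\<^esub> b) = \<one>\<^bsub>U\<^esub>"
        using Q.one_closed by (metis restrict_apply')
      also have "\<dots> \<longleftrightarrow> b \<in> B2"
        using True b Y1 j1[OF jY] by (simp add: B1_iff)
      finally show ?thesis using True b by (simp add: E_ker)
    next
      case False
      then show ?thesis using B2(2) by (auto simp: kernel_def)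
    qed
    then show "kernel B (wreath U Q) (\<lambda>b. (E b, \<beta> b)) = B2"
      using B2.subset unfolding kernel_def by blast
  qed
qed

section \<open>Solvable quotients of the amalgamated product\<close>

lemma (in group_hom) solvable_Mod_kernel:
  assumes "solvable H"
  shows "solvable (G Mod kernel G H h)"
proof -
  have "group_hom (G Mod kernel G H h) H (\<lambda>X. the_elem (h ` X))"
    by (simp add: group_hom_def group_hom_axioms_def FactGroup_hom H.is_group
        normal.factorgroup_is_group[OF normal_kernel])
  then show ?thesis
    using group_hom.inj_hom_imp_solvable FactGroup_inj_on assms by blast
qed

section \<open>The amalgamated product and its universal property\<close>

text \<open>The second amalgamated subgroup is represented as the image of \<open>C\<close> under
  the embedding \<phi> into \<open>B\<close>.\<close>

locale amalgam = two_groups A B for A (structure) and B (structure) +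
  fixes C :: "'a set" and \<phi> :: "'a \<Rightarrow> 'c"
  assumes C: "subgroup C A" and \<phi>: "\<phi> \<in> hom (A\<lparr>carrier := C\<rparr>) B" and inj_\<phi>: "inj_on \<phi> C"
begin

abbreviation (input) "P \<equiv> free_product A B"
abbreviation (input) "G \<equiv> amalgamated_product A B C \<phi>"

definition "relators =
  {free_product_inl A B c \<otimes>\<^bsub>P\<^esub> inv\<^bsub>P\<^esub> (free_product_inr A B (\<phi> c)) | c. c \<in> C}"
definition "inA a = normal_closure P relators #>\<^bsub>P\<^esub> free_product_inl A B a"
definition "inB b = normal_closure P relators #>\<^bsub>P\<^esub> free_product_inr A B b"

lemma C_mem: "c \<in> C \<Longrightarrow> c \<in> carrier A"
  using subgroup.mem_carrier[OF C] .

lemma \<phi>_mem: "c \<in> C \<Longrightarrow> \<phi> c \<in> carrier B"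
  using hom_in_carrier[OF \<phi>, of c] by simp

lemma group_C: "group (A\<lparr>carrier := C\<rparr>)"
  by (rule subgroup.subgroup_is_group[OF C A.is_group])

lemma \<phi>_int_pow: "c \<in> C \<Longrightarrow> \<phi> (c [^]\<^bsub>A\<^esub> (t::int)) = \<phi> c [^]\<^bsub>B\<^esub> t"
  using hom_int_pow[OF \<phi> _ group_C B.is_group, of c t] A.int_pow_consistent[OF C] by simp

lemma \<phi>_one_iff: "c \<in> C \<Longrightarrow> \<phi> c = \<one>\<^bsub>B\<^esub> \<longleftrightarrow> c = \<one>\<^bsub>A\<^esub>"
  using hom_one[OF \<phi> group_C B.is_group] inj_on_eq_iff[OF inj_\<phi> _ subgroup.one_closed[OF C], of c]
  by simp

lemma relators_subset: "relators \<subseteq> carrier P"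
proof -
  interpret P: group P by (rule group_free_product)
  show ?thesis
    unfolding relators_def
    using hom_in_carrier[OF free_product_inl_hom C_mem] hom_in_carrier[OF free_product_inr_hom \<phi>_mem]
    by auto
qed

lemma normal_relators: "normal_closure P relators \<lhd> P"
  using group.normal_closure_normal[OF group_free_product relators_subset] .

lemma G_eq: "G = P Mod normal_closure P relators"
  by (simp add: amalgamated_product_def relators_def)

lemma group_G: "group G"
  unfolding G_eq by (rule normal.factorgroup_is_group[OF normal_relators])

lemma proj_hom: "(\<lambda>X. normal_closure P relators #>\<^bsub>P\<^esub> X) \<in> hom P G"
  unfolding G_eq by (rule normal.r_coset_hom_Mod[OF normal_relators])

lemma inA_hom: "inA \<in> hom A G" and inB_hom: "inB \<in> hom B G"
  using hom_compose[OF free_product_inl_hom proj_hom] hom_compose[OF free_product_inr_hom proj_hom]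
  by (simp_all add: o_def inA_def[abs_def] inB_def[abs_def])

lemma inA_agree:
  assumes "c \<in> C"
  shows "inA c = inB (\<phi> c)"
proof -
  interpret P: group P by (rule group_free_product)
  have mem: "free_product_inl A B c \<in> carrier P" "free_product_inr A B (\<phi> c) \<in> carrier P"
    using hom_in_carrier[OF free_product_inl_hom C_mem] hom_in_carrier[OF free_product_inr_hom \<phi>_mem]
      assms by blast+
  have sub: "subgroup (normal_closure P relators) P"
    by (rule normal_imp_subgroup[OF normal_relators])
  have "free_product_inl A B c \<otimes>\<^bsub>P\<^esub> inv\<^bsub>P\<^esub> (free_product_inr A B (\<phi> c)) \<in> normal_closure P relators"
    using assms P.normal_closure_superset by (fastforce simp: relators_def)
  then have "free_product_inl A B c \<in> normal_closure P relators #>\<^bsub>P\<^esub> free_product_inr A B (\<phi> c)"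
    by (intro subgroup.rcos_module_rev[OF sub P.is_group] mem)
  then show ?thesis
    unfolding inA_def inB_def using P.repr_independence[OF _ mem(2) sub] by simp
qed

lemma universal:
  assumes H: "group H" and f: "f \<in> hom A H" and g: "g \<in> hom B H"
    and fg: "\<And>c. c \<in> C \<Longrightarrow> f c = g (\<phi> c)"
  obtains h where "h \<in> hom G H" "\<And>a. a \<in> carrier A \<Longrightarrow> h (inA a) = f a"
    "\<And>b. b \<in> carrier B \<Longrightarrow> h (inB b) = g b"
proof -
  obtain k where k: "k \<in> hom P H"
    and kA: "\<And>a. a \<in> carrier A \<Longrightarrow> k (free_product_inl A B a) = f a"
    and kB: "\<And>b. b \<in> carrier B \<Longrightarrow> k (free_product_inr A B b) = g b"
    using free_product_universal[OF H f g] by blast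
  interpret k: group_hom P H k
    using k H by (simp add: group_hom_def group_hom_axioms_def group_free_product)
  have mem: "free_product_inl A B a \<in> carrier P" "free_product_inr A B b \<in> carrier P"
    if "a \<in> carrier A" "b \<in> carrier B" for a b
    using hom_in_carrier[OF free_product_inl_hom] hom_in_carrier[OF free_product_inr_hom] that by blast+
  have "relators \<subseteq> kernel P H k"
  proof
    fix X assume "X \<in> relators"
    then obtain c where c: "c \<in> C"
      and X: "X = free_product_inl A B c \<otimes>\<^bsub>P\<^esub> inv\<^bsub>P\<^esub> (free_product_inr A B (\<phi> c))"
      by (auto simp: relators_def)
    have "k X = f c \<otimes>\<^bsub>H\<^esub> inv\<^bsub>H\<^esub> (g (\<phi> c))"
      using mem[OF C_mem \<phi>_mem, OF c c] kA[OF C_mem[OF c]] kB[OF \<phi>_mem[OF c]] by (simp add: X)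
    also have "\<dots> = \<one>\<^bsub>H\<^esub>"
      using fg[OF c] hom_in_carrier[OF g \<phi>_mem[OF c]] by simp
    finally show "X \<in> kernel P H k"
      using mem[OF C_mem \<phi>_mem, OF c c] by (simp add: kernel_def X)
  qed
  then have "normal_closure P relators \<subseteq> kernel P H k"
    using k.normal_kernel k.G.normal_closure_minimal by blast
  then obtain h where "h \<in> hom G H"
    and "\<And>x. x \<in> carrier P \<Longrightarrow> h (normal_closure P relators #>\<^bsub>P\<^esub> x) = k x"
    unfolding G_eq using k.FactGroup_universal_kernel[OF normal_relators] by blast
  then show ?thesis
    using that[of h] mem kA kB A.one_closed B.one_closed by (metis inA_def inB_def)
qed

text \<open>An element is represented by a word in the two factors, and the induction adds letters
  on the left.\<close>

lemma amalgam_induct [consumes 1, case_names one left right]: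
  assumes "x \<in> carrier G"
    and one: "Pr \<one>\<^bsub>G\<^esub>"
    and left: "\<And>a x. \<lbrakk>a \<in> carrier A; x \<in> carrier G; Pr x\<rbrakk> \<Longrightarrow> Pr (inA a \<otimes>\<^bsub>G\<^esub> x)"
    and right: "\<And>b x. \<lbrakk>b \<in> carrier B; x \<in> carrier G; Pr x\<rbrakk> \<Longrightarrow> Pr (inB b \<otimes>\<^bsub>G\<^esub> x)"
  shows "Pr x"
proof -
  let ?\<pi> = "\<lambda>X. normal_closure P relators #>\<^bsub>P\<^esub> X"
  interpret \<pi>: group_hom P G ?\<pi>
    by (simp add: group_hom_def group_hom_axioms_def group_free_product group_G proj_hom)
  obtain X where X: "X \<in> carrier P" "x = ?\<pi> X"
    using assms(1) by (auto simp: G_eq carrier_FactGroup)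
  then obtain w where w: "w \<in> W" "X = R `` {w}" by (elim carrier_cases)
  have "Pr (?\<pi> (R `` {w}))"
    using w(1)
  proof (induction w)
    case Nil
    have "?\<pi> (R `` {[]}) = \<one>\<^bsub>G\<^esub>" using \<pi>.hom_one by (simp add: one_free_product)
    then show ?case using one by simp
  next
    case (Cons y w)
    then have yw: "[y] \<in> W" "w \<in> W" by auto
    have "R `` {y # w} = R `` {[y]} \<otimes>\<^bsub>P\<^esub> R `` {w}"
      using mult_class[OF yw] by simp
    then have eq: "?\<pi> (R `` {y # w}) = ?\<pi> (R `` {[y]}) \<otimes>\<^bsub>G\<^esub> ?\<pi> (R `` {w})"
      using \<pi>.hom_mult[OF class_in_carrier[OF yw(1)] class_in_carrier[OF yw(2)]] by (simp only:)
    have mem: "?\<pi> (R `` {w}) \<in> carrier G" by (rule \<pi>.hom_closed[OF class_in_carrier[OF yw(2)]])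
    show ?case
    proof (cases y)
      case (Inl a)
      then show ?thesis
        unfolding eq using left[OF _ mem Cons.IH[OF yw(2)], of a] yw(1)
        by (auto simp: inA_def free_product_inl_def)
    next
      case (Inr b)
      then show ?thesis
        unfolding eq using right[OF _ mem Cons.IH[OF yw(2)], of b] yw(1)
        by (auto simp: inB_def free_product_inr_def)
    qed
  qed
  then show ?thesis using X w by simp
qed

section \<open>Subgroups of the factors cut out by solvable quotients\<close>

text \<open>Records what a solvable quotient of \<open>G\<close> kills in each factor. The descent
  replaces such pairs by smaller ones until both subgroups are trivial.\<close>

definition solvable_trace :: "'a set \<Rightarrow> 'c set \<Rightarrow> bool" where
  "solvable_trace A1 B1 \<longleftrightarrow> (\<exists>N. N \<lhd> G \<and> solvable (G Mod N) \<and>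
     A1 = {a \<in> carrier A. inA a \<in> N} \<and> B1 = {b \<in> carrier B. inB b \<in> N})"

lemma solvable_traceE:
  assumes "solvable_trace A1 B1"
  obtains N where "N \<lhd> G" "solvable (G Mod N)"
    "(\<lambda>a. N #>\<^bsub>G\<^esub> inA a) \<in> hom A (G Mod N)" "(\<lambda>b. N #>\<^bsub>G\<^esub> inB b) \<in> hom B (G Mod N)"
    "A1 = kernel A (G Mod N) (\<lambda>a. N #>\<^bsub>G\<^esub> inA a)" "B1 = kernel B (G Mod N) (\<lambda>b. N #>\<^bsub>G\<^esub> inB b)"
proof -
  obtain N where N: "N \<lhd> G" "solvable (G Mod N)"
    and A1: "A1 = {a \<in> carrier A. inA a \<in> N}" and B1: "B1 = {b \<in> carrier B. inB b \<in> N}"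
    using assms by (auto simp: solvable_trace_def)
  have "A1 = kernel A (G Mod N) (\<lambda>a. N #>\<^bsub>G\<^esub> inA a)"
    unfolding A1 kernel_def
    using normal.rcoset_eq_one_iff[OF N(1) hom_in_carrier[OF inA_hom]] by blast
  moreover have "B1 = kernel B (G Mod N) (\<lambda>b. N #>\<^bsub>G\<^esub> inB b)"
    unfolding B1 kernel_def
    using normal.rcoset_eq_one_iff[OF N(1) hom_in_carrier[OF inB_hom]] by blast
  ultimately show thesis
    using that[OF N] hom_compose[OF inA_hom normal.r_coset_hom_Mod[OF N(1)]]
      hom_compose[OF inB_hom normal.r_coset_hom_Mod[OF N(1)]] by (simp add: o_def)
qed

lemma solvable_trace_normal:
  assumes "solvable_trace A1 B1"
  shows "A1 \<lhd> A" "B1 \<lhd> B"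
proof -
  obtain N where N: "N \<lhd> G" and f: "(\<lambda>a. N #>\<^bsub>G\<^esub> inA a) \<in> hom A (G Mod N)"
    and g: "(\<lambda>b. N #>\<^bsub>G\<^esub> inB b) \<in> hom B (G Mod N)"
    and A1: "A1 = kernel A (G Mod N) (\<lambda>a. N #>\<^bsub>G\<^esub> inA a)"
    and B1: "B1 = kernel B (G Mod N) (\<lambda>b. N #>\<^bsub>G\<^esub> inB b)"
    using assms by (rule solvable_traceE)
  have Q: "group (G Mod N)" using N by (rule normal.factorgroup_is_group)
  show "A1 \<lhd> A" "B1 \<lhd> B"
    unfolding A1 B1 using f g Q
    by (auto intro!: group_hom.normal_kernel simp: group_hom_def group_hom_axioms_def
        A.is_group B.is_group)
qed

lemma solvable_trace_agree:
  "solvable_trace A1 B1 \<Longrightarrow> c \<in> C \<Longrightarrow> c \<in> A1 \<longleftrightarrow> \<phi> c \<in> B1"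
  using inA_agree C_mem \<phi>_mem by (auto simp: solvable_trace_def)

text \<open>The start of the descent, given by the trivial quotient.\<close>

lemma solvable_trace_carrier: "solvable_trace (carrier A) (carrier B)"
proof -
  interpret G: group G by (rule group_G)
  have "carrier (G Mod carrier G) = {\<one>\<^bsub>G Mod carrier G\<^esub>}"
    using G.self_factor_iso by (auto simp: carrier_FactGroup G.coset_join2[OF _ G.subgroup_self])
  then have "solvable (G Mod carrier G)"
    unfolding solvable_def by (metis solvable_seq.unity)
  then show ?thesis
    unfolding solvable_trace_def
    using G.normal_self hom_in_carrier[OF inA_hom] hom_in_carrier[OF inB_hom]
    by (intro exI[of _ "carrier G"]) auto
qed

text \<open>The universal property joins the two lifts to the wreath product into a map on
  \<open>G\<close>, whose kernel is the new normal subgroup.\<close>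

lemma solvable_trace_layer:
  assumes good: "solvable_trace A1 B1"
    and A2: "A2 \<lhd> A" "A2 \<subseteq> A1" "A1 \<subseteq> central_mod A A2"
    and B2: "B2 \<lhd> B" "B2 \<subseteq> B1" "B1 \<subseteq> central_mod B B2"
    and compat: "\<And>c. c \<in> C \<Longrightarrow> c \<in> A2 \<longleftrightarrow> \<phi> c \<in> B2"
  shows "solvable_trace A2 B2"
proof -
  obtain N where N: "N \<lhd> G" "solvable (G Mod N)" and f: "(\<lambda>a. N #>\<^bsub>G\<^esub> inA a) \<in> hom A (G Mod N)"
    and g: "(\<lambda>b. N #>\<^bsub>G\<^esub> inB b) \<in> hom B (G Mod N)"
    and A1: "A1 = kernel A (G Mod N) (\<lambda>a. N #>\<^bsub>G\<^esub> inA a)"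
    and B1: "B1 = kernel B (G Mod N) (\<lambda>b. N #>\<^bsub>G\<^esub> inB b)"
    using good by (rule solvable_traceE)
  have Q: "group (G Mod N)" using N(1) by (rule normal.factorgroup_is_group)
  have agree: "\<And>c. c \<in> C \<Longrightarrow> N #>\<^bsub>G\<^esub> inA c = N #>\<^bsub>G\<^esub> inB (\<phi> c)"
    by (simp add: inA_agree)
  obtain H :: "((('a + 'c) list set set set \<Rightarrow> ('a set \<times> 'c set) set)
      \<times> ('a + 'c) list set set set) monoid" and f' g'
    where H: "group H" "solvable H" and f': "f' \<in> hom A H" and g': "g' \<in> hom B H"
    and fg': "\<And>c. c \<in> C \<Longrightarrow> f' c = g' (\<phi> c)" and ker: "kernel A H f' = A2" "kernel B H g' = B2"
    using wreath_layer[OF A.is_group B.is_group Q N(2) f g C \<phi> agree A2(1) A2(2,3)[unfolded A1]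
        B2(1) B2(2,3)[unfolded B1] compat] by blast
  obtain h where h: "h \<in> hom G H" and hA: "\<And>a. a \<in> carrier A \<Longrightarrow> h (inA a) = f' a"
    and hB: "\<And>b. b \<in> carrier B \<Longrightarrow> h (inB b) = g' b"
    using universal[OF H(1) f' g' fg'] by blast
  interpret h: group_hom G H h
    using h H(1) group_G by (simp add: group_hom_def group_hom_axioms_def)
  have "A2 = {a \<in> carrier A. inA a \<in> kernel G H h}"
    using ker(1) hA hom_in_carrier[OF inA_hom] by (auto simp: kernel_def)
  moreover have "B2 = {b \<in> carrier B. inB b \<in> kernel G H h}"
    using ker(2) hB hom_in_carrier[OF inB_hom] by (auto simp: kernel_def)
  ultimately show ?thesis
    unfolding solvable_trace_def using h.normal_kernel h.solvable_Mod_kernel[OF H(2)] by blast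
qed

end

section \<open>Powers of an element in subgroups and central series\<close>

lemma (in group) Int_central_mod:
  assumes "K \<lhd> G" "L \<subseteq> central_mod G Y"
  shows "K \<inter> L \<subseteq> central_mod G (K \<inter> Y)"
proof
  interpret K: normal K G by fact
  fix x assume x: "x \<in> K \<inter> L"
  then have "a \<otimes> x \<otimes> inv a \<otimes> inv x \<in> K" if "a \<in> carrier G" for a
    using that by (intro K.m_closed K.inv_op_closed2 K.m_inv_closed) auto
  then show "x \<in> central_mod G (K \<inter> Y)"
    using x assms(2) by (auto simp: central_mod_def)
qed

text \<open>The exponents of powers lying in \<open>H\<close> form a subgroup of the integers inside
  the multiples of \<open>k\<close>, containing \<open>k * p\<close> but not \<open>k\<close>. As
  \<open>p\<close> is prime, only the multiples of \<open>k * p\<close> remain.\<close>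

lemma (in group) int_pow_mem_iff:
  assumes H: "subgroup H G" and c: "c \<in> carrier G" and p: "prime (p::nat)"
    and dvd: "\<And>t::int. c [^] t \<in> H \<Longrightarrow> int k dvd t"
    and k: "c [^] k \<notin> H" "(c [^] k) [^] p \<in> H"
  shows "c [^] (t::int) \<in> H \<longleftrightarrow> int (k * p) dvd t"
proof
  assume "int (k * p) dvd t"
  then obtain s where "t = int k * int p * s" by (auto simp: dvd_def)
  then have "c [^] t = ((c [^] k) [^] p) [^] s"
    using c by (simp add: int_pow_pow int_pow_int[symmetric])
  then show "c [^] t \<in> H"
    using subgroup_int_pow_closed[OF H k(2)] by simp
next
  assume t: "c [^] t \<in> H"
  then obtain s where s: "t = int k * s" using dvd by (auto simp: dvd_def)
  have xs: "(c [^] k) [^] s \<in> H"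
    using t c by (simp add: s int_pow_pow int_pow_int[symmetric])
  show "int (k * p) dvd t"
  proof (cases "int p dvd s")
    case True
    then show ?thesis by (simp add: s)
  next
    case False
    moreover have "prime (int p)" using p by simp
    ultimately have "coprime s (int p)"
      using prime_imp_coprime[of "int p" s] by (simp add: coprime_commute)
    then obtain u v where uv: "u * s + v * int p = 1"
      using bezout_int[of s "int p"] by auto
    have "c [^] k = (c [^] k) [^] (s * u + int p * v)"
      using uv c by (simp add: mult.commute)
    also have "\<dots> = ((c [^] k) [^] s) [^] u \<otimes> ((c [^] k) [^] p) [^] v"
      using c by (simp add: int_pow_mult int_pow_pow int_pow_int[symmetric] mult.assoc)
    also have "\<dots> \<in> H"
      by (rule subgroup.m_closed[OF H subgroup_int_pow_closed[OF H xs] subgroup_int_pow_closed[OF H k(2)]])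
    finally show ?thesis using k(1) by contradiction
  qed
qed

text \<open>\<open>ord c = 0\<close> encodes infinite order. Some positive power of \<open>c\<close>
  lies in the first term of the lower central series but none in the last, so there is a step where
  this changes; \<open>Y\<close> is the term just below it.\<close>

lemma (in group) nilpotent_central_power:
  assumes nil: "nilpotent_group G" and c: "c \<in> carrier G" and ord: "ord c = 0"
  obtains m :: nat and Y where "m > 0" "Y \<lhd> G" "c [^] m \<in> central_mod G Y"
    "\<And>t::int. c [^] t \<in> Y \<Longrightarrow> t = 0"
proof -
  let ?P = "\<lambda>i. \<exists>m>0. c [^] (m::nat) \<in> lower_central_series G i"
  obtain n where "\<And>i. i \<ge> n \<Longrightarrow> lower_central_series G i = {\<one>}"
    using nilpotent_eventually_trivial[OF nil] by blast
  then have n: "\<not> ?P n"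
    using pow_eq_id[OF c] ord by auto
  have zero: "?P 0" using c by (auto intro!: exI[of _ 1])
  have "\<exists>i. P i \<and> \<not> P (Suc i)" if "P 0" "\<not> P n" for P :: "nat \<Rightarrow> bool"
    using that by (induction n) auto
  from this[of ?P, OF zero n] have "\<exists>i. ?P i \<and> \<not> ?P (Suc i)" .
  then obtain i and m :: nat where m: "m > 0" "c [^] m \<in> lower_central_series G i" and i: "\<not> ?P (Suc i)"
    by blast
  let ?Y = "lower_central_series G (Suc i)"
  have Y: "subgroup ?Y G" by (rule normal_imp_subgroup[OF normal_lower_central_series])
  have "t = 0" if t: "c [^] t \<in> ?Y" for t :: int
  proof (rule ccontr)
    assume "t \<noteq> 0"
    have "c [^] int (nat \<bar>t\<bar>) \<in> ?Y"
      using t subgroup.m_inv_closed[OF Y t] int_pow_neg[OF c, of t] by (simp add: abs_if)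
    then have "c [^] nat \<bar>t\<bar> \<in> ?Y" by (simp only: int_pow_int)
    with i \<open>t \<noteq> 0\<close> show False by (metis zero_less_abs_iff zero_less_nat_eq)
  qed
  moreover have "c [^] m \<in> central_mod G ?Y"
    using m(2) lower_central_series_central by blast
  ultimately show ?thesis
    using that[OF m(1) normal_lower_central_series] by blast
qed

section \<open>Descent steps for solvable traces\<close>

context amalgam
begin

text \<open>If the smaller pair still contains all that the old pair has in common with the
  amalgamated subgroups, no compatibility has to be arranged: the old trace is intersected with the
  relative lower central series of both factors, one layer at a time.\<close>

lemma solvable_trace_descend:
  assumes good: "solvable_trace A1 B1" and nil: "nilpotent_group A" "nilpotent_group B"
    and A2: "A2 \<lhd> A" "A2 \<subseteq> A1" and B2: "B2 \<lhd> B" "B2 \<subseteq> B1"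
    and CA: "C \<inter> A1 \<subseteq> A2" and CB: "\<phi> ` C \<inter> B1 \<subseteq> B2"
  shows "solvable_trace A2 B2"
proof -
  let ?S = "\<lambda>i. A1 \<inter> relative_lower_central A A2 i"
  let ?T = "\<lambda>i. B1 \<inter> relative_lower_central B B2 i"
  note A1 = solvable_trace_normal(1)[OF good] and B1 = solvable_trace_normal(2)[OF good]
  have "solvable_trace (?S i) (?T i)" for i
  proof (induction i)
    case 0
    have "?S 0 = A1" "?T 0 = B1"
      using subgroup.subset[OF normal_imp_subgroup[OF A1]]
        subgroup.subset[OF normal_imp_subgroup[OF B1]]
      by (auto simp: A.relative_lower_central_0[OF A2(1)] B.relative_lower_central_0[OF B2(1)])
    then show ?case using good by simp
  next
    case (Suc i)
    show ?case
    proof (rule solvable_trace_layer[OF Suc])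
      show "?S (Suc i) \<lhd> A"
        by (rule A.normal_subgroup_intersect[OF A1 A.normal_relative_lower_central[OF A2(1)]])
      show "?T (Suc i) \<lhd> B"
        by (rule B.normal_subgroup_intersect[OF B1 B.normal_relative_lower_central[OF B2(1)]])
      show "?S (Suc i) \<subseteq> ?S i" "?T (Suc i) \<subseteq> ?T i"
        using A.relative_lower_central_Suc[OF A2(1)] B.relative_lower_central_Suc[OF B2(1)] by blast+
      show "?S i \<subseteq> central_mod A (?S (Suc i))"
        by (rule A.Int_central_mod[OF A1 A.relative_lower_central_central[OF A2(1)]])
      show "?T i \<subseteq> central_mod B (?T (Suc i))"
        by (rule B.Int_central_mod[OF B1 B.relative_lower_central_central[OF B2(1)]])
    next
      fix c assume c: "c \<in> C"
      have "c \<in> ?S (Suc i) \<longleftrightarrow> c \<in> A1"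
        using c CA A.relative_lower_central_superset[OF A2(1), of "Suc i"] by blast
      moreover have "\<phi> c \<in> ?T (Suc i) \<longleftrightarrow> \<phi> c \<in> B1"
        using c CB B.relative_lower_central_superset[OF B2(1), of "Suc i"] by blast
      ultimately show "c \<in> ?S (Suc i) \<longleftrightarrow> \<phi> c \<in> ?T (Suc i)"
        using solvable_trace_agree[OF good c] by blast
    qed
  qed
  moreover obtain m where "\<And>i. i \<ge> m \<Longrightarrow> lower_central_series A i = {\<one>\<^bsub>A\<^esub>}"
    using A.nilpotent_eventually_trivial[OF nil(1)] by blast
  moreover obtain n where "\<And>i. i \<ge> n \<Longrightarrow> lower_central_series B i = {\<one>\<^bsub>B\<^esub>}"
    using B.nilpotent_eventually_trivial[OF nil(2)] by blast
  \<comment> \<open>At the maximum of the two indices both relative series have reached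
    \<open>A2\<close> and \<open>B2\<close>.\<close>
  ultimately have "solvable_trace (A1 \<inter> A2) (B1 \<inter> B2)"
    using A.relative_lower_central_trivial[OF A2(1), of "max m n"]
      B.relative_lower_central_trivial[OF B2(1), of "max m n"] by (metis max.cobounded1 max.cobounded2)
  then show ?thesis
    using A2(2) B2(2) by (simp add: Int_absorb1)
qed

text \<open>The intersections with the amalgamated subgroups shrink in a single layer. Descending
  first to the part central modulo \<open>A2\<close> and \<open>B2\<close> leaves them unchanged;
  the last central layer lowers them.\<close>

lemma solvable_trace_jump:
  assumes good: "solvable_trace A1 B1" and nil: "nilpotent_group A" "nilpotent_group B"
    and A2: "A2 \<lhd> A" "A2 \<subseteq> A1" and B2: "B2 \<lhd> B" "B2 \<subseteq> B1"
    and CA: "C \<inter> A1 \<subseteq> central_mod A A2" and CB: "\<phi> ` C \<inter> B1 \<subseteq> central_mod B B2"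
    and compat: "\<And>c. c \<in> C \<Longrightarrow> c \<in> A2 \<longleftrightarrow> \<phi> c \<in> B2"
  shows "solvable_trace A2 B2"
proof (rule solvable_trace_layer)
  show "solvable_trace (A1 \<inter> central_mod A A2) (B1 \<inter> central_mod B B2)"
  proof (rule solvable_trace_descend[OF good nil])
    show "A1 \<inter> central_mod A A2 \<lhd> A"
      by (rule A.normal_subgroup_intersect[OF solvable_trace_normal(1)[OF good]
            normal.normal_central_mod[OF A2(1)]])
    show "B1 \<inter> central_mod B B2 \<lhd> B"
      by (rule B.normal_subgroup_intersect[OF solvable_trace_normal(2)[OF good]
            normal.normal_central_mod[OF B2(1)]])
  qed (use CA CB in auto)
  show "A2 \<subseteq> A1 \<inter> central_mod A A2" "B2 \<subseteq> B1 \<inter> central_mod B B2"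
    using A2 B2 normal.superset_central_mod by blast+
qed (use A2 B2 compat in auto)

end

section \<open>Descent for a cyclic amalgamated subgroup\<close>

locale cyclic_amalgam = amalgam A B C \<phi> for A (structure) and B (structure) and C \<phi> +
  fixes c
  assumes nilA: "nilpotent_group A" and nilB: "nilpotent_group B"
    and c: "c \<in> C" and C_eq: "C = range (\<lambda>t::int. c [^]\<^bsub>A\<^esub> t)"
begin

lemma pow_C: "c [^]\<^bsub>A\<^esub> (t::int) \<in> C"
  by (simp add: C_eq)

lemma \<phi>_pow: "\<phi> (c [^]\<^bsub>A\<^esub> (t::int)) = \<phi> c [^]\<^bsub>B\<^esub> t"
  by (rule \<phi>_int_pow[OF c])

lemma \<phi>_pow_eq_one_iff: "\<phi> c [^]\<^bsub>B\<^esub> (t::int) = \<one>\<^bsub>B\<^esub> \<longleftrightarrow> c [^]\<^bsub>A\<^esub> t = \<one>\<^bsub>A\<^esub>"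
  using \<phi>_one_iff[OF pow_C, of t] by (simp add: \<phi>_pow)

lemma solvable_trace_pow:
  "solvable_trace A1 B1 \<Longrightarrow> \<phi> c [^]\<^bsub>B\<^esub> (t::int) \<in> B1 \<longleftrightarrow> c [^]\<^bsub>A\<^esub> t \<in> A1"
  using solvable_trace_agree[OF _ pow_C, of A1 B1 t] by (simp add: \<phi>_pow)

text \<open>Multiplies the exponent by \<open>p\<close>. In each factor, \<open>c^k\<close> (or its
  image) is outside the normal closure of its \<open>p\<close>-th power, so a normal subgroup
  containing that power separates it while keeping it central. Intersecting with these subgroups
  lowers both intersections to the multiples of \<open>k * p\<close>. For infinite order,
  \<open>ord\<close> is 0 and \<open>ord\<close> holds for every \<open>k\<close> and
  \<open>p\<close>.\<close>

lemma solvable_trace_prime: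
  assumes good: "solvable_trace A1 B1" and exp: "\<And>t::int. c [^]\<^bsub>A\<^esub> t \<in> A1 \<longleftrightarrow> int k dvd t"
    and k: "k > 0" and p: "prime p" and ord: "k * p dvd A.ord c"
  obtains A2 B2 where "solvable_trace A2 B2" "\<And>t::int. c [^]\<^bsub>A\<^esub> t \<in> A2 \<longleftrightarrow> int (k * p) dvd t"
proof -
  note A1 = solvable_trace_normal(1)[OF good] and B1 = solvable_trace_normal(2)[OF good]
  define x where "x = c [^]\<^bsub>A\<^esub> k"
  define y where "y = \<phi> c [^]\<^bsub>B\<^esub> k"
  have cA: "c \<in> carrier A" and cB: "\<phi> c \<in> carrier B"
    using c C_mem \<phi>_mem by auto
  have x: "x \<in> carrier A" and y: "y \<in> carrier B"
    using cA cB by (auto simp: x_def y_def)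
  have x_pow: "x [^]\<^bsub>A\<^esub> s = c [^]\<^bsub>A\<^esub> (int k * s)" and y_pow: "y [^]\<^bsub>B\<^esub> s = \<phi> c [^]\<^bsub>B\<^esub> (int k * s)" for s :: int
    using cA cB by (simp_all add: x_def y_def A.int_pow_pow B.int_pow_pow int_pow_int[symmetric])
  have ord_x: "p dvd t" if "x [^]\<^bsub>A\<^esub> t = \<one>\<^bsub>A\<^esub>" for t :: nat
  proof -
    have "c [^]\<^bsub>A\<^esub> (k * t) = \<one>\<^bsub>A\<^esub>" using that cA by (simp add: x_def A.nat_pow_pow)
    then have "k * p dvd k * t" using A.pow_eq_id[OF cA] ord dvd_trans by blast
    then show ?thesis using k by simp
  qed
  have ord_y: "p dvd t" if "y [^]\<^bsub>B\<^esub> t = \<one>\<^bsub>B\<^esub>" for t :: nat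
  proof (rule ord_x)
    have "\<phi> c [^]\<^bsub>B\<^esub> (int k * int t) = \<one>\<^bsub>B\<^esub>"
      using that y_pow[of "int t"] by (simp add: int_pow_int)
    then show "x [^]\<^bsub>A\<^esub> t = \<one>\<^bsub>A\<^esub>"
      using x_pow[of "int t"] by (simp add: \<phi>_pow_eq_one_iff int_pow_int)
  qed
  have "normal_closure A {x [^]\<^bsub>A\<^esub> p} \<lhd> A"
    using x by (intro A.normal_closure_normal) simp
  then obtain Y where Y: "Y \<lhd> A" "normal_closure A {x [^]\<^bsub>A\<^esub> p} \<subseteq> Y"
      "x \<notin> Y" "x \<in> central_mod A Y"
    using A.nilpotent_central_separation[OF nilA _ x A.nilpotent_not_in_closure_pow[OF nilA x p ord_x]]
    by metis
  have Yp: "x [^]\<^bsub>A\<^esub> p \<in> Y"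
    using Y(2) A.normal_closure_superset by blast
  have "normal_closure B {y [^]\<^bsub>B\<^esub> p} \<lhd> B"
    using y by (intro B.normal_closure_normal) simp
  then obtain Z where Z: "Z \<lhd> B" "normal_closure B {y [^]\<^bsub>B\<^esub> p} \<subseteq> Z"
      "y \<notin> Z" "y \<in> central_mod B Z"
    using B.nilpotent_central_separation[OF nilB _ y B.nilpotent_not_in_closure_pow[OF nilB y p ord_y]]
    by metis
  have Zp: "y [^]\<^bsub>B\<^esub> p \<in> Z"
    using Z(2) B.normal_closure_superset by blast
  have A2: "A1 \<inter> Y \<lhd> A" and B2: "B1 \<inter> Z \<lhd> B"
    using A.normal_subgroup_intersect[OF A1 Y(1)] B.normal_subgroup_intersect[OF B1 Z(1)] .
  have expB: "\<phi> c [^]\<^bsub>B\<^esub> t \<in> B1 \<longleftrightarrow> int k dvd t" for t :: int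
    using solvable_trace_pow[OF good] exp by simp
  have xA1: "x [^]\<^bsub>A\<^esub> s \<in> A1" and yB1: "y [^]\<^bsub>B\<^esub> s \<in> B1" for s :: int
    by (simp_all add: x_pow y_pow exp expB)
  \<comment> \<open>The intersection contains \<open>x^p\<close> but not \<open>x\<close>, so
    exactly the multiples of \<open>k * p\<close> survive.\<close>
  have expA2: "c [^]\<^bsub>A\<^esub> t \<in> A1 \<inter> Y \<longleftrightarrow> int (k * p) dvd t" for t :: int
    using exp Yp Y(3) xA1[of "int p"] x
    by (intro A.int_pow_mem_iff[OF normal_imp_subgroup[OF A2] cA p]) (auto simp: x_def int_pow_int)
  have expB2: "\<phi> c [^]\<^bsub>B\<^esub> t \<in> B1 \<inter> Z \<longleftrightarrow> int (k * p) dvd t" for t :: int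
    using expB Zp Z(3) yB1[of "int p"] y
    by (intro B.int_pow_mem_iff[OF normal_imp_subgroup[OF B2] cB p]) (auto simp: y_def int_pow_int)
  have "solvable_trace (A1 \<inter> Y) (B1 \<inter> Z)"
  proof (rule solvable_trace_jump[OF good nilA nilB A2 _ B2])
    show "C \<inter> A1 \<subseteq> central_mod A (A1 \<inter> Y)"
    proof
      fix d assume d: "d \<in> C \<inter> A1"
      then obtain t :: int where "d = c [^]\<^bsub>A\<^esub> t" "int k dvd t" using exp by (auto simp: C_eq)
      then obtain s :: int where s: "d = x [^]\<^bsub>A\<^esub> s" using x_pow by (auto simp: dvd_def)
      have "d \<in> central_mod A Y"
        unfolding s using A.subgroup_int_pow_closed[OF normal_imp_subgroup Y(4)]
          normal.normal_central_mod[OF Y(1)] by blast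
      then show "d \<in> central_mod A (A1 \<inter> Y)"
        using A.Int_central_mod[OF A1, of "central_mod A Y" Y] d by blast
    qed
    show "\<phi> ` C \<inter> B1 \<subseteq> central_mod B (B1 \<inter> Z)"
    proof
      fix d assume d: "d \<in> \<phi> ` C \<inter> B1"
      then obtain t :: int where "d = \<phi> c [^]\<^bsub>B\<^esub> t" "int k dvd t"
        using expB by (auto simp: C_eq \<phi>_pow)
      then obtain s :: int where s: "d = y [^]\<^bsub>B\<^esub> s" using y_pow by (auto simp: dvd_def)
      have "d \<in> central_mod B Z"
        unfolding s using B.subgroup_int_pow_closed[OF normal_imp_subgroup Z(4)]
          normal.normal_central_mod[OF Z(1)] by blast
      then show "d \<in> central_mod B (B1 \<inter> Z)"
        using B.Int_central_mod[OF B1, of "central_mod B Z" Z] d by blast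
    qed
    show "d \<in> A1 \<inter> Y \<longleftrightarrow> \<phi> d \<in> B1 \<inter> Z" if d: "d \<in> C" for d
    proof -
      obtain t :: int where "d = c [^]\<^bsub>A\<^esub> t" using d by (auto simp: C_eq)
      then show ?thesis using expA2[of t] expB2[of t] by (simp only: \<phi>_pow)
    qed
  qed auto
  then show ?thesis using that expA2 by blast
qed

text \<open>The prime factors of \<open>m\<close> are added one at a time. For infinite order every
  positive \<open>m\<close> divides the value 0 of \<open>ord\<close>.\<close>

lemma solvable_trace_exponent:
  assumes "m > 0" "m dvd A.ord c"
  shows "\<exists>A1 B1. solvable_trace A1 B1 \<and> (\<forall>t::int. c [^]\<^bsub>A\<^esub> t \<in> A1 \<longleftrightarrow> int m dvd t)"
  using assms
proof (induction m rule: less_induct)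
  case (less m)
  show ?case
  proof (cases "m = 1")
    case True
    then show ?thesis
      using solvable_trace_carrier c C_mem by (intro exI[of _ "carrier A"] exI[of _ "carrier B"]) auto
  next
    case False
    then obtain p where p: "prime p" "p dvd m" using prime_factor_nat by blast
    then obtain k where m: "m = k * p" by (auto simp: dvd_def mult.commute)
    have k: "k > 0" "k < m" using less.prems m prime_gt_1_nat[OF p(1)] by auto
    obtain A1 B1 where "solvable_trace A1 B1" "\<And>t::int. c [^]\<^bsub>A\<^esub> t \<in> A1 \<longleftrightarrow> int k dvd t"
      using less.IH[OF k(2,1)] less.prems(2) m by (auto dest: dvd_mult_left)
    then show ?thesis
      using solvable_trace_prime[OF _ _ k(1) p(1)] less.prems(2) unfolding m by metis
  qed
qed

text \<open>For finite order, the exponent \<open>ord c\<close> suffices. For infinite order, some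
  powers of \<open>c\<close> and of its image are central modulo subgroups \<open>Y\<close> and
  \<open>Z\<close> that contain no nontrivial power; after a finite exponent is reached, one jump to
  the intersections with \<open>Y\<close> and \<open>Z\<close> removes the rest.\<close>

lemma solvable_trace_disjoint:
  "\<exists>A1 B1. solvable_trace A1 B1 \<and> C \<inter> A1 \<subseteq> {\<one>\<^bsub>A\<^esub>} \<and> \<phi> ` C \<inter> B1 \<subseteq> {\<one>\<^bsub>B\<^esub>}"
proof -
  have cA: "c \<in> carrier A" and cB: "\<phi> c \<in> carrier B"
    using c C_mem \<phi>_mem by auto
  have *: "C \<inter> A1 \<subseteq> {\<one>\<^bsub>A\<^esub>} \<and> \<phi> ` C \<inter> B1 \<subseteq> {\<one>\<^bsub>B\<^esub>}"
    if "solvable_trace A1 B1" "\<And>t::int. c [^]\<^bsub>A\<^esub> t \<in> A1 \<Longrightarrow> c [^]\<^bsub>A\<^esub> t = \<one>\<^bsub>A\<^esub>" for A1 B1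
    using that solvable_trace_pow[OF that(1)] \<phi>_pow_eq_one_iff by (auto simp: C_eq \<phi>_pow)
  show ?thesis
  proof (cases "A.ord c = 0")
    case False
    then obtain A1 B1 where "solvable_trace A1 B1" "\<And>t::int. c [^]\<^bsub>A\<^esub> t \<in> A1 \<longleftrightarrow> int (A.ord c) dvd t"
      using solvable_trace_exponent[of "A.ord c"] by auto
    then show ?thesis using * A.int_pow_eq_id[OF cA] by blast
  next
    case True
    have inf: "c [^]\<^bsub>A\<^esub> t = \<one>\<^bsub>A\<^esub> \<longleftrightarrow> t = 0" for t :: int
      using A.int_pow_eq_id[OF cA] True by simp
    have "B.ord (\<phi> c) = 0"
      using B.int_pow_eq_id[OF cB, of "int (B.ord (\<phi> c))"] \<phi>_pow_eq_one_iff inf by simp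
    then obtain l :: nat and Z where l: "l > 0" "Z \<lhd> B" "\<phi> c [^]\<^bsub>B\<^esub> l \<in> central_mod B Z"
      and Z: "\<And>t::int. \<phi> c [^]\<^bsub>B\<^esub> t \<in> Z \<Longrightarrow> t = 0"
      using B.nilpotent_central_power[OF nilB cB] by blast
    obtain k :: nat and Y where k: "k > 0" "Y \<lhd> A" "c [^]\<^bsub>A\<^esub> k \<in> central_mod A Y"
      and Y: "\<And>t::int. c [^]\<^bsub>A\<^esub> t \<in> Y \<Longrightarrow> t = 0"
      using A.nilpotent_central_power[OF nilA cA True] by blast
    \<comment> \<open>The product \<open>k * l\<close> serves both factors: what remains consists of
      powers of \<open>c^k\<close> in \<open>A\<close> and of the \<open>l\<close>-th power of the
      image of \<open>c\<close> in \<open>B\<close>.\<close>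
    obtain A1 B1 where good: "solvable_trace A1 B1"
      and exp: "\<And>t::int. c [^]\<^bsub>A\<^esub> t \<in> A1 \<longleftrightarrow> int (k * l) dvd t"
      using solvable_trace_exponent[of "k * l"] k(1) l(1) True by auto
    note A1 = solvable_trace_normal(1)[OF good] and B1 = solvable_trace_normal(2)[OF good]
    have A2: "A1 \<inter> Y \<lhd> A" and B2: "B1 \<inter> Z \<lhd> B"
      using A.normal_subgroup_intersect[OF A1 k(2)] B.normal_subgroup_intersect[OF B1 l(2)] .
    have expA2: "c [^]\<^bsub>A\<^esub> t \<in> A1 \<inter> Y \<longleftrightarrow> t = 0" for t :: int
      using Y subgroup.one_closed[OF normal_imp_subgroup[OF A2]] by auto
    have expB2: "\<phi> c [^]\<^bsub>B\<^esub> t \<in> B1 \<inter> Z \<longleftrightarrow> t = 0" for t :: int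
      using Z subgroup.one_closed[OF normal_imp_subgroup[OF B2]] by auto
    have good2: "solvable_trace (A1 \<inter> Y) (B1 \<inter> Z)"
    proof (rule solvable_trace_jump[OF good nilA nilB A2 _ B2])
      show "C \<inter> A1 \<subseteq> central_mod A (A1 \<inter> Y)"
      proof
        fix d assume d: "d \<in> C \<inter> A1"
        then obtain t :: int where t: "d = c [^]\<^bsub>A\<^esub> t" "int (k * l) dvd t"
          using exp by (auto simp: C_eq)
        then have "int k dvd t" by (metis of_nat_mult dvd_mult_left)
        then obtain s where "t = int k * s" by (rule dvdE)
        then have s: "d = (c [^]\<^bsub>A\<^esub> k) [^]\<^bsub>A\<^esub> s"
          using t(1) cA by (simp add: A.int_pow_pow int_pow_int[symmetric])
        have "d \<in> central_mod A Y"
          unfolding s using A.subgroup_int_pow_closed[OF normal_imp_subgroup k(3)]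
            normal.normal_central_mod[OF k(2)] by blast
        then show "d \<in> central_mod A (A1 \<inter> Y)"
          using A.Int_central_mod[OF A1, of "central_mod A Y" Y] d by blast
      qed
      show "\<phi> ` C \<inter> B1 \<subseteq> central_mod B (B1 \<inter> Z)"
      proof
        fix d assume d: "d \<in> \<phi> ` C \<inter> B1"
        then obtain t :: int where t: "d = \<phi> c [^]\<^bsub>B\<^esub> t" "int (k * l) dvd t"
          using exp solvable_trace_pow[OF good] by (auto simp: C_eq \<phi>_pow)
        then have "int l dvd t" by (metis of_nat_mult dvd_mult_right)
        then obtain s where "t = int l * s" by (rule dvdE)
        then have s: "d = (\<phi> c [^]\<^bsub>B\<^esub> l) [^]\<^bsub>B\<^esub> s"
          using t(1) cB by (simp add: B.int_pow_pow int_pow_int[symmetric])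
        have "d \<in> central_mod B Z"
          unfolding s using B.subgroup_int_pow_closed[OF normal_imp_subgroup l(3)]
            normal.normal_central_mod[OF l(2)] by blast
        then show "d \<in> central_mod B (B1 \<inter> Z)"
          using B.Int_central_mod[OF B1, of "central_mod B Z" Z] d by blast
      qed
      show "d \<in> A1 \<inter> Y \<longleftrightarrow> \<phi> d \<in> B1 \<inter> Z" if d: "d \<in> C" for d
      proof -
        obtain t :: int where "d = c [^]\<^bsub>A\<^esub> t" using d by (auto simp: C_eq)
        then show ?thesis using expA2[of t] expB2[of t] by (simp only: \<phi>_pow)
      qed
    qed auto
    show ?thesis
      using good2 *[OF good2] expA2 inf by blast
  qed
qed

text \<open>Once the trace meets the amalgamated subgroups trivially, it descends to the trivial
  subgroups.\<close>

lemma solvable_trace_trivial: "solvable_trace {\<one>\<^bsub>A\<^esub>} {\<one>\<^bsub>B\<^esub>}"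
proof -
  obtain A1 B1 where good: "solvable_trace A1 B1" and "C \<inter> A1 \<subseteq> {\<one>\<^bsub>A\<^esub>}" "\<phi> ` C \<inter> B1 \<subseteq> {\<one>\<^bsub>B\<^esub>}"
    using solvable_trace_disjoint by blast
  moreover have "\<one>\<^bsub>A\<^esub> \<in> A1" "\<one>\<^bsub>B\<^esub> \<in> B1"
    using solvable_trace_normal[OF good] normal_imp_subgroup subgroup.one_closed by blast+
  ultimately show ?thesis
    using solvable_trace_descend[OF good nilA nilB A.one_is_normal _ B.one_is_normal] by simp
qed

end

section \<open>Reduced words\<close>

context amalgam
begin

section \<open>Normal forms and their separation from the identity\<close>

definition letter :: "'a + 'c \<Rightarrow> ('a + 'c) list set set" where
  "letter = case_sum inA inB"

definition ev :: "('a + 'c) list \<Rightarrow> ('a + 'c) list set set" where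
  "ev w = foldr (\<lambda>s x. letter s \<otimes>\<^bsub>G\<^esub> x) w \<one>\<^bsub>G\<^esub>"

definition reduced :: "('a + 'c) list \<Rightarrow> bool" where
  "reduced w \<longleftrightarrow> set w \<subseteq> Sum_Type.Plus (carrier A - C) (carrier B - \<phi> ` C) \<and>
     successively (\<lambda>s t. isl s \<noteq> isl t) w"

lemma ev_simps [simp]: "ev [] = \<one>\<^bsub>G\<^esub>" "ev (s # w) = letter s \<otimes>\<^bsub>G\<^esub> ev w"
  by (simp_all add: ev_def)

lemma letter_simps [simp]: "letter (Inl a) = inA a" "letter (Inr b) = inB b"
  by (simp_all add: letter_def)

lemma reduced_Nil [simp]: "reduced []"
  by (simp add: reduced_def)

lemma reduced_Cons:
  "reduced (s # w) \<longleftrightarrow> s \<in> Sum_Type.Plus (carrier A - C) (carrier B - \<phi> ` C) \<and>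
     (w = [] \<or> isl s \<noteq> isl (hd w)) \<and> reduced w"
  by (cases w) (auto simp: reduced_def)

lemma reduced_appendD: "reduced (u @ v) \<Longrightarrow> reduced u"
  by (auto simp: reduced_def successively_append_iff)

lemma inA_closed: "a \<in> carrier A \<Longrightarrow> inA a \<in> carrier G"
  using hom_in_carrier[OF inA_hom] .

lemma inB_closed: "b \<in> carrier B \<Longrightarrow> inB b \<in> carrier G"
  using hom_in_carrier[OF inB_hom] .

lemma letter_closed: "s \<in> Sum_Type.Plus (carrier A) (carrier B) \<Longrightarrow> letter s \<in> carrier G"
  by (auto simp: inA_closed inB_closed)

lemma ev_closed: "set w \<subseteq> Sum_Type.Plus (carrier A) (carrier B) \<Longrightarrow> ev w \<in> carrier G"
proof (induction w)
  case Nil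
  then show ?case using group.is_monoid[OF group_G] monoid.one_closed by fastforce
next
  case (Cons s w)
  then show ?case
    using letter_closed monoid.m_closed[OF group.is_monoid[OF group_G]] by simp
qed

lemma reduced_subset: "reduced w \<Longrightarrow> set w \<subseteq> Sum_Type.Plus (carrier A) (carrier B)"
  by (auto simp: reduced_def)

lemma ev_reduced_closed: "reduced w \<Longrightarrow> ev w \<in> carrier G"
  by (rule ev_closed[OF reduced_subset])

text \<open>Existence of normal forms, with the amalgamated part collected in front. A new letter
  absorbs that part and, if it belongs to the same factor, the first letter of the word; the result
  either falls into \<open>C\<close> or becomes a first letter itself.\<close>

lemma reduced_form:
  assumes "x \<in> carrier G"
  shows "\<exists>c w. c \<in> C \<and> reduced w \<and> x = inA c \<otimes>\<^bsub>G\<^esub> ev w"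
  using assms
proof (induction rule: amalgam_induct)
  interpret G: group G by (rule group_G)
  have oneC: "\<one>\<^bsub>A\<^esub> \<in> C" by (rule subgroup.one_closed[OF C])
  have one: "inA \<one>\<^bsub>A\<^esub> = \<one>\<^bsub>G\<^esub>" using hom_one[OF inA_hom A.is_group group_G] .
  {
    case one
    show ?case
      using oneC \<open>inA \<one>\<^bsub>A\<^esub> = \<one>\<^bsub>G\<^esub>\<close> by (intro exI[of _ "\<one>\<^bsub>A\<^esub>"] exI[of _ "[]"]) simp
  next
    case (left a x)
    then obtain c w where c: "c \<in> C" and w: "reduced w" and x: "x = inA c \<otimes>\<^bsub>G\<^esub> ev w" by blast
    have main: ?case if d: "d \<in> carrier A" and v: "reduced v" "v = [] \<or> \<not> isl (hd v)"
      and eq: "inA a \<otimes>\<^bsub>G\<^esub> x = inA d \<otimes>\<^bsub>G\<^esub> ev v" for d v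
    proof (cases "d \<in> C")
      case True
      then show ?thesis using v(1) eq by blast
    next
      case False
      then have "reduced (Inl d # v)" using d v by (auto simp: reduced_Cons)
      moreover have "inA a \<otimes>\<^bsub>G\<^esub> x = inA \<one>\<^bsub>A\<^esub> \<otimes>\<^bsub>G\<^esub> ev (Inl d # v)"
        using eq d ev_reduced_closed[OF v(1)] by (simp add: one inA_closed)
      ultimately show ?thesis using oneC by blast
    qed
    have ac: "a \<otimes>\<^bsub>A\<^esub> c \<in> carrier A" using left(1) C_mem[OF c] by simp
    have eq: "inA a \<otimes>\<^bsub>G\<^esub> x = inA (a \<otimes>\<^bsub>A\<^esub> c) \<otimes>\<^bsub>G\<^esub> ev w"
      using left(1) C_mem[OF c] ev_reduced_closed[OF w]
      by (simp add: x hom_mult[OF inA_hom] G.m_assoc inA_closed)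
    show ?case
    proof (cases "w = [] \<or> \<not> isl (hd w)")
      case True
      then show ?thesis using main[OF ac w _ eq] by blast
    next
      case False
      then obtain d v where v: "w = Inl d # v" by (cases w; cases "hd w") auto
      then have d: "d \<in> carrier A" and red: "reduced v" "v = [] \<or> \<not> isl (hd v)"
        using w by (auto simp: reduced_Cons)
      have "inA a \<otimes>\<^bsub>G\<^esub> x = inA (a \<otimes>\<^bsub>A\<^esub> c \<otimes>\<^bsub>A\<^esub> d) \<otimes>\<^bsub>G\<^esub> ev v"
        using ac d ev_reduced_closed[OF red(1)]
        by (simp add: eq v hom_mult[OF inA_hom] G.m_assoc inA_closed)
      then show ?thesis using main[OF _ red] ac d by simp
    qed
  next
    case (right b x)
    then obtain c w where c: "c \<in> C" and w: "reduced w" and x: "x = inA c \<otimes>\<^bsub>G\<^esub> ev w" by blast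
    have main: ?case if d: "d \<in> carrier B" and v: "reduced v" "v = [] \<or> isl (hd v)"
      and eq: "inB b \<otimes>\<^bsub>G\<^esub> x = inB d \<otimes>\<^bsub>G\<^esub> ev v" for d v
    proof (cases "d \<in> \<phi> ` C")
      case True
      \<comment> \<open>An element of the image of \<open>C\<close> is read again as an element of
        \<open>C\<close>, as the normal form requires its front part in \<open>A\<close>.\<close>
      then show ?thesis using v(1) eq inA_agree by force
    next
      case False
      then have "reduced (Inr d # v)" using d v by (auto simp: reduced_Cons)
      moreover have "inB b \<otimes>\<^bsub>G\<^esub> x = inA \<one>\<^bsub>A\<^esub> \<otimes>\<^bsub>G\<^esub> ev (Inr d # v)"
        using eq d ev_reduced_closed[OF v(1)] by (simp add: one inB_closed)
      ultimately show ?thesis using oneC by blast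
    qed
    have bc: "b \<otimes>\<^bsub>B\<^esub> \<phi> c \<in> carrier B" using right(1) \<phi>_mem[OF c] by simp
    have eq: "inB b \<otimes>\<^bsub>G\<^esub> x = inB (b \<otimes>\<^bsub>B\<^esub> \<phi> c) \<otimes>\<^bsub>G\<^esub> ev w"
      using right(1) \<phi>_mem[OF c] ev_reduced_closed[OF w]
      by (simp add: x inA_agree[OF c] hom_mult[OF inB_hom] G.m_assoc inB_closed)
    show ?case
    proof (cases "w = [] \<or> isl (hd w)")
      case True
      then show ?thesis using main[OF bc w _ eq] by blast
    next
      case False
      then obtain d v where v: "w = Inr d # v" by (cases w; cases "hd w") auto
      then have d: "d \<in> carrier B" and red: "reduced v" "v = [] \<or> isl (hd v)"
        using w by (auto simp: reduced_Cons)
      have "inB b \<otimes>\<^bsub>G\<^esub> x = inB (b \<otimes>\<^bsub>B\<^esub> \<phi> c \<otimes>\<^bsub>B\<^esub> d) \<otimes>\<^bsub>G\<^esub> ev v"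
        using bc d ev_reduced_closed[OF red(1)]
        by (simp add: eq v hom_mult[OF inB_hom] G.m_assoc inB_closed)
      then show ?thesis using main[OF _ red] bc d by simp
    qed
  }
qed

text \<open>\<open>m\<close> is the indicator function of the vertex \<open>C\<close> in the coset graph of \<open>Q = G / N\<close>.  The
  crossed homomorphism \<open>\<delta>\<close> with \<open>\<delta> a = 0\<close> and \<open>\<delta> b = b \<cdot> m - m\<close> counts the edges of the path
  described by a word.  As the word \<open>s # t # v\<close> returns to the coset of the first letter \<open>s\<close> at
  no other time, \<open>\<delta>\<close> takes the value \<open>1\<close> or \<open>-1\<close> there.\<close>

lemma separate_longer_words:
  assumes N: "N \<lhd> G" "solvable (G Mod N)"
    and sep: "\<And>w c. \<lbrakk>reduced w; w \<noteq> []; length w \<le> n; c \<in> C\<rbrakk> \<Longrightarrow> inA c \<otimes>\<^bsub>G\<^esub> ev w \<notin> N"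
    and n: "n \<ge> 1"
  obtains N' where "N' \<lhd> G" "solvable (G Mod N')" "N' \<subseteq> N"
    "\<And>w c. \<lbrakk>reduced w; w \<noteq> []; length w \<le> Suc n; c \<in> C\<rbrakk> \<Longrightarrow> inA c \<otimes>\<^bsub>G\<^esub> ev w \<notin> N'"
proof -
  interpret G: group G by (rule group_G)
  interpret N: normal N G by (rule N(1))
  define Q where "Q = G Mod N"
  define \<pi> where "\<pi> x = N #>\<^bsub>G\<^esub> x" for x
  interpret \<pi>: group_hom G Q \<pi>
    unfolding Q_def \<pi>_def[abs_def] by (rule N.group_hom_rcoset)
  interpret \<pi>A: group_hom A Q "\<lambda>a. \<pi> (inA a)"
    using hom_compose[OF inA_hom \<pi>.homh]
    by (simp add: group_hom_def group_hom_axioms_def o_def A.is_group \<pi>.H.is_group)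
  interpret \<pi>B: group_hom B Q "\<lambda>b. \<pi> (inB b)"
    using hom_compose[OF inB_hom \<pi>.homh]
    by (simp add: group_hom_def group_hom_axioms_def o_def B.is_group \<pi>.H.is_group)
  define K where "K = (\<lambda>c. \<pi> (inA c)) ` C"
  have K: "subgroup K Q"
    unfolding K_def by (rule \<pi>A.subgroup_img_is_subgroup[OF C])
  define m where "m y = (if y \<in> K then 1 else 0 :: int)" for y
  have m_inv: "m (inv\<^bsub>Q\<^esub> y) = m y" if "y \<in> carrier Q" for y
    using that subgroup.m_inv_closed[OF K, of y] subgroup.m_inv_closed[OF K, of "inv\<^bsub>Q\<^esub> y"]
    by (auto simp: m_def)
  have m_mult: "m (inv\<^bsub>Q\<^esub> k \<otimes>\<^bsub>Q\<^esub> y) = m y" if k: "k \<in> K" and y: "y \<in> carrier Q" for k y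
  proof -
    have kQ: "k \<in> carrier Q" using subgroup.mem_carrier[OF K k] .
    have "y \<in> K" if "inv\<^bsub>Q\<^esub> k \<otimes>\<^bsub>Q\<^esub> y \<in> K"
      using subgroup.m_closed[OF K k that] kQ y by (simp add: \<pi>.H.inv_mult_cancel)
    moreover have "inv\<^bsub>Q\<^esub> k \<otimes>\<^bsub>Q\<^esub> y \<in> K" if "y \<in> K"
      using subgroup.m_closed[OF K subgroup.m_inv_closed[OF K k] that] .
    ultimately show ?thesis by (auto simp: m_def)
  qed
  \<comment> \<open>The hypothesis on \<open>N\<close>, restated: a short nonempty reduced word does
    not return to the vertex \<open>C\<close> of the coset graph.\<close>
  have notin: "\<pi> (ev w) \<notin> K" if w: "reduced w" "w \<noteq> []" "length w \<le> n" for w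
  proof
    assume "\<pi> (ev w) \<in> K"
    then obtain d where d: "d \<in> C" "\<pi> (ev w) = \<pi> (inA d)" by (auto simp: K_def)
    have d': "inv\<^bsub>A\<^esub> d \<in> C" by (rule subgroup.m_inv_closed[OF C d(1)])
    have "\<pi> (inA (inv\<^bsub>A\<^esub> d) \<otimes>\<^bsub>G\<^esub> ev w) = \<one>\<^bsub>Q\<^esub>"
      using d C_mem[OF d(1)] ev_reduced_closed[OF w(1)] by (simp add: inA_closed)
    then have "inA (inv\<^bsub>A\<^esub> d) \<otimes>\<^bsub>G\<^esub> ev w \<in> N"
      using N.rcoset_eq_one_iff[of "inA (inv\<^bsub>A\<^esub> d) \<otimes>\<^bsub>G\<^esub> ev w"] C_mem[OF d']
        ev_reduced_closed[OF w(1)] by (simp add: Q_def \<pi>_def inA_closed)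
    then show False using sep[OF w d'] by contradiction
  qed
  let ?W = "wreath integer_group Q"
  have W: "group ?W" by (rule group_wreath) (simp_all add: \<pi>.H.is_group)
  have f: "(\<lambda>a. (\<lambda>y \<in> carrier Q. 0, \<pi> (inA a))) \<in> hom A ?W"
    by (rule wreath_homI[OF \<pi>A.homh]) (auto simp: A.is_group)
  have g: "(\<lambda>b. (\<lambda>y \<in> carrier Q. m (inv\<^bsub>Q\<^esub> (\<pi> (inB b)) \<otimes>\<^bsub>Q\<^esub> y) - m y, \<pi> (inB b))) \<in> hom B ?W"
    by (rule wreath_homI[OF \<pi>B.homh]) (auto simp: B.is_group \<pi>.H.inv_mult_group \<pi>.H.m_assoc)
  \<comment> \<open>The two crossed homomorphisms agree on \<open>C\<close> because \<open>m\<close>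
    is invariant under left translation by \<open>K\<close>.\<close>
  have fg: "(\<lambda>y \<in> carrier Q. 0, \<pi> (inA c)) =
      (\<lambda>y \<in> carrier Q. m (inv\<^bsub>Q\<^esub> (\<pi> (inB (\<phi> c))) \<otimes>\<^bsub>Q\<^esub> y) - m y, \<pi> (inB (\<phi> c)))" if "c \<in> C" for c
    using m_mult[of "\<pi> (inA c)"] that by (simp add: K_def inA_agree cong: restrict_cong)
  obtain h where h: "h \<in> hom G ?W"
    and hA: "\<And>a. a \<in> carrier A \<Longrightarrow> h (inA a) = (\<lambda>y \<in> carrier Q. 0, \<pi> (inA a))"
    and hB: "\<And>b. b \<in> carrier B \<Longrightarrow>
      h (inB b) = (\<lambda>y \<in> carrier Q. m (inv\<^bsub>Q\<^esub> (\<pi> (inB b)) \<otimes>\<^bsub>Q\<^esub> y) - m y, \<pi> (inB b))"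
    using universal[OF W f g fg] by blast
  interpret h: group_hom G ?W h
    using h W by (simp add: group_hom_def group_hom_axioms_def group_G)
  define \<delta> where "\<delta> x = fst (h x)" for x
  have h_mult: "h (x \<otimes>\<^bsub>G\<^esub> y) = (\<lambda>q \<in> carrier Q. \<delta> x q + \<delta> y (inv\<^bsub>Q\<^esub> (snd (h x)) \<otimes>\<^bsub>Q\<^esub> q),
      snd (h x) \<otimes>\<^bsub>Q\<^esub> snd (h y))" if "x \<in> carrier G" "y \<in> carrier G" for x y
    using h.hom_mult[OF that] by (cases "h x"; cases "h y") (simp add: \<delta>_def)
  have snd_h: "snd (h x) = \<pi> x" if "x \<in> carrier G" for x
    using that
    by (induction rule: amalgam_induct) (simp_all add: hA hB h_mult inA_closed inB_closed del: h.hom_mult)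
  have \<delta>_mult: "\<delta> (x \<otimes>\<^bsub>G\<^esub> y) q = \<delta> x q + \<delta> y (inv\<^bsub>Q\<^esub> (\<pi> x) \<otimes>\<^bsub>Q\<^esub> q)"
    if "x \<in> carrier G" "y \<in> carrier G" "q \<in> carrier Q" for x y q
    using h_mult[OF that(1,2)] that(3) snd_h[OF that(1)] by (simp add: \<delta>_def)
  have \<delta>_one: "\<delta> \<one>\<^bsub>G\<^esub> q = 0" if "q \<in> carrier Q" for q
    using that by (simp add: \<delta>_def)
  have \<delta>_inA: "\<delta> (inA a) q = 0" if "a \<in> carrier A" "q \<in> carrier Q" for a q
    using that by (simp add: \<delta>_def hA)
  have \<delta>_inB: "\<delta> (inB b) q = m (inv\<^bsub>Q\<^esub> (\<pi> (inB b)) \<otimes>\<^bsub>Q\<^esub> q) - m q"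
    if "b \<in> carrier B" "q \<in> carrier Q" for b q
    using that by (simp add: \<delta>_def hB)
  \<comment> \<open>A letter from \<open>B\<close> contributes the difference of \<open>m\<close> at
    two successive translates of \<open>q\<close>; if no prefix brings \<open>q\<close> into
    \<open>K\<close>, every contribution is zero.\<close>
  have \<delta>_zero: "\<delta> (ev v) q = 0"
    if "set v \<subseteq> Sum_Type.Plus (carrier A) (carrier B)" "q \<in> carrier Q"
      "\<And>p r. v = p @ r \<Longrightarrow> inv\<^bsub>Q\<^esub> (\<pi> (ev p)) \<otimes>\<^bsub>Q\<^esub> q \<notin> K" for v q
    using that
  proof (induction v arbitrary: q)
    case Nil
    then show ?case by (simp add: \<delta>_one)
  next
    case (Cons s v)
    have s: "s \<in> Sum_Type.Plus (carrier A) (carrier B)" "letter s \<in> carrier G" and v: "set v \<subseteq> Sum_Type.Plus (carrier A) (carrier B)"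
      "ev v \<in> carrier G"
      using Cons.prems(1) letter_closed ev_closed[of v] by auto
    let ?q = "inv\<^bsub>Q\<^esub> (\<pi> (letter s)) \<otimes>\<^bsub>Q\<^esub> q"
    have q': "?q \<in> carrier Q" using s Cons.prems(2) by simp
    have "q \<notin> K" "?q \<notin> K"
      using Cons.prems(3)[of "[]" "s # v"] Cons.prems(3)[of "[s]" v] Cons.prems(2) s by simp_all
    then have "\<delta> (letter s) q = 0"
      using s(1) Cons.prems(2) by (auto simp: \<delta>_inA \<delta>_inB m_def)
    moreover have "\<delta> (ev v) ?q = 0"
    proof (rule Cons.IH[OF v(1) q'])
      fix p r assume vp: "v = p @ r"
      then have "ev p \<in> carrier G" using v(1) by (intro ev_closed) auto
      then show "inv\<^bsub>Q\<^esub> (\<pi> (ev p)) \<otimes>\<^bsub>Q\<^esub> ?q \<notin> K"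
        using Cons.prems(3)[of "s # p" r] vp Cons.prems(2) s
        by (simp add: \<pi>.H.inv_mult_group \<pi>.H.m_assoc)
    qed
    ultimately show ?case
      using \<delta>_mult[OF s(2) v(2) Cons.prems(2)] by simp
  qed
  have m_one: "m \<one>\<^bsub>Q\<^esub> = 1" using subgroup.one_closed[OF K] by (simp add: m_def)
  have "inA c \<otimes>\<^bsub>G\<^esub> ev w \<notin> kernel G ?W h"
    if w: "reduced w" "w \<noteq> []" "length w \<le> Suc n" and c: "c \<in> C" for w c
  proof
    assume "inA c \<otimes>\<^bsub>G\<^esub> ev w \<in> kernel G ?W h"
    then have one: "h (inA c \<otimes>\<^bsub>G\<^esub> ev w) = \<one>\<^bsub>?W\<^esub>" by (simp add: kernel_def)
    have cG: "inA c \<in> carrier G" and wG: "ev w \<in> carrier G"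
      using inA_closed[OF C_mem[OF c]] ev_reduced_closed[OF w(1)] .
    have zero: "\<delta> (ev w) q = 0" if q: "q \<in> carrier Q" for q
    proof -
      have q': "\<pi> (inA c) \<otimes>\<^bsub>Q\<^esub> q \<in> carrier Q" using q cG by simp
      have "\<delta> (inA c \<otimes>\<^bsub>G\<^esub> ev w) (\<pi> (inA c) \<otimes>\<^bsub>Q\<^esub> q) = 0"
        using one q' by (simp add: \<delta>_def)
      then show ?thesis
        using \<delta>_mult[OF cG wG q'] \<delta>_inA[OF C_mem[OF c] q'] q cG by (simp add: \<pi>.H.inv_mult_cancel)
    qed
    show False
    proof (cases "length w \<le> n")
      case True
      have "inA c \<otimes>\<^bsub>G\<^esub> ev w \<in> N"
        using snd_h[of "inA c \<otimes>\<^bsub>G\<^esub> ev w"] one cG wG N.rcoset_eq_one_iff[of "inA c \<otimes>\<^bsub>G\<^esub> ev w"]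
        by (simp add: Q_def \<pi>_def)
      then show False using sep[OF w(1,2) True c] by contradiction
    next
      case False
      \<comment> \<open>The length exceeds \<open>n\<close>, which is at least 1, so there are two
        letters.\<close>
      then obtain s t v where stv: "w = s # t # v"
        using n w(3) by (cases w; cases "tl w") auto
      have st: "reduced [s]" "reduced [t]" "isl s \<noteq> isl t" "reduced (t # v)" "length (t # v) \<le> n"
        using w stv by (auto simp: reduced_Cons)
      have mem: "letter s \<in> carrier G" "letter t \<in> carrier G" "ev v \<in> carrier G"
        using ev_reduced_closed[of "[s]"] reduced_subset[OF st(1)] reduced_subset[OF st(2)]
          reduced_subset[OF st(4)] by (auto intro!: letter_closed ev_closed)
      have sK: "\<pi> (letter s) \<notin> K" and tK: "\<pi> (letter t) \<notin> K"
        using notin[OF st(1)] notin[OF st(2)] n mem by simp_all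
      \<comment> \<open>Evaluation starts at the image of \<open>s\<close>, so after
        \<open>s\<close> the point is the identity and after \<open>t\<close> it is the inverse of
        the image of \<open>t\<close>. A further prefix \<open>p\<close> leads to the inverse of the
        image of \<open>t # p\<close>, a reduced word of length at most \<open>n\<close>.\<close>
      have "\<delta> (ev v) (inv\<^bsub>Q\<^esub> (\<pi> (letter t))) = 0"
      proof (rule \<delta>_zero)
        show "set v \<subseteq> Sum_Type.Plus (carrier A) (carrier B)" using reduced_subset[OF st(4)] by simp
        show "inv\<^bsub>Q\<^esub> (\<pi> (letter t)) \<in> carrier Q" using mem by simp
      next
        fix p r assume "v = p @ r"
        then have tp: "reduced (t # p)" "length (t # p) \<le> n"
          using reduced_appendD[of "t # p" r] st by auto
        have p: "ev p \<in> carrier G" using reduced_subset[OF tp(1)] by (intro ev_closed) auto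
        have "\<pi> (ev (t # p)) \<notin> K" using notin[OF tp(1) _ tp(2)] by simp
        then have "inv\<^bsub>Q\<^esub> (\<pi> (ev (t # p))) \<notin> K"
          using subgroup.m_inv_closed[OF K, of "inv\<^bsub>Q\<^esub> (\<pi> (ev (t # p)))"] mem p by auto
        then show "inv\<^bsub>Q\<^esub> (\<pi> (ev p)) \<otimes>\<^bsub>Q\<^esub> inv\<^bsub>Q\<^esub> (\<pi> (letter t)) \<notin> K"
          using mem p by (simp add: \<pi>.H.inv_mult_group)
      qed
      then have "\<delta> (ev (t # v)) \<one>\<^bsub>Q\<^esub> = \<delta> (letter t) \<one>\<^bsub>Q\<^esub>"
        using \<delta>_mult[OF mem(2,3), of "\<one>\<^bsub>Q\<^esub>"] mem by simp
      then have "\<delta> (ev w) (\<pi> (letter s)) = \<delta> (letter s) (\<pi> (letter s)) + \<delta> (letter t) \<one>\<^bsub>Q\<^esub>"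
        using \<delta>_mult[OF mem(1), of "ev (t # v)" "\<pi> (letter s)"] mem by (simp add: stv)
      then have "\<delta> (letter s) (\<pi> (letter s)) + \<delta> (letter t) \<one>\<^bsub>Q\<^esub> = 0"
        using zero mem by simp
      \<comment> \<open>Just one of \<open>s\<close> and \<open>t\<close> comes from
        \<open>B\<close>; it contributes 1 or -1, the other 0, so the sum cannot vanish.\<close>
      moreover have "\<delta> (letter s) (\<pi> (letter s)) = (if isl s then 0 else 1)"
        using st(1) mem sK m_one by (cases s) (auto simp: reduced_Cons \<delta>_inA \<delta>_inB m_def)
      moreover have "\<delta> (letter t) \<one>\<^bsub>Q\<^esub> = (if isl t then 0 else - 1)"
        using st(2) mem tK m_one m_inv[of "\<pi> (letter t)"]
        by (cases t) (auto simp: reduced_Cons \<delta>_inA \<delta>_inB m_def)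
      ultimately show False using st(3) by (simp split: if_splits)
    qed
  qed
  moreover have "kernel G ?W h \<subseteq> N"
  proof
    fix x assume "x \<in> kernel G ?W h"
    then have "x \<in> carrier G" "\<pi> x = \<one>\<^bsub>Q\<^esub>"
      using snd_h[of x] by (auto simp: kernel_def)
    then show "x \<in> N" using N.rcoset_eq_one_iff[of x] by (simp add: Q_def \<pi>_def)
  qed
  moreover have "solvable (G Mod kernel G ?W h)"
    using N(2) by (intro h.solvable_Mod_kernel solvable_wreath abelian_integer_group)
      (simp_all add: Q_def N.factorgroup_is_group)
  ultimately show ?thesis using that h.normal_kernel by blast
qed

text \<open>The trivial trace handles single letters: if \<open>c\<close> times a letter dies, it is
  trivial in its factor, and the letter would lie in the amalgamated subgroup. The index is shifted
  by one, so the induction starts at length 1. The clause on \<open>A\<close> covers the empty word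
  and survives because the subgroups shrink.\<close>

lemma separate_words:
  assumes "solvable_trace {\<one>\<^bsub>A\<^esub>} {\<one>\<^bsub>B\<^esub>}"
  shows "\<exists>N. N \<lhd> G \<and> solvable (G Mod N) \<and> (\<forall>a \<in> carrier A. inA a \<in> N \<longrightarrow> a = \<one>\<^bsub>A\<^esub>) \<and>
    (\<forall>w c. reduced w \<and> w \<noteq> [] \<and> length w \<le> Suc n \<and> c \<in> C \<longrightarrow> inA c \<otimes>\<^bsub>G\<^esub> ev w \<notin> N)"
proof (induction n)
  case 0
  interpret G: group G by (rule group_G)
  obtain N where N: "N \<lhd> G" "solvable (G Mod N)"
    and triv: "{\<one>\<^bsub>A\<^esub>} = {a \<in> carrier A. inA a \<in> N}" "{\<one>\<^bsub>B\<^esub>} = {b \<in> carrier B. inB b \<in> N}"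
    using assms unfolding solvable_trace_def by blast
  have "inA c \<otimes>\<^bsub>G\<^esub> ev w \<notin> N" if w: "reduced w" "w \<noteq> []" "length w \<le> Suc 0" and c: "c \<in> C" for w c
  proof
    assume in_N: "inA c \<otimes>\<^bsub>G\<^esub> ev w \<in> N"
    obtain s where s: "w = [s]" using w(2,3) by (cases w) auto
    show False
    proof (cases s)
      case (Inl a)
      then have a: "a \<in> carrier A" "a \<notin> C" using w(1) s by (auto simp: reduced_Cons)
      have "inA c \<otimes>\<^bsub>G\<^esub> ev w = inA (c \<otimes>\<^bsub>A\<^esub> a)"
        using a C_mem[OF c] by (simp add: s Inl hom_mult[OF inA_hom] inA_closed)
      then have "c \<otimes>\<^bsub>A\<^esub> a = \<one>\<^bsub>A\<^esub>"
        using triv(1) in_N a C_mem[OF c] by auto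
      then have "a = inv\<^bsub>A\<^esub> c"
        using a C_mem[OF c] A.inv_equality[of a c] A.inv_comm by metis
      then show False using a(2) subgroup.m_inv_closed[OF C c] by simp
    next
      case (Inr b)
      then have b: "b \<in> carrier B" "b \<notin> \<phi> ` C" using w(1) s by (auto simp: reduced_Cons)
      have "inA c \<otimes>\<^bsub>G\<^esub> ev w = inB (\<phi> c \<otimes>\<^bsub>B\<^esub> b)"
        using b \<phi>_mem[OF c] by (simp add: s Inr inA_agree[OF c] hom_mult[OF inB_hom] inB_closed)
      then have "\<phi> c \<otimes>\<^bsub>B\<^esub> b = \<one>\<^bsub>B\<^esub>"
        using triv(2) in_N b \<phi>_mem[OF c] by auto
      then have "b = inv\<^bsub>B\<^esub> (\<phi> c)"
        using b \<phi>_mem[OF c] B.inv_equality[of b "\<phi> c"] B.inv_comm by metis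
      also have "\<dots> = \<phi> (inv\<^bsub>A\<^esub> c)"
        using \<phi>_int_pow[OF c, of "-1"] C_mem[OF c] \<phi>_mem[OF c] by (simp add: A.int_pow_neg B.int_pow_neg)
      finally show False using b(2) subgroup.m_inv_closed[OF C c] by blast
    qed
  qed
  moreover have "\<forall>a \<in> carrier A. inA a \<in> N \<longrightarrow> a = \<one>\<^bsub>A\<^esub>" using triv(1) by blast
  ultimately show ?case using N by blast
next
  case (Suc n)
  then obtain N where N: "N \<lhd> G" "solvable (G Mod N)"
    and triv: "\<forall>a \<in> carrier A. inA a \<in> N \<longrightarrow> a = \<one>\<^bsub>A\<^esub>"
    and sep: "\<And>w c. \<lbrakk>reduced w; w \<noteq> []; length w \<le> Suc n; c \<in> C\<rbrakk> \<Longrightarrow> inA c \<otimes>\<^bsub>G\<^esub> ev w \<notin> N"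
    by metis
  obtain N' where "N' \<lhd> G" "solvable (G Mod N')" "N' \<subseteq> N"
    "\<And>w c. \<lbrakk>reduced w; w \<noteq> []; length w \<le> Suc (Suc n); c \<in> C\<rbrakk> \<Longrightarrow> inA c \<otimes>\<^bsub>G\<^esub> ev w \<notin> N'"
    using separate_longer_words[OF N sep] by auto
  then show ?case using triv by (intro exI[of _ N']) blast
qed

text \<open>The quotient depends on the element: it is chosen for the length of a normal form. An
  element with empty reduced word lies in the image of \<open>C\<close> and is handled by
  injectivity on \<open>A\<close>.\<close>

lemma residually_solvable_if_trivial_trace:
  assumes "solvable_trace {\<one>\<^bsub>A\<^esub>} {\<one>\<^bsub>B\<^esub>}"
  shows "residually_solvable G"
proof (rule group.residually_solvableI[OF group_G])
  interpret G: group G by (rule group_G)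
  fix x assume x: "x \<in> carrier G" "x \<noteq> \<one>\<^bsub>G\<^esub>"
  obtain c w where c: "c \<in> C" and w: "reduced w" and xw: "x = inA c \<otimes>\<^bsub>G\<^esub> ev w"
    using reduced_form[OF x(1)] by blast
  obtain N where N: "N \<lhd> G" "solvable (G Mod N)" and triv: "\<forall>a \<in> carrier A. inA a \<in> N \<longrightarrow> a = \<one>\<^bsub>A\<^esub>"
    and sep: "\<forall>v d. reduced v \<and> v \<noteq> [] \<and> length v \<le> Suc (length w) \<and> d \<in> C \<longrightarrow> inA d \<otimes>\<^bsub>G\<^esub> ev v \<notin> N"
    using separate_words[OF assms] by metis
  have "x \<notin> N"
  proof (cases "w = []")
    case True
    then have "x = inA c" using xw inA_closed[OF C_mem[OF c]] by simp
    then show ?thesis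
      using triv C_mem[OF c] x(2) hom_one[OF inA_hom A.is_group group_G] by metis
  next
    case False
    then show ?thesis using sep w c xw by simp
  qed
  then have "N #>\<^bsub>G\<^esub> x \<noteq> \<one>\<^bsub>G Mod N\<^esub>"
    using normal.rcoset_eq_one_iff[OF N(1) x(1)] by blast
  moreover have "(\<lambda>x. N #>\<^bsub>G\<^esub> x) \<in> epi G (G Mod N)"
    using normal.r_coset_hom_Mod[OF N(1)] by (simp add: epi_def carrier_FactGroup)
  ultimately show "\<exists>(H :: ('a + 'c) list set set set monoid) f.
      group H \<and> solvable H \<and> f \<in> epi G H \<and> f x \<noteq> \<one>\<^bsub>H\<^esub>"
    using N normal.factorgroup_is_group by blast
qed

end

theorem theorem2:
  fixes A :: "('a, 'm) monoid_scheme" and B :: "('b, 'n) monoid_scheme"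
    and C\<^sub>A :: "'a set" and C\<^sub>B :: "'b set" and \<phi> :: "'a \<Rightarrow> 'b"
  assumes "group A" and "finitely_generated_group A" and "nilpotent_group A"
    and "group B" and "finitely_generated_group B" and "nilpotent_group B"
    and "subgroup C\<^sub>A A" and "cyclic_group (A\<lparr>carrier := C\<^sub>A\<rparr>)"
    and "subgroup C\<^sub>B B" and "cyclic_group (B\<lparr>carrier := C\<^sub>B\<rparr>)"
    and "\<phi> \<in> iso (A\<lparr>carrier := C\<^sub>A\<rparr>) (B\<lparr>carrier := C\<^sub>B\<rparr>)"
  shows "residually_solvable (amalgamated_product A B C\<^sub>A \<phi>)"
proof -
  have "group (A\<lparr>carrier := C\<^sub>A\<rparr>)"
    by (rule subgroup.subgroup_is_group[OF assms(7,1)])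
  then obtain c where c: "c \<in> C\<^sub>A" "C\<^sub>A = range (\<lambda>t::int. c [^]\<^bsub>A\<lparr>carrier := C\<^sub>A\<rparr>\<^esub> t)"
    using assms(8) by (auto simp: group.cyclic_group)
  have "c [^]\<^bsub>A\<lparr>carrier := C\<^sub>A\<rparr>\<^esub> t = c [^]\<^bsub>A\<^esub> t" for t :: int
    using group.int_pow_consistent[OF assms(1,7) c(1)] by simp
  then have C_eq: "C\<^sub>A = range (\<lambda>t::int. c [^]\<^bsub>A\<^esub> t)"
    using c(2) by simp
  \<comment> \<open>The isomorphism is composed with the inclusion of \<open>C\<^sub>B\<close> into
    \<open>B\<close>.\<close>
  have "\<phi> \<in> hom (A\<lparr>carrier := C\<^sub>A\<rparr>) B" "inj_on \<phi> C\<^sub>A"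
    using assms(11) subgroup.mem_carrier[OF assms(9)] by (auto simp: iso_def hom_def bij_betw_def)
  then interpret cyclic_amalgam A B C\<^sub>A \<phi> c
    using assms c(1) C_eq
    by (simp add: cyclic_amalgam_def cyclic_amalgam_axioms_def amalgam_def amalgam_axioms_def
        two_groups_def)
  show ?thesis
    by (rule residually_solvable_if_trivial_trace[OF solvable_trace_trivial])
qed

end
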